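(* Let $G$ be a simple plane graph, let $J$ be its line graph, and let $k:=\max\{10,\Delta(G)+1\}$. If $L$ is a $k$-assignment for $J$, then $J$ is $L$-swappable.
   Context: A list assignment $L$ for a graph assigns to each vertex $v$ a set $L(v)$ of colors; it is a $k$-assignment if $|L(v)|=k$ for all $v$. An $L$-coloring is a proper coloring $\varphi$ with $\varphi(v)\in L(v)$ for all $v$. An $\alpha,\beta$-Kempe swap interchanges colors $\alpha,\beta$ on one connected component of the subgraph induced by vertices colored $\alpha$ or $\beta$; it is $L$-valid for $\varphi$ if the result is again an $L$-coloring. A graph is $L$-swappable if every two of its $L$-colorings can be transformed into each other by a sequence of $L$-valid Kempe swaps. A plane graph is a planar graph with a fixed planar embedding. The line graph has vertex set $E(G)$, two edges adjacent iff they share an endpoint. *)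

theory Defs
  imports "HOL-Analysis.Analysis"
begin

type_synonym 'a graph = "'a set \<times> 'a set set"

abbreviation verts :: "'a graph \<Rightarrow> 'a set" where "verts \<equiv> fst"
abbreviation edges :: "'a graph \<Rightarrow> 'a set set" where "edges \<equiv> snd"

definition simple_graph :: "'a graph \<Rightarrow> bool" where
  "simple_graph G \<longleftrightarrow>
     finite (verts G) \<and> (\<forall>e\<in>edges G. e \<subseteq> verts G \<and> card e = 2)"

definition degree :: "'a graph \<Rightarrow> 'a \<Rightarrow> nat" where
  "degree G v = card {e \<in> edges G. v \<in> e}"

(* The 0 only matters for the graph without vertices, whose maximum degree is taken to be 0. *)
definition max_degree :: "'a graph \<Rightarrow> nat" where
  "max_degree G = Max (insert 0 (degree G ` verts G))"

(* A planar embedding consists of the points p v representing the vertices and the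
   simple arcs c e representing the edges. Arcs meet vertex points only at their own ends,
   and two different arcs meet only in the points of common end vertices. *)
definition plane_graph :: "'a graph \<Rightarrow> ('a \<Rightarrow> complex) \<Rightarrow> ('a set \<Rightarrow> real \<Rightarrow> complex) \<Rightarrow> bool" where
  "plane_graph G p c \<longleftrightarrow>
     simple_graph G \<and>
     inj_on p (verts G) \<and>
     (\<forall>e\<in>edges G. arc (c e) \<and> {pathstart (c e), pathfinish (c e)} = p ` e) \<and>
     (\<forall>e\<in>edges G. path_image (c e) \<inter> p ` verts G \<subseteq> p ` e) \<and>
     (\<forall>e\<in>edges G. \<forall>f\<in>edges G. e \<noteq> f \<longrightarrow>
        path_image (c e) \<inter> path_image (c f) \<subseteq> p ` (e \<inter> f))"

definition line_graph :: "'a graph \<Rightarrow> 'a set graph" where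
  "line_graph G =
     (edges G, {{e, f} |e f. e \<in> edges G \<and> f \<in> edges G \<and> e \<noteq> f \<and> e \<inter> f \<noteq> {}})"

definition induced_subgraph :: "'a graph \<Rightarrow> 'a set \<Rightarrow> 'a graph" where
  "induced_subgraph G W = (verts G \<inter> W, {e \<in> edges G. e \<subseteq> W})"

definition graph_components :: "'a graph \<Rightarrow> 'a set set" where
  "graph_components G = {{y. (\<lambda>u v. {u, v} \<in> edges G)\<^sup>*\<^sup>* x y} |x. x \<in> verts G}"

definition k_assignment :: "nat \<Rightarrow> 'a graph \<Rightarrow> ('a \<Rightarrow> 'c set) \<Rightarrow> bool" where
  "k_assignment k G L \<longleftrightarrow> (\<forall>v\<in>verts G. finite (L v) \<and> card (L v) = k)"

(* Colorings are extensional functions, so that two colorings are equal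
   as soon as they agree on all vertices. *)
definition L_coloring :: "'a graph \<Rightarrow> ('a \<Rightarrow> 'c set) \<Rightarrow> ('a \<Rightarrow> 'c) \<Rightarrow> bool" where
  "L_coloring G L \<phi> \<longleftrightarrow>
     \<phi> \<in> (\<Pi>\<^sub>E v\<in>verts G. L v) \<and> (\<forall>u v. {u, v} \<in> edges G \<longrightarrow> \<phi> u \<noteq> \<phi> v)"

definition kempe_swap ::
    "'a graph \<Rightarrow> 'c \<Rightarrow> 'c \<Rightarrow> ('a \<Rightarrow> 'c) \<Rightarrow> ('a \<Rightarrow> 'c) \<Rightarrow> bool" where
  "kempe_swap G \<alpha> \<beta> \<phi> \<psi> \<longleftrightarrow>
     \<alpha> \<noteq> \<beta> \<and>
     (\<exists>C \<in> graph_components (induced_subgraph G {v. \<phi> v = \<alpha> \<or> \<phi> v = \<beta>}).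
        \<psi> = (\<lambda>v. if v \<in> C then (if \<phi> v = \<alpha> then \<beta> else \<alpha>) else \<phi> v))"

definition valid_swap ::
    "'a graph \<Rightarrow> ('a \<Rightarrow> 'c set) \<Rightarrow> ('a \<Rightarrow> 'c) \<Rightarrow> ('a \<Rightarrow> 'c) \<Rightarrow> bool" where
  "valid_swap G L \<phi> \<psi> \<longleftrightarrow>
     L_coloring G L \<phi> \<and> L_coloring G L \<psi> \<and> (\<exists>\<alpha> \<beta>. kempe_swap G \<alpha> \<beta> \<phi> \<psi>)"

definition swappable :: "'a graph \<Rightarrow> ('a \<Rightarrow> 'c set) \<Rightarrow> bool" where
  "swappable G L \<longleftrightarrow>
     (\<forall>\<phi> \<psi>. L_coloring G L \<phi> \<longrightarrow> L_coloring G L \<psi> \<longrightarrow> (valid_swap G L)\<^sup>*\<^sup>* \<phi> \<psi>)"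

end

theory Submission
  imports Defs
begin

text \<open>
  Induction on the number of edges, for subgraphs with lists of the fixed size \<open>k\<close>. Planarity enters
  only through the bounds \<open>|E| \<le> 3|V| - 6\<close> and, for bipartite subgraphs, \<open>|E| \<le> 2|V|\<close>. A charge
  counting argument with these bounds yields an edge that meets fewer than \<open>k\<close> other edges, or a
  cycle \<open>C\<close> whose vertices have degrees \<open>3\<close> and \<open>k - 1\<close> alternately.

  In the first case every swap lifts from the graph without the edge. In the second case every edge of
  \<open>C\<close> has at least two colors that do not appear on its neighbors outside \<open>C\<close>. A swap outside \<open>C\<close>
  lifts because either the given coloring of \<open>C\<close> moves each of its colors along the cycle, and then
  the swap extends as it is, or all colorings of \<open>C\<close> over the current coloring are equivalent, and
  one of them can be chosen such that the swap extends. Hence it suffices to reach one outer coloring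
  that leaves three colors for some edge of \<open>C\<close>, since all its extensions are equivalent. Such a
  coloring is found by precoloring one or two edges next to \<open>C\<close>, and precolorings extend because the
  counting argument has enough slack.
\<close>

section \<open>Faces of plane drawings\<close>

text \<open>An edge of the exceptional cycle meets exactly \<open>k\<close> others, so its list is
  one color too short for the lifting argument of the first case. If every cycle edge has just two
  free colors, the cycle may have only two colorings over the outer one, and recoloring cannot
  connect them. So the lifting of a swap has to distinguish these frozen colorings from all others,
  and an outer coloring with a third free color can serve only as a common target.

  The limit of three marks is what the count tolerates. With at most \<open>M\<close> marks,
  planarity bounds three times the total charge by \<open>-3 * (12 - M)\<close>, while the weighted
  bipartite and forest bounds give at least \<open>-6 * M\<close>; these contradict each other
  exactly for \<open>M < 4\<close>. The constant 10 enters through neighbors: without a reducible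
  edge, a vertex of degree \<open>j\<close> has only neighbors of degree at least
  \<open>k + 2 - j\<close>, and the weights balance for the value \<open>12 - j\<close>.\<close>

lemma interior_arc_image:
  fixes g :: "real \<Rightarrow> complex"
  assumes "arc g"
  shows "interior (path_image g) = {}"
proof (rule ccontr)
  assume ne: "interior (path_image g) \<noteq> {}"
  obtain h where h: "homeomorphism {0..1} (path_image g) g h"
    by (metis arc_def assms compact_Icc continuous_on_path homeomorphism_compact order_refl path_def path_image_def)
  have "continuous_on (interior (path_image g)) h"
    using h continuous_on_subset interior_subset unfolding homeomorphism_def by blast
  moreover have "inj_on h (interior (path_image g))"
    using h interior_subset unfolding homeomorphism_def by (metis inj_onI subsetD)
  ultimately have "DIM(complex) \<le> DIM(real)"
    using invariance_of_dimension[of "interior (path_image g)" h] ne by blast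
  then show False by simp
qed

lemma connected_component_avoiding_arc:
  fixes g :: "real \<Rightarrow> complex"
  assumes "closed S" "x \<notin> S" "arc g"
  obtains y where "y \<notin> S \<union> path_image g" "connected_component (-S) x y"
proof -
  have "open (connected_component_set (-S) x)"
    using assms by (simp add: open_Compl open_connected_component)
  moreover have "x \<in> connected_component_set (-S) x"
    using assms by simp
  ultimately have "\<not> connected_component_set (-S) x \<subseteq> path_image g"
    using interior_arc_image[OF assms(3)] interior_maximal by (metis empty_iff subset_empty)
  then show ?thesis
    using that connected_component_in by blast
qed

text \<open>Points in different faces stand in for the faces. A lower bound on the number of faces
  is then the size of a finite sample, and samples can be moved and enlarged as arcs are
  added.\<close>

definition separated_points :: "complex set \<Rightarrow> complex set \<Rightarrow> bool" where
  "separated_points S P \<longleftrightarrow> finite P \<and> P \<inter> S = {} \<and>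
     (\<forall>x\<in>P. \<forall>y\<in>P. connected_component (-S) x y \<longrightarrow> x = y)"

lemma separated_points_subset: "separated_points S P \<Longrightarrow> Q \<subseteq> P \<Longrightarrow> separated_points S Q"
  unfolding separated_points_def by (meson disjoint_iff finite_subset subsetD)

lemma connected_component_Compl_mono:
  "connected_component (-T) x y \<Longrightarrow> S \<subseteq> T \<Longrightarrow> connected_component (-S) x y"
  by (meson Compl_anti_mono connected_component_of_subset)

text \<open>An arc has empty interior, so each sample point can be moved off it within its own face:
  adding an arc never loses a face.\<close>

lemma separated_points_avoiding_arc:
  assumes "closed S" "arc g" "separated_points S P"
  obtains f where "inj_on f P" "\<And>x. x \<in> P \<Longrightarrow> connected_component (-S) x (f x)"
    "separated_points (S \<union> path_image g) (f ` P)"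
proof -
  have "\<forall>x\<in>P. \<exists>y. y \<notin> S \<union> path_image g \<and> connected_component (-S) x y"
    using connected_component_avoiding_arc[OF assms(1) _ assms(2)] assms(3)
    unfolding separated_points_def by (metis disjoint_iff)
  then obtain f where f: "\<And>x. x \<in> P \<Longrightarrow> f x \<notin> S \<union> path_image g \<and> connected_component (-S) x (f x)"
    by metis
  have eq: "x = y" if "x \<in> P" "y \<in> P" "connected_component (-S) (f x) (f y)" for x y
    using that f assms(3) unfolding separated_points_def
    by (meson connected_component_sym connected_component_trans)
  have "inj_on f P"
    by (rule inj_onI) (metis eq f connected_component_refl ComplI UnI1)
  moreover have "separated_points (S \<union> path_image g) (f ` P)"
    unfolding separated_points_def
  proof (intro conjI ballI impI)
    show "finite (f ` P)" using assms(3) by (simp add: separated_points_def)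
    show "f ` P \<inter> (S \<union> path_image g) = {}" using f by blast
    fix u v assume "u \<in> f ` P" "v \<in> f ` P" "connected_component (-(S \<union> path_image g)) u v"
    then show "u = v" using eq connected_component_Compl_mono[of "S \<union> path_image g" u v S] by blast
  qed
  ultimately show ?thesis using that f by blast
qed

text \<open>An arc inside \<open>S\<close> closes the crosscut to a Jordan curve. The curve meets
  \<open>S\<close> exactly in that arc, and this connectedness is the hypothesis that Janiszewski's
  theorem asks for later.\<close>

lemma crosscut_closed_curve:
  fixes g :: "real \<Rightarrow> complex"
  assumes "arc g" "path_image g \<inter> S = {pathstart g, pathfinish g}"
    and "path_component S (pathstart g) (pathfinish g)"
  obtains z where "simple_path z" "pathfinish z = pathstart z" "path_image g \<subseteq> path_image z"
    "path_image z \<subseteq> S \<union> path_image g" "connected (path_image z \<inter> S)"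
proof -
  have ne: "pathfinish g \<noteq> pathstart g"
    using assms(1) arc_distinct_ends by metis
  obtain q where q: "path q" "path_image q \<subseteq> S" "pathstart q = pathfinish g" "pathfinish q = pathstart g"
    using assms(3) path_component_sym unfolding path_component_def by metis
  obtain d where d: "arc d" "path_image d \<subseteq> S" "pathstart d = pathfinish g" "pathfinish d = pathstart g"
    using path_contains_arc[OF q(1,3,4) ne] q(2) by (metis subset_trans)
  let ?z = "g +++ d"
  have im: "path_image ?z = path_image g \<union> path_image d"
    using d by (simp add: path_image_join)
  have "simple_path ?z"
    using d assms by (subst simple_path_join_loop_eq) auto
  moreover have "path_image ?z \<inter> S = path_image d"
    using im d assms(2) by (auto simp: pathstart_in_path_image pathfinish_in_path_image)
      (metis pathstart_in_path_image pathfinish_in_path_image Int_iff insertE empty_iff)+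
  moreover have "connected (path_image d)"
    using d arc_imp_path connected_path_image by blast
  ultimately show ?thesis
    using that[of ?z] im d by auto
qed

text \<open>Close to a point \<open>m\<close> of the crosscut off \<open>S\<close> there are points
  on both sides of the Jordan curve through it. These two replace the sample point in the face of
  \<open>m\<close>, if there is one, so the sample grows by at least one.\<close>

lemma separated_points_crosscut:
  fixes g :: "real \<Rightarrow> complex"
  assumes "closed S" "arc g" and ends: "path_image g \<inter> S = {pathstart g, pathfinish g}"
    and pc: "path_component S (pathstart g) (pathfinish g)" and P: "separated_points S P"
  shows "\<exists>Q. separated_points (S \<union> path_image g) Q \<and> card Q = Suc (card P)"
proof -
  obtain z where z: "simple_path z" "pathfinish z = pathstart z" "path_image g \<subseteq> path_image z"
    "path_image z \<subseteq> S \<union> path_image g"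
    using crosscut_closed_curve[OF assms(2) ends pc] by metis
  note J = Jordan_inside_outside[OF z(1,2)]
  obtain m where m: "m \<in> path_image g" "m \<notin> S"
    using ends nonempty_simple_path_endless[OF arc_imp_simple_path[OF assms(2)]] by blast
  obtain r where r: "r > 0" "ball m r \<subseteq> - S"
    using assms(1) m(2) by (metis ComplI open_Compl open_contains_ball)
  have fr: "m \<in> frontier (inside (path_image z))" "m \<in> frontier (outside (path_image z))"
    using J m(1) z(3) by auto
  obtain a where a: "a \<in> inside (path_image z)" "a \<in> ball m r"
    using fr(1) r(1) unfolding frontier_def closure_approachable
    by (metis (no_types, lifting) DiffD1 closure_approachable dist_commute mem_ball)
  obtain b where b: "b \<in> outside (path_image z)" "b \<in> ball m r"
    using fr(2) r(1) unfolding frontier_def closure_approachable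
    by (metis (no_types, lifting) DiffD1 closure_approachable dist_commute mem_ball)
  have ab: "connected_component (-S) m a" "connected_component (-S) m b"
    using r a b connected_ball[of m r] centre_in_ball[of m r]
    unfolding connected_component_def by blast+
  have ab_notin: "a \<notin> S \<union> path_image g" "b \<notin> S \<union> path_image g"
    using a b r z(3) by (auto dest: subsetD simp: inside_def outside_def)
  have nab: "\<not> connected_component (-(S \<union> path_image g)) a b"
    using connected_component_Compl_mono[OF _ z(4)] inside_same_component[OF _ a(1)] b(1) J
    by blast
  obtain f where f: "inj_on f P" "\<And>x. x \<in> P \<Longrightarrow> connected_component (-S) x (f x)"
    "separated_points (S \<union> path_image g) (f ` P)"
    using separated_points_avoiding_arc[OF assms(1,2) P] by metis
  define R where "R = {x\<in>P. \<not> connected_component (-S) m x}"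
  have fin: "finite P" using P by (simp add: separated_points_def)
  have "card (P - R) \<le> 1"
  proof -
    have "x = y" if "x \<in> P - R" "y \<in> P - R" for x y
      using that P unfolding R_def separated_points_def
      by (metis (mono_tags, lifting) DiffE connected_component_sym connected_component_trans mem_Collect_eq)
    then show ?thesis
      using fin by (metis (no_types, lifting) One_nat_def card_le_Suc0_iff_eq finite_Diff)
  qed
  then have cR: "card P \<le> Suc (card R)"
    using card_Diff_subset[of R P] fin unfolding R_def by (simp add: R_def)
  let ?Q = "insert a (insert b (f ` R))"
  have nR: "\<not> connected_component (-S) m (f x)" if "x \<in> R" for x
    using that f(2) unfolding R_def
    by (metis (mono_tags, lifting) connected_component_sym connected_component_trans mem_Collect_eq)
  have nQ: "\<not> connected_component (-(S \<union> path_image g)) a (f x)"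
           "\<not> connected_component (-(S \<union> path_image g)) b (f x)" if "x \<in> R" for x
    using nR[OF that] ab connected_component_Compl_mono[of "S \<union> path_image g" _ _ S]
    by (meson Un_upper1 connected_component_trans)+
  have sep: "separated_points (S \<union> path_image g) ?Q"
    unfolding separated_points_def
  proof (intro conjI ballI impI)
    show "finite ?Q" using fin by (simp add: R_def)
    show "?Q \<inter> (S \<union> path_image g) = {}"
      using ab_notin f(3) unfolding separated_points_def R_def by blast
    fix x y assume "x \<in> ?Q" "y \<in> ?Q" "connected_component (- (S \<union> path_image g)) x y"
    then show "x = y"
      using nab nQ f(3) connected_component_sym[of "- (S \<union> path_image g)"]
      unfolding separated_points_def R_def by blast
  qed
  have "a \<noteq> b"
    using a(1) b(1) inside_Int_outside by blast
  moreover have "a \<notin> f ` R" "b \<notin> f ` R"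
    using nR ab by blast+
  moreover have "card (f ` R) = card R"
    using f(1) R_def by (intro card_image) (auto intro: inj_on_subset)
  ultimately have "card ?Q \<ge> Suc (card P)"
    using cR fin R_def by simp
  \<comment> \<open>If the face of \<open>m\<close> contained no sample point, two points were
    gained and one is dropped.\<close>
  then obtain Q' where "Q' \<subseteq> ?Q" "card Q' = Suc (card P)"
    using obtain_subset_with_card_n by metis
  then show ?thesis
    using separated_points_subset[OF sep] by blast
qed

text \<open>Two points on the same side of the closed curve \<open>z\<close> through the arc are separated neither by
  \<open>z\<close> nor by \<open>S\<close>, and \<open>z\<close> meets \<open>S\<close> in a connected set, so Janiszewski's theorem applies.\<close>
lemma crosscut_two_sides:
  fixes g :: "real \<Rightarrow> complex"
  assumes "compact S" "arc g" and ends: "path_image g \<inter> S = {pathstart g, pathfinish g}"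
    and pc: "path_component S (pathstart g) (pathfinish g)"
    and X: "X \<inter> (S \<union> path_image g) = {}" "\<And>x y. x \<in> X \<Longrightarrow> y \<in> X \<Longrightarrow> connected_component (-S) x y"
    and sep: "\<And>x y. x \<in> X \<Longrightarrow> y \<in> X \<Longrightarrow> connected_component (-(S \<union> path_image g)) x y \<Longrightarrow> x = y"
  shows "finite X \<and> card X \<le> 2"
proof -
  obtain z where z: "simple_path z" "pathfinish z = pathstart z" "path_image g \<subseteq> path_image z"
    "path_image z \<subseteq> S \<union> path_image g" "connected (path_image z \<inter> S)"
    using crosscut_closed_curve[OF assms(2) ends pc] by metis
  note J = Jordan_inside_outside[OF z(1,2)]
  have eq: "path_image z \<union> S = S \<union> path_image g" using z by blast
  have same: "x = y" if "x \<in> X" "y \<in> X" "connected_component (- path_image z) x y" for x y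
  proof -
    have "connected_component (- (path_image z \<union> S)) x y"
      using Janiszewski[OF compact_simple_path_image[OF z(1)] compact_imp_closed[OF assms(1)] z(5) that(3) X(2)[OF that(1,2)]] .
    then show ?thesis using sep that eq by simp
  qed
  have in1: "x = y" if "x \<in> X \<inter> inside (path_image z)" "y \<in> X \<inter> inside (path_image z)" for x y
    using that J same[of x y] unfolding connected_component_def
    by (metis Int_iff inside_Int_outside inside_no_overlap disjoint_eq_subset_Compl)
  have out1: "x = y" if "x \<in> X \<inter> outside (path_image z)" "y \<in> X \<inter> outside (path_image z)" for x y
    using that J same[of x y] unfolding connected_component_def
    by (metis Int_iff outside_no_overlap disjoint_eq_subset_Compl)
  have "X \<subseteq> inside (path_image z) \<union> outside (path_image z)"
    using X(1) z(4) J by blast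
  then have X_eq: "X = (X \<inter> inside (path_image z)) \<union> (X \<inter> outside (path_image z))" by blast
  have f: "finite (X \<inter> inside (path_image z))" "card (X \<inter> inside (path_image z)) \<le> 1"
    using in1 by (metis finite.simps insertI1 is_singletonI' is_singleton_def,
       metis One_nat_def card_eq_0_iff card_1_singleton_iff is_singletonI' is_singleton_def nat_le_linear zero_le order_refl card.empty)
  have g: "finite (X \<inter> outside (path_image z))" "card (X \<inter> outside (path_image z)) \<le> 1"
    using out1 by (metis finite.simps insertI1 is_singletonI' is_singleton_def,
       metis One_nat_def card_eq_0_iff card_1_singleton_iff is_singletonI' is_singleton_def nat_le_linear zero_le order_refl card.empty)
  show ?thesis
    using X_eq f g card_Un_le[of "X \<inter> inside (path_image z)" "X \<inter> outside (path_image z)"]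
    by (metis add_mono finite_UnI le_trans one_add_one)
qed

text \<open>Janiszewski's theorem applies twice, because the arc meets \<open>A\<close> in a single
  point and the union of both meets \<open>B\<close> in a single point. Hence a bridge does not
  divide its face.\<close>

lemma bridge_one_side:
  fixes g :: "real \<Rightarrow> complex"
  assumes "compact A" "compact B" "A \<inter> B = {}" "arc g"
    and gA: "path_image g \<inter> A = {pathstart g}" and gB: "path_image g \<inter> B = {pathfinish g}"
    and xy: "connected_component (-(A \<union> B)) x y" "x \<notin> path_image g" "y \<notin> path_image g"
  shows "connected_component (-(A \<union> B \<union> path_image g)) x y"
proof -
  have "connected_component (- path_image g) x y"
    using connected_arc_complement[OF assms(4)] xy by (simp add: connected_iff_connected_component)
  then have "connected_component (-(path_image g \<union> A)) x y"
    using Janiszewski[of "path_image g" A x y] gA assms connected_component_Compl_mono[OF xy(1), of A]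
    by (auto simp: compact_arc_image compact_imp_closed)
  moreover have "(path_image g \<union> A) \<inter> B = {pathfinish g}"
    using gB assms(3) by blast
  ultimately have "connected_component (-((path_image g \<union> A) \<union> B)) x y"
    using Janiszewski[of "path_image g \<union> A" B x y] assms connected_component_Compl_mono[OF xy(1), of B]
    by (auto simp: compact_arc_image compact_imp_closed compact_Un)
  then show ?thesis by (simp add: Un_ac)
qed

text \<open>Forests occur below as edge sets without nonempty leafless subset. In this form some
  edge always has an end of degree one and can be peeled off, without any talk of cycles.\<close>

definition leafless :: "'a set set \<Rightarrow> bool" where
  "leafless K \<longleftrightarrow> (\<forall>e\<in>K. \<forall>v\<in>e. \<exists>f\<in>K. f \<noteq> e \<and> v \<in> f)"

lemma leafless_card_ge_3:
  assumes "finite K" "leafless K" "K \<noteq> {}" "\<And>e. e \<in> K \<Longrightarrow> card e = 2"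
  shows "3 \<le> card K"
proof -
  obtain e where e: "e \<in> K" using assms by blast
  then obtain u v where uv: "e = {u,v}" "u \<noteq> v" using assms(4) card_2_iff by metis
  obtain f where f: "f \<in> K" "f \<noteq> e" "u \<in> f" using assms(2) e uv unfolding leafless_def by blast
  obtain g where g: "g \<in> K" "g \<noteq> e" "v \<in> g" using assms(2) e uv unfolding leafless_def by blast
  have "f \<noteq> g"
  proof
    assume "f = g"
    then have "{u,v} \<subseteq> f" "card f = 2" "finite f"
      using f g assms(4) by (auto intro: card_ge_0_finite)
    then show False using f(2) uv by (metis card_2_iff card_subset_eq)
  qed
  then have "card {e,f,g} = 3" using f g by simp
  moreover have "{e,f,g} \<subseteq> K" using e f g by simp
  ultimately show ?thesis using assms(1) by (metis card_mono)
qed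

lemma leafless_bipartite_card_ge_4:
  assumes "finite K" "leafless K" "K \<noteq> {}" "\<And>e. e \<in> K \<Longrightarrow> card e = 2"
    "\<And>e. e \<in> K \<Longrightarrow> card (e \<inter> S) = 1"
  shows "4 \<le> card K"
proof -
  have edge: "\<exists>a b. e = {a,b} \<and> a \<in> S \<and> b \<notin> S \<and> a \<noteq> b" if eK: "e \<in> K" for e
  proof -
    obtain u v where uv: "e = {u,v}" "u \<noteq> v" using assms(4)[OF eK] by (auto simp: card_2_iff)
    have "card (e \<inter> S) = 1" by (rule assms(5)[OF eK])
    then have "(u \<in> S) \<noteq> (v \<in> S)" unfolding uv(1) using uv(2) by (cases "u \<in> S"; cases "v \<in> S") simp_all
    then show ?thesis using uv by (metis insert_commute)
  qed
  obtain e where e: "e \<in> K" using assms by blast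
  then obtain a b where ab: "e = {a,b}" "a \<in> S" "b \<notin> S" using edge by blast
  obtain f where f: "f \<in> K" "f \<noteq> e" "b \<in> f" using assms(2) e ab unfolding leafless_def by blast
  obtain a' where a': "f = {a',b}" "a' \<in> S" "a' \<noteq> a" using edge[OF f(1)] f ab by blast
  obtain g where g: "g \<in> K" "g \<noteq> e" "a \<in> g" using assms(2) e ab unfolding leafless_def by blast
  obtain h where h: "h \<in> K" "h \<noteq> f" "a' \<in> h" using assms(2) f a' unfolding leafless_def by blast
  have "a' \<notin> e" "a' \<notin> g" "a \<notin> h" "a \<notin> f" "g \<noteq> f" "h \<noteq> e"
    using ab a' g h edge[OF g(1)] edge[OF h(1)] by auto
  moreover have "g \<noteq> h" using g h \<open>a' \<notin> g\<close> by blast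
  ultimately have "card {e,f,g,h} = 4" using f g h by (simp add: eq_commute[of e])
  moreover have "{e,f,g,h} \<subseteq> K" using e f g h by simp
  ultimately show ?thesis using assms(1) by (metis card_mono)
qed

section \<open>Drawings, their faces and boundary edges\<close>

locale drawing =
  fixes V :: "'a set" and E :: "'a set set" and p :: "'a \<Rightarrow> complex" and c :: "'a set \<Rightarrow> real \<Rightarrow> complex"
  assumes plane: "plane_graph (V, E) p c"
begin

lemma fin_V: "finite V" and E_sub: "e \<in> E \<Longrightarrow> e \<subseteq> V" and card_E: "e \<in> E \<Longrightarrow> card e = 2"
  and inj_p: "inj_on p V" and arc_c: "e \<in> E \<Longrightarrow> arc (c e)"
  and ends_c: "e \<in> E \<Longrightarrow> {pathstart (c e), pathfinish (c e)} = p ` e"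
  and arc_vertices: "e \<in> E \<Longrightarrow> path_image (c e) \<inter> p ` V \<subseteq> p ` e"
  and arcs_meet: "e \<in> E \<Longrightarrow> f \<in> E \<Longrightarrow> e \<noteq> f \<Longrightarrow> path_image (c e) \<inter> path_image (c f) \<subseteq> p ` (e \<inter> f)"
  using plane unfolding plane_graph_def simple_graph_def by auto

lemma fin_E: "finite E"
  using fin_V E_sub by (meson PowI finite_Pow_iff finite_subset subsetI)

definition drawn :: "'a set \<Rightarrow> 'a set set \<Rightarrow> complex set" where
  "drawn W K = p ` W \<union> (\<Union>e\<in>K. path_image (c e))"

lemma ends_in_image: "e \<in> E \<Longrightarrow> p ` e \<subseteq> path_image (c e)"
  using ends_c by (metis empty_subsetI insert_subset pathfinish_in_path_image pathstart_in_path_image)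

lemma compact_drawn: "W \<subseteq> V \<Longrightarrow> K \<subseteq> E \<Longrightarrow> compact (drawn W K)"
  unfolding drawn_def using fin_V fin_E arc_c
  by (intro compact_Un compact_UN finite_imp_compact[OF finite_imageI]) (auto intro: finite_subset compact_arc_image)

lemma drawn_insert: "drawn W (insert e K) = drawn W K \<union> path_image (c e)"
  by (auto simp: drawn_def)

lemma arc_meets_drawn:
  assumes "e \<in> E" "K \<subseteq> E" "e \<notin> K" "W \<subseteq> V"
  shows "path_image (c e) \<inter> drawn W K \<subseteq> p ` e" and "e \<subseteq> W \<Longrightarrow> path_image (c e) \<inter> drawn W K = p ` e"
proof -
  show 1: "path_image (c e) \<inter> drawn W K \<subseteq> p ` e"
    unfolding drawn_def using arc_vertices[OF assms(1)] arcs_meet[OF assms(1)] assms by blast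
  show "path_image (c e) \<inter> drawn W K = p ` e" if "e \<subseteq> W"
    using 1 that ends_in_image[OF assms(1)] unfolding drawn_def by blast
qed

text \<open>A forest does not separate the plane: putting back a leaf edge adds an arc that meets
  the rest in at most one point, and Janiszewski's theorem keeps the complement connected.\<close>

lemma connected_Compl_drawn_if_peelable:
  assumes "K \<subseteq> E" "W \<subseteq> V" "\<And>K'. K' \<subseteq> K \<Longrightarrow> leafless K' \<Longrightarrow> K' = {}"
  shows "connected (- drawn W K)"
proof -
  have "finite K" using assms(1) fin_E finite_subset by blast
  then show ?thesis using assms
  proof (induction K arbitrary: W rule: finite_psubset_induct)
    case (psubset K)
    show ?case
    proof (cases "K = {}")
      case True
      have "countable (p ` W)" using psubset.prems fin_V by (meson countable_finite finite_imageI finite_subset)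
      then have "connected (UNIV - p ` W)" by (intro connected_open_diff_countable) auto
      then show ?thesis using True by (simp add: drawn_def Compl_eq_Diff_UNIV)
    next
      case False
      then have "\<not> leafless K" using psubset.prems by blast
      then obtain e v where e: "e \<in> K" "v \<in> e" "\<And>f. f \<in> K \<Longrightarrow> f \<noteq> e \<Longrightarrow> v \<notin> f"
        unfolding leafless_def by blast
      have eE: "e \<in> E" using e psubset.prems by blast
      obtain u where u: "e = {u, v}" "u \<noteq> v"
        using card_E[OF eE] e(2) by (auto simp: card_2_iff)
      \<comment> \<open>The leaf vertex leaves \<open>W\<close> together with its edge, since
        otherwise the arc could meet the rest in both ends.\<close>
      let ?B = "drawn (W - {v}) (K - {e})"
      have vV: "v \<in> V" "u \<in> V" using eE E_sub u by blast+
      have con: "connected (- ?B)"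
      proof (rule psubset.IH)
        show "K - {e} \<subset> K" "K - {e} \<subseteq> E" "W - {v} \<subseteq> V" using e psubset.prems by blast+
        show "K' = {}" if "K' \<subseteq> K - {e}" "leafless K'" for K'
          by (rule psubset.prems(3)) (use that in auto)
      qed
      have sub: "path_image (c e) \<inter> ?B \<subseteq> {p u}"
      proof -
        have "p v \<notin> p ` (W - {v})"
          using vV psubset.prems(2) by (auto dest: inj_onD[OF inj_p])
        moreover have "p v \<notin> path_image (c f)" if "f \<in> K - {e}" for f
        proof
          assume "p v \<in> path_image (c f)"
          then have "p v \<in> p ` f" using arc_vertices[of f] that psubset.prems vV by blast
          moreover have "f \<subseteq> V" using that psubset.prems E_sub by blast
          ultimately have "v \<in> f" using vV by (auto dest: inj_onD[OF inj_p])
          then show False using e that by blast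
        qed
        ultimately have "p v \<notin> ?B" unfolding drawn_def by blast
        moreover have "path_image (c e) \<inter> ?B \<subseteq> p ` e"
          by (rule arc_meets_drawn) (use e psubset.prems in auto)
        ultimately show ?thesis using u by blast
      qed
      then have "connected (path_image (c e) \<inter> ?B)"
        by (metis connected_empty connected_sing subset_singleton_iff)
      then have "connected (- (path_image (c e) \<union> ?B))"
        using con eE arc_c connected_arc_complement[of "c e"] compact_imp_closed[OF compact_drawn[of "W - {v}" "K - {e}"]] psubset.prems(1,2)
        by (intro Janiszewski_connected) (auto simp: compact_arc_image)
      moreover have "path_image (c e) \<union> ?B = drawn W K"
        using e u ends_in_image[OF eE] unfolding drawn_def by auto
      ultimately show ?thesis by simp
    qed
  qed
qed

text \<open>Ends of the arc are excluded, because a vertex also lies in the closure of faces that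
  the edge does not border.\<close>

definition boundary_edges :: "complex \<Rightarrow> 'a set set" where
  "boundary_edges x = {e\<in>E. \<exists>z \<in> path_image (c e) - p ` e. z \<in> closure (connected_component_set (- drawn V E) x)}"

text \<open>If the boundary edges formed a forest, their drawing would have a connected complement.
  The frontier of the face of \<open>x\<close> lies in that drawing, so the face would fill the
  whole complement and contain \<open>y\<close> as well.\<close>

lemma boundary_edges_leafless:
  assumes "x \<notin> drawn V E" "y \<notin> drawn V E" "\<not> connected_component (- drawn V E) x y"
  shows "\<exists>K \<subseteq> boundary_edges x. leafless K \<and> K \<noteq> {}"
proof (rule ccontr)
  assume "\<not> ?thesis"
  then have no: "K = {}" if "K \<subseteq> boundary_edges x" "leafless K" for K using that by blast
  have con: "connected (- drawn V (boundary_edges x))"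
    by (rule connected_Compl_drawn_if_peelable[OF _ order_refl no]) (auto simp: boundary_edges_def)
  let ?f = "connected_component_set (- drawn V E) x"
  have cl: "closed (drawn V E)" using compact_drawn compact_imp_closed by blast
  have sub: "drawn V (boundary_edges x) \<subseteq> drawn V E" unfolding drawn_def boundary_edges_def by blast
  have "frontier ?f \<subseteq> drawn V (boundary_edges x)"
  proof
    fix z assume z: "z \<in> frontier ?f"
    have zS: "z \<in> drawn V E"
      using subsetD[OF frontier_of_connected_component_subset z] frontier_subset_closed[OF cl]
      unfolding frontier_complement by blast
    show "z \<in> drawn V (boundary_edges x)"
    proof (cases "z \<in> p ` V")
      case True then show ?thesis by (auto simp: drawn_def)
    next
      case False
      then obtain e where e: "e \<in> E" "z \<in> path_image (c e)" using zS unfolding drawn_def by blast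
      have "z \<notin> p ` e" using False E_sub[OF e(1)] by blast
      then have "e \<in> boundary_edges x" using e z unfolding boundary_edges_def frontier_def by blast
      then show ?thesis using e by (auto simp: drawn_def)
    qed
  qed
  moreover have "x \<in> - drawn V (boundary_edges x) \<inter> ?f" using assms(1) sub by auto
  ultimately have "- drawn V (boundary_edges x) \<subseteq> ?f"
    using connected_Int_frontier[OF con, of ?f] by blast
  then show False using assms sub by auto
qed

text \<open>A component of the drawing consists of whole arcs, so it is compact.\<close>
lemma split_drawn:
  assumes "W \<subseteq> V" "K \<subseteq> E" "a \<in> drawn W K" "b \<in> drawn W K" "\<not> path_component (drawn W K) a b"
  obtains A B where "compact A" "compact B" "A \<inter> B = {}" "A \<union> B = drawn W K" "a \<in> A" "b \<in> B"
proof -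
  define F where "F = (\<lambda>v. {p v}) ` W \<union> (\<lambda>e. path_image (c e)) ` K"
  have FU: "\<Union>F = drawn W K" unfolding F_def drawn_def by auto
  have finF: "finite F" unfolding F_def using finite_subset[OF assms(1) fin_V] finite_subset[OF assms(2) fin_E] by blast
  have F: "compact X \<and> path_connected X" if "X \<in> F" for X
    using that assms arc_c unfolding F_def
    by (auto intro: compact_arc_image) (metis arc_imp_path path_connected_path_image subsetD)
  define C where "C = path_component_set (drawn W K) a"
  have dich: "X \<subseteq> C" if X: "X \<in> F" "X \<inter> C \<noteq> {}" for X
  proof
    fix x assume "x \<in> X"
    obtain y where y: "y \<in> X" "y \<in> C" using X(2) by blast
    have "path_component X y x" using F[OF X(1)] y \<open>x \<in> X\<close> by (simp add: path_connected_component)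
    then have "path_component (drawn W K) y x" using FU X(1) path_component_of_subset by (metis Union_upper)
    then show "x \<in> C" using y path_component_trans[of _ a y x] unfolding C_def by blast
  qed
  show ?thesis
  proof (rule that[of "\<Union>{X\<in>F. X \<subseteq> C}" "\<Union>{X\<in>F. X \<inter> C = {}}"])
    show "compact (\<Union>{X\<in>F. X \<subseteq> C})" "compact (\<Union>{X\<in>F. X \<inter> C = {}})"
      using finF F by (auto intro: compact_Union)
    show "\<Union>{X\<in>F. X \<subseteq> C} \<inter> \<Union>{X\<in>F. X \<inter> C = {}} = {}" by blast
    have "F = {X\<in>F. X \<subseteq> C} \<union> {X\<in>F. X \<inter> C = {}}" using dich by fast
    then show "\<Union>{X\<in>F. X \<subseteq> C} \<union> \<Union>{X\<in>F. X \<inter> C = {}} = drawn W K"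
      using FU by (metis Union_Un_distrib)
    have ab: "a \<in> C" "b \<notin> C" using assms unfolding C_def by (auto simp: path_component_refl)
    obtain X Y where "X \<in> F" "a \<in> X" "Y \<in> F" "b \<in> Y" using FU assms(3,4) by blast
    then show "a \<in> \<Union>{X\<in>F. X \<subseteq> C}" "b \<in> \<Union>{X\<in>F. X \<inter> C = {}}"
      using dich[of X] dich[of Y] ab by blast+
  qed
qed

text \<open>After removal of \<open>e\<close> all points of \<open>X\<close> lie in one face, as
  each of them reaches the open arc, which is connected. Putting the arc back is a crosscut with two
  sides if its ends are joined in the rest, and otherwise a bridge with one side.\<close>

lemma edge_at_most_two_faces:
  assumes e: "e \<in> E" and X: "X \<inter> drawn V E = {}" "\<And>x. x \<in> X \<Longrightarrow> e \<in> boundary_edges x"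
    and sep: "\<And>x y. x \<in> X \<Longrightarrow> y \<in> X \<Longrightarrow> connected_component (- drawn V E) x y \<Longrightarrow> x = y"
  shows "finite X \<and> card X \<le> 2"
proof -
  let ?S = "drawn V (E - {e})" and ?g = "c e"
  have SE: "?S \<union> path_image ?g = drawn V E" using drawn_insert[of V e "E - {e}"] e by (simp add: insert_absorb)
  have cp: "compact ?S" by (intro compact_drawn) auto
  have meet: "path_image ?g \<inter> ?S = {pathstart ?g, pathfinish ?g}"
    using arc_meets_drawn(2)[of e "E - {e}" V] e E_sub ends_c by auto
  have near: "\<exists>z. z \<in> path_image ?g - p ` e \<and> connected_component (- ?S) x z" if x: "x \<in> X" for x
  proof -
    obtain z where z: "z \<in> path_image ?g - p ` e" "z \<in> closure (connected_component_set (- drawn V E) x)"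
      using X(2)[OF x] unfolding boundary_edges_def by blast
    have "z \<in> - ?S" using z meet ends_c[OF e] by blast
    then obtain r where r: "r > 0" "ball z r \<subseteq> - ?S"
      using cp compact_imp_closed by (meson open_Compl open_contains_ball)
    obtain y where y: "connected_component (- drawn V E) x y" "y \<in> ball z r"
      using z(2) r(1) unfolding closure_approachable by (auto simp: dist_commute)
    have "connected_component (- ?S) y z"
      using r y(2) connected_ball[of z r] centre_in_ball[of z r] unfolding connected_component_def by blast
    moreover have "connected_component (- ?S) x y"
      using y(1) connected_component_Compl_mono SE by blast
    ultimately show ?thesis using z(1) connected_component_trans by blast
  qed
  have con: "connected_component (- ?S) x y" if xy: "x \<in> X" "y \<in> X" for x y
  proof -
    obtain z where z: "z \<in> path_image ?g - p ` e" "connected_component (- ?S) x z" using near[OF xy(1)] by blast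
    obtain w where w: "w \<in> path_image ?g - p ` e" "connected_component (- ?S) y w" using near[OF xy(2)] by blast
    have "connected (path_image ?g - p ` e)"
      using connected_simple_path_endless[OF arc_imp_simple_path[OF arc_c[OF e]]] ends_c[OF e] by simp
    then have "connected_component (- ?S) z w"
      using z w meet ends_c[OF e] unfolding connected_component_def by blast
    then show ?thesis using z w by (meson connected_component_sym connected_component_trans)
  qed
  show ?thesis
  proof (cases "path_component ?S (pathstart ?g) (pathfinish ?g)")
    case True
    then show ?thesis
      using crosscut_two_sides[OF cp arc_c[OF e] meet True, of X] X(1) con sep SE by auto
  next
    case False
    obtain A B where AB: "compact A" "compact B" "A \<inter> B = {}" "A \<union> B = ?S" "pathstart ?g \<in> A" "pathfinish ?g \<in> B"
      using split_drawn[OF _ _ _ _ False] meet by auto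
    have "path_image ?g \<inter> A = {pathstart ?g}" "path_image ?g \<inter> B = {pathfinish ?g}"
      using meet[folded AB(4)] AB(3,5,6) by (auto simp del: AB)
    note AB' = this
    have "x = y" if xy: "x \<in> X" "y \<in> X" for x y
    proof (rule sep[OF xy])
      have "connected_component (- (A \<union> B)) x y" using con[OF xy] AB(4) by simp
      moreover have "x \<notin> path_image ?g" "y \<notin> path_image ?g" using xy X(1) SE by blast+
      ultimately have "connected_component (- (A \<union> B \<union> path_image ?g)) x y"
        using bridge_one_side[OF AB(1,2,3) arc_c[OF e] AB'] by blast
      then show "connected_component (- drawn V E) x y" using AB(4) SE by simp
    qed
    then have "X = {} \<or> (\<exists>x. X = {x})" by blast
    then show ?thesis by auto
  qed
qed

section \<open>Euler's formula as a lower bound on the number of faces\<close>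

definition components_of :: "'a set set \<Rightarrow> 'a set set" where
  "components_of K = (\<lambda>v. {w\<in>V. path_component (drawn V K) (p v) (p w)}) ` V"

lemma path_component_drawn_mono:
  "path_component (drawn V K) x y \<Longrightarrow> path_component (drawn V (insert e K)) x y"
  by (rule path_component_of_subset) (auto simp: drawn_def)

lemma card_components_of_insert:
  shows "card (components_of (insert e K)) \<le> card (components_of K)"
  and "u \<in> V \<Longrightarrow> v \<in> V \<Longrightarrow> path_component (drawn V (insert e K)) (p u) (p v) \<Longrightarrow>
     \<not> path_component (drawn V K) (p u) (p v) \<Longrightarrow>
     Suc (card (components_of (insert e K))) \<le> card (components_of K)"
proof -
  define cl where "cl = (\<lambda>K v. {w\<in>V. path_component (drawn V K) (p v) (p w)})"
  have eq: "cl K v = cl K w \<longleftrightarrow> path_component (drawn V K) (p v) (p w)" if "v \<in> V" "w \<in> V" for K v w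
  proof -
    let ?R = "path_component (drawn V K)"
    have refl: "?R (p w) (p w)" using that by (auto simp: drawn_def path_component_refl)
    have "?R (p v) x \<longleftrightarrow> ?R (p w) x" if "?R (p v) (p w)" for x
      using that by (meson path_component_sym path_component_trans)
    moreover have "w \<in> cl K w" using refl that by (simp add: cl_def)
    ultimately show ?thesis unfolding cl_def by blast
  qed
  \<comment> \<open>\<open>g\<close> sends a class of vertices to the class that contains it after
    \<open>e\<close> is added. It is onto, which gives the first claim, and not injective when two
    classes merge, which gives the second.\<close>
  define g where "g = (\<lambda>X. cl (insert e K) (SOME v. v \<in> V \<and> cl K v = X))"
  have g: "g (cl K v) = cl (insert e K) v" if "v \<in> V" for v
  proof -
    define w where "w = (SOME w. w \<in> V \<and> cl K w = cl K v)"
    have w: "w \<in> V \<and> cl K w = cl K v" unfolding w_def by (rule someI[of _ v]) (use that in auto)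
    then have "path_component (drawn V (insert e K)) (p w) (p v)"
      using eq[of w v K] that path_component_drawn_mono by blast
    then show ?thesis using eq[of w v "insert e K"] w that unfolding g_def w_def by simp
  qed
  have im: "components_of (insert e K) = g ` components_of K"
    using g unfolding components_of_def cl_def[symmetric, THEN fun_cong, THEN fun_cong] cl_def[symmetric] image_image
    by (intro image_cong refl) (simp add: cl_def)
  have fin: "finite (components_of K)" unfolding components_of_def using fin_V by simp
  show "card (components_of (insert e K)) \<le> card (components_of K)"
    using im fin card_image_le by simp
  assume uv: "u \<in> V" "v \<in> V" "path_component (drawn V (insert e K)) (p u) (p v)"
     "\<not> path_component (drawn V K) (p u) (p v)"
  then have "\<not> inj_on g (components_of K)"
  proof -
    have "cl K u \<in> components_of K" "cl K v \<in> components_of K"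
      using uv(1,2) unfolding components_of_def cl_def by auto
    moreover have "g (cl K u) = g (cl K v)" "cl K u \<noteq> cl K v"
      using eq[OF uv(1,2)] g[OF uv(1)] g[OF uv(2)] uv(3,4) by simp_all
    ultimately show ?thesis unfolding inj_on_def by blast
  qed
  then show "Suc (card (components_of (insert e K))) \<le> card (components_of K)"
    using im fin by (metis card_image_le eq_card_imp_inj_on le_neq_implies_less less_eq_Suc_le)
qed

text \<open>A new edge whose ends are already joined is a crosscut and adds a face; any other edge
  merges two components. The start is one face and at most \<open>card V\<close> components.\<close>

lemma euler_lower:
  assumes "K \<subseteq> E" "V \<noteq> {}"
  shows "\<exists>P. separated_points (drawn V K) P \<and> card K + card (components_of K) + 1 \<le> card P + card V"
proof -
  have "finite K" using assms(1) fin_E finite_subset by blast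
  then show ?thesis using assms(1)
  proof (induction K rule: finite_induct)
    case empty
    have "components_of {} \<subseteq> (\<lambda>v. {w\<in>V. path_component (drawn V {}) (p v) (p w)}) ` V"
      by (simp add: components_of_def)
    then have c: "card (components_of {}) \<le> card V" using fin_V by (meson surj_card_le)
    have "drawn V {} \<noteq> UNIV"
      using fin_V unfolding drawn_def by (metis UN_empty Un_empty_right finite_imageI infinite_UNIV_char_0)
    then obtain x where "x \<notin> drawn V {}" by blast
    then show ?case using c by (intro exI[of _ "{x}"]) (auto simp: separated_points_def)
  next
    case (insert e K)
    then obtain P where P: "separated_points (drawn V K) P"
      "card K + card (components_of K) + 1 \<le> card P + card V" by auto
    have eE: "e \<in> E" "K \<subseteq> E" using insert by auto
    have cl: "closed (drawn V K)" using compact_drawn[of V K] eE compact_imp_closed by blast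
    have meet: "path_image (c e) \<inter> drawn V K = {pathstart (c e), pathfinish (c e)}"
      using arc_meets_drawn(2)[of e K V] eE insert.hyps E_sub ends_c by auto
    show ?case
    proof (cases "path_component (drawn V K) (pathstart (c e)) (pathfinish (c e))")
      case True
      obtain Q where "separated_points (drawn V K \<union> path_image (c e)) Q" "card Q = Suc (card P)"
        using separated_points_crosscut[OF cl arc_c[OF eE(1)] meet True P(1)] by blast
      then show ?thesis
        using P(2) card_components_of_insert(1)[of e K] insert.hyps
        by (intro exI[of _ Q]) (auto simp: drawn_insert)
    next
      case False
      obtain f where f: "inj_on f P" "separated_points (drawn V K \<union> path_image (c e)) (f ` P)"
        using separated_points_avoiding_arc[OF cl arc_c[OF eE(1)] P(1)] by metis
      have "pathstart (c e) \<in> p ` e" "pathfinish (c e) \<in> p ` e" using ends_c[OF eE(1)] by blast+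
      then obtain u v where uv: "u \<in> e" "v \<in> e" "p u = pathstart (c e)" "p v = pathfinish (c e)"
        by (metis image_iff)
      have "path_component (path_image (c e)) (p u) (p v)"
        using uv arc_c[OF eE(1)] by (metis arc_imp_path path_component_def order_refl)
      then have "path_component (drawn V (insert e K)) (p u) (p v)"
        by (rule path_component_of_subset[rotated]) (auto simp: drawn_def)
      then have "Suc (card (components_of (insert e K))) \<le> card (components_of K)"
        using card_components_of_insert(2)[of u v e K] False uv E_sub[OF eE(1)] by auto
      then show ?thesis
        using P(2) f insert.hyps
        by (intro exI[of _ "f ` P"]) (auto simp: drawn_insert card_image)
    qed
  qed
qed

text \<open>Double counting of pairs of a face and a boundary edge. A lone face need not have a
  cycle on its boundary, hence the condition \<open>2 \<le> F\<close>.\<close>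

lemma face_count:
  assumes "V \<noteq> {}" and len: "\<And>K. K \<subseteq> E \<Longrightarrow> leafless K \<Longrightarrow> K \<noteq> {} \<Longrightarrow> l \<le> card K"
  obtains F where "card E + 2 \<le> F + card V" "2 \<le> F \<Longrightarrow> l * F \<le> 2 * card E"
proof -
  obtain P where P: "separated_points (drawn V E) P" "card E + card (components_of E) + 1 \<le> card P + card V"
    using euler_lower[OF order_refl assms(1)] by blast
  have "card (components_of E) \<noteq> 0"
    using assms(1) fin_V unfolding components_of_def by simp
  then have 1: "card E + 2 \<le> card P + card V" using P(2) by linarith
  have "l * card P \<le> 2 * card E" if "2 \<le> card P"
  proof -
    have fP: "finite P" and sep: "\<And>x y. x \<in> P \<Longrightarrow> y \<in> P \<Longrightarrow> connected_component (- drawn V E) x y \<Longrightarrow> x = y"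
      and disj: "P \<inter> drawn V E = {}"
      using P(1) unfolding separated_points_def by auto
    have "l \<le> card (boundary_edges x)" if x: "x \<in> P" for x
    proof -
      have "\<exists>y\<in>P. y \<noteq> x" using \<open>2 \<le> card P\<close> fP x
        by (metis One_nat_def card_le_Suc0_iff_eq not_less_eq_eq numeral_2_eq_2)
      then obtain y where y: "y \<in> P" "y \<noteq> x" by blast
      have "\<not> connected_component (- drawn V E) x y" using sep x y by blast
      then obtain K where K: "K \<subseteq> boundary_edges x" "leafless K" "K \<noteq> {}"
        using boundary_edges_leafless x y disj by (metis disjoint_iff)
      have sub: "boundary_edges x \<subseteq> E" by (auto simp: boundary_edges_def)
      then have "l \<le> card K" using len K by blast
      also have "\<dots> \<le> card (boundary_edges x)" using K(1) sub fin_E by (meson card_mono finite_subset)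
      finally show ?thesis .
    qed
    then have "l * card P \<le> (\<Sum>x\<in>P. card (boundary_edges x))"
      using sum_bounded_below[of P l "\<lambda>x. card (boundary_edges x)"] by (simp add: mult.commute)
    also have "\<dots> = (\<Sum>x\<in>P. card {e\<in>E. e \<in> boundary_edges x})"
      by (intro sum.cong refl arg_cong[of _ _ card]) (auto simp: boundary_edges_def)
    also have "\<dots> = (\<Sum>e\<in>E. card {x\<in>P. e \<in> boundary_edges x})"
      unfolding card_eq_sum sum.inter_filter[OF fP] sum.inter_filter[OF fin_E] by (rule sum.swap)
    also have "\<dots> \<le> (\<Sum>e\<in>E. 2)"
      by (intro sum_mono conjunct2[OF edge_at_most_two_faces]) (use sep disj in auto)
    finally show ?thesis by simp
  qed
  then show ?thesis using that 1 by blast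
qed

end

section \<open>Edge bounds for plane graphs\<close>

theorem plane_graph_edge_bound:
  assumes "plane_graph (V, E) p c" "3 \<le> card V"
  shows "card E + 6 \<le> 3 * card V"
proof -
  interpret drawing V E p c using assms by unfold_locales
  have "V \<noteq> {}" using assms(2) by auto
  then obtain F where F: "card E + 2 \<le> F + card V" "2 \<le> F \<Longrightarrow> 3 * F \<le> 2 * card E"
    using face_count[of 3] leafless_card_ge_3 fin_E card_E by (metis finite_subset subsetD)
  \<comment> \<open>With fewer than two faces the graph has at most \<open>card V - 1\<close> edges,
    and \<open>3 \<le> card V\<close> turns this into the stated bound.\<close>
  show ?thesis using F assms(2) by (cases "2 \<le> F") auto
qed

text \<open>\<open>S\<close> is one side of a bipartition. The bound omits the usual
  \<open>- 4\<close>, so that it holds for any number of vertices.\<close>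

theorem plane_graph_bipartite_edge_bound:
  assumes "plane_graph (V, E) p c" "\<And>e. e \<in> E \<Longrightarrow> card (e \<inter> S) = 1"
  shows "card E \<le> 2 * card V"
proof (cases "V = {}")
  interpret drawing V E p c using assms by unfold_locales
  case True
  then have "E = {}" using E_sub card_E by fastforce
  then show ?thesis by simp
next
  interpret drawing V E p c using assms by unfold_locales
  case False
  then obtain F where F: "card E + 2 \<le> F + card V" "2 \<le> F \<Longrightarrow> 4 * F \<le> 2 * card E"
    using face_count[of 4] leafless_bipartite_card_ge_4[of _ S] fin_E card_E assms(2) by (metis finite_subset subsetD)
  show ?thesis using F by (cases "2 \<le> F") auto
qed

lemma plane_graph_subset:
  assumes "plane_graph (V, E) p c" "K \<subseteq> E"
  shows "plane_graph (\<Union>K, K) p c"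
proof -
  interpret drawing V E p c using assms by unfold_locales
  have sub: "\<Union>K \<subseteq> V" using assms(2) E_sub by blast
  have KE: "e \<in> E" if "e \<in> K" for e using that assms(2) by blast
  have 1: "finite (\<Union>K)" "inj_on p (\<Union>K)" using sub fin_V inj_p by (auto intro: finite_subset inj_on_subset)
  have 2: "path_image (c e) \<inter> p ` \<Union>K \<subseteq> p ` e" if "e \<in> K" for e
    using arc_vertices[OF KE[OF that]] image_mono[OF sub, of p] by blast
  show ?thesis
    unfolding plane_graph_def simple_graph_def fst_conv snd_conv
    using 1 2 KE card_E arc_c ends_c arcs_meet by (intro conjI ballI impI) (simp_all add: Union_upper)
qed

section \<open>Kempe equivalence of list colorings\<close>

locale adjacency =
  fixes adj :: "'v \<Rightarrow> 'v \<Rightarrow> bool"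
  assumes adj_sym: "adj u v \<Longrightarrow> adj v u" and adj_irrefl: "\<not> adj v v"
begin

definition colors :: "'v set \<Rightarrow> ('v \<Rightarrow> 'c set) \<Rightarrow> ('v \<Rightarrow> 'c) \<Rightarrow> bool" where
  "colors V L \<phi> \<longleftrightarrow> (\<forall>v\<in>V. \<phi> v \<in> L v) \<and> (\<forall>u\<in>V. \<forall>v\<in>V. adj u v \<longrightarrow> \<phi> u \<noteq> \<phi> v)"

definition swap_set :: "'v set \<Rightarrow> ('v \<Rightarrow> 'c) \<Rightarrow> 'c \<Rightarrow> 'c \<Rightarrow> 'v set \<Rightarrow> bool" where
  "swap_set V \<phi> \<alpha> \<beta> K \<longleftrightarrow> K \<subseteq> V \<and> \<phi> ` K \<subseteq> {\<alpha>, \<beta>} \<and>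
     (\<forall>v\<in>K. \<forall>w\<in>V. adj v w \<longrightarrow> \<phi> w \<in> {\<alpha>, \<beta>} \<longrightarrow> w \<in> K)"

definition swap :: "'c \<Rightarrow> 'c \<Rightarrow> 'v set \<Rightarrow> ('v \<Rightarrow> 'c) \<Rightarrow> 'v \<Rightarrow> 'c" where
  "swap \<alpha> \<beta> K \<phi> v = (if v \<in> K then (if \<phi> v = \<alpha> then \<beta> else \<alpha>) else \<phi> v)"

text \<open>A step swaps two colors on a union of Kempe components, which is the same as a sequence of
  valid Kempe swaps. Colorings are only considered up to agreement on \<^term>\<open>V\<close>.\<close>
definition step :: "'v set \<Rightarrow> ('v \<Rightarrow> 'c set) \<Rightarrow> ('v \<Rightarrow> 'c) \<Rightarrow> ('v \<Rightarrow> 'c) \<Rightarrow> bool" where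
  "step V L \<phi> \<psi> \<longleftrightarrow> colors V L \<phi> \<and> colors V L \<psi> \<and>
     (\<exists>\<alpha> \<beta> K. swap_set V \<phi> \<alpha> \<beta> K \<and> (\<forall>v\<in>V. \<psi> v = swap \<alpha> \<beta> K \<phi> v))"

abbreviation steps :: "'v set \<Rightarrow> ('v \<Rightarrow> 'c set) \<Rightarrow> ('v \<Rightarrow> 'c) \<Rightarrow> ('v \<Rightarrow> 'c) \<Rightarrow> bool" where
  "steps V L \<equiv> (step V L)\<^sup>*\<^sup>*"

definition all_equivalent :: "'v set \<Rightarrow> ('v \<Rightarrow> 'c set) \<Rightarrow> bool" where
  "all_equivalent V L \<longleftrightarrow> (\<forall>\<phi> \<psi>. colors V L \<phi> \<longrightarrow> colors V L \<psi> \<longrightarrow> steps V L \<phi> \<psi>)"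

lemma swap_setI:
  assumes "K \<subseteq> V" "\<And>v. v \<in> K \<Longrightarrow> \<phi> v = \<alpha> \<or> \<phi> v = \<beta>"
    "\<And>v w. v \<in> K \<Longrightarrow> w \<in> V \<Longrightarrow> adj v w \<Longrightarrow> \<phi> w = \<alpha> \<or> \<phi> w = \<beta> \<Longrightarrow> w \<in> K"
  shows "swap_set V \<phi> \<alpha> \<beta> K"
  using assms unfolding swap_set_def by blast

lemma swap_setD:
  assumes "swap_set V \<phi> \<alpha> \<beta> K"
  shows "K \<subseteq> V" "v \<in> K \<Longrightarrow> \<phi> v = \<alpha> \<or> \<phi> v = \<beta>"
    "v \<in> K \<Longrightarrow> w \<in> V \<Longrightarrow> adj v w \<Longrightarrow> \<phi> w = \<alpha> \<or> \<phi> w = \<beta> \<Longrightarrow> w \<in> K"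
  using assms unfolding swap_set_def by blast+

lemma colors_cong: "(\<And>v. v \<in> V \<Longrightarrow> \<phi> v = \<psi> v) \<Longrightarrow> colors V L \<phi> = colors V L \<psi>"
  unfolding colors_def by simp

lemma colors_subset: "colors V L \<phi> \<Longrightarrow> W \<subseteq> V \<Longrightarrow> colors W L \<phi>"
  unfolding colors_def by blast

lemma step_swap:
  assumes "colors V L \<phi>" "swap_set V \<phi> \<alpha> \<beta> K" "\<And>v. v \<in> K \<Longrightarrow> swap \<alpha> \<beta> K \<phi> v \<in> L v"
    "\<And>v. v \<in> V \<Longrightarrow> \<psi> v = swap \<alpha> \<beta> K \<phi> v"
  shows "step V L \<phi> \<psi>"
proof -
  have "\<psi> v \<in> L v" if "v \<in> V" for v
    using that assms by (cases "v \<in> K") (auto simp: colors_def swap_def)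
  moreover have "\<psi> u \<noteq> \<psi> v" if uv: "u \<in> V" "v \<in> V" "adj u v" for u v
  proof -
    have ne: "\<phi> u \<noteq> \<phi> v" using assms(1) uv by (simp add: colors_def)
    note im = swap_setD(2)[OF assms(2)] and cl = swap_setD(3)[OF assms(2)]
    show ?thesis
      unfolding assms(4)[OF uv(1)] assms(4)[OF uv(2)] swap_def
      using ne im[of u] im[of v] cl[of u v] cl[of v u] uv adj_sym[OF uv(3)] by auto
  qed
  ultimately have "colors V L \<psi>" unfolding colors_def by blast
  then show ?thesis using assms unfolding step_def by blast
qed

lemma steps_agree:
  assumes "colors V L \<phi>" "\<And>v. v \<in> V \<Longrightarrow> \<psi> v = \<phi> v"
  shows "steps V L \<phi> \<psi>"
proof (rule r_into_rtranclp, rule step_swap[OF assms(1)])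
  show "swap_set V \<phi> undefined undefined {}" by (rule swap_setI) auto
  show "\<psi> v = swap undefined undefined {} \<phi> v" if "v \<in> V" for v
    using assms(2)[OF that] by (simp add: swap_def)
qed simp

lemma step_sym:
  assumes "step V L \<phi> \<psi>"
  shows "step V L \<psi> \<phi>"
proof -
  obtain \<alpha> \<beta> K where K: "swap_set V \<phi> \<alpha> \<beta> K" "\<forall>v\<in>V. \<psi> v = swap \<alpha> \<beta> K \<phi> v"
    using assms unfolding step_def by blast
  note im = swap_setD(2)[OF K(1)] and KV = swap_setD(1)[OF K(1)]
  have \<psi>: "\<psi> v = (if v \<in> K then (if \<phi> v = \<alpha> then \<beta> else \<alpha>) else \<phi> v)" if "v \<in> V" for v
    using K(2) that by (simp add: swap_def)
  have "swap_set V \<psi> \<alpha> \<beta> K"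
  proof (rule swap_setI)
    show "\<psi> v = \<alpha> \<or> \<psi> v = \<beta>" if "v \<in> K" for v
      using \<psi>[OF subsetD[OF KV that]] that by simp
    show "w \<in> K" if vw: "v \<in> K" "w \<in> V" "adj v w" "\<psi> w = \<alpha> \<or> \<psi> w = \<beta>" for v w
    proof (rule ccontr)
      assume "w \<notin> K"
      then have "\<phi> w = \<alpha> \<or> \<phi> w = \<beta>" using vw \<psi>[of w] by simp
      then show False using swap_setD(3)[OF K(1) vw(1-3)] \<open>w \<notin> K\<close> by blast
    qed
  qed (rule KV)
  moreover have "\<forall>v\<in>V. \<phi> v = swap \<alpha> \<beta> K \<psi> v"
  proof
    fix v assume "v \<in> V"
    then show "\<phi> v = swap \<alpha> \<beta> K \<psi> v" using \<psi>[of v] im[of v] by (auto simp: swap_def)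
  qed
  ultimately show ?thesis using assms unfolding step_def by blast
qed

lemma steps_sym: "steps V L \<phi> \<psi> \<Longrightarrow> steps V L \<psi> \<phi>"
proof (induction rule: rtranclp_induct)
  case (step \<eta> \<theta>)
  then show ?case using step_sym[OF step(2)] by (simp add: converse_rtranclp_into_rtranclp)
qed simp

lemma step_cong_left:
  assumes "step V L \<phi> \<psi>" "\<And>v. v \<in> V \<Longrightarrow> \<phi>' v = \<phi> v"
  shows "step V L \<phi>' \<psi>"
proof -
  obtain \<alpha> \<beta> K where K: "swap_set V \<phi> \<alpha> \<beta> K" "\<forall>v\<in>V. \<psi> v = swap \<alpha> \<beta> K \<phi> v"
    using assms unfolding step_def by blast
  note im = swap_setD(2)[OF K(1)] and KV = swap_setD(1)[OF K(1)]
  have "swap_set V \<phi>' \<alpha> \<beta> K"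
  proof (rule swap_setI)
    show "\<phi>' v = \<alpha> \<or> \<phi>' v = \<beta>" if "v \<in> K" for v
      using im[OF that] assms(2)[of v] KV that by auto
    show "w \<in> K" if "v \<in> K" "w \<in> V" "adj v w" "\<phi>' w = \<alpha> \<or> \<phi>' w = \<beta>" for v w
      using that(4) swap_setD(3)[OF K(1) that(1-3)] unfolding assms(2)[OF that(2)] by blast
  qed (rule KV)
  moreover have "\<forall>v\<in>V. \<psi> v = swap \<alpha> \<beta> K \<phi>' v"
    using K(2) unfolding swap_def using assms(2) by simp
  moreover have "colors V L \<phi>'" "colors V L \<psi>"
    using assms(1) colors_cong[of V \<phi>' \<phi> L] assms(2) by (simp_all add: step_def)
  ultimately show ?thesis unfolding step_def by blast
qed

lemma steps_mono:
  assumes "steps V M \<phi> \<psi>" "\<And>v. v \<in> V \<Longrightarrow> M v \<subseteq> L v"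
  shows "steps V L \<phi> \<psi>"
proof -
  have "step V L x y" if "step V M x y" for x y
    using that assms(2) unfolding step_def colors_def by blast
  then show ?thesis using assms(1) by (metis mono_rtranclp)
qed

lemma steps_colors: "steps V L \<phi> \<psi> \<Longrightarrow> colors V L \<phi> \<Longrightarrow> colors V L \<psi>"
  by (induction rule: rtranclp_induct) (simp_all add: step_def)

section \<open>Lifting steps to one more vertex\<close>

lemma lift_steps:
  assumes lift: "\<And>\<phi> \<theta>. colors W L \<phi> \<Longrightarrow> step V L \<phi> \<theta> \<Longrightarrow> \<exists>\<phi>'. steps W L \<phi> \<phi>' \<and> (\<forall>v\<in>V. \<phi>' v = \<theta> v)"
    and "steps V L \<phi> \<theta>" "colors W L \<phi>"
  shows "\<exists>\<phi>'. steps W L \<phi> \<phi>' \<and> (\<forall>v\<in>V. \<phi>' v = \<theta> v)"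
  using assms(2)
proof (induction rule: rtranclp_induct)
  case base then show ?case by blast
next
  case (step \<eta> \<theta>)
  then obtain \<phi>' where \<phi>': "steps W L \<phi> \<phi>'" "\<forall>v\<in>V. \<phi>' v = \<eta> v" by blast
  have "step V L \<phi>' \<theta>" using step_cong_left step.hyps(2) \<phi>'(2) by blast
  then obtain \<phi>'' where "steps W L \<phi>' \<phi>''" "\<forall>v\<in>V. \<phi>'' v = \<theta> v"
    using lift steps_colors[OF \<phi>'(1) assms(3)] by blast
  then show ?case using \<phi>'(1) by (meson rtranclp_trans)
qed

lemma swap_commute: "swap_set V \<phi> \<alpha> \<beta> K \<Longrightarrow> swap \<alpha> \<beta> K \<phi> = swap \<beta> \<alpha> K \<phi>"
  by (rule ext) (use swap_setD(2)[of V \<phi> \<alpha> \<beta> K] in \<open>force simp: swap_def\<close>)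

lemma swap_set_commute: "swap_set V \<phi> \<alpha> \<beta> K = swap_set V \<phi> \<beta> \<alpha> K"
  unfolding swap_set_def by (simp add: insert_commute)

lemma recolor_vertex:
  assumes "colors (insert v V) L \<phi>" "v \<notin> V" "\<gamma> \<in> L v" "\<And>w. w \<in> V \<Longrightarrow> adj v w \<Longrightarrow> \<phi> w \<noteq> \<gamma>"
  shows "step (insert v V) L \<phi> (\<phi>(v := \<gamma>))"
proof (rule step_swap[OF assms(1), of "\<phi> v" \<gamma> "{v}"])
  show "swap_set (insert v V) \<phi> (\<phi> v) \<gamma> {v}"
  proof (rule swap_setI)
    show "w \<in> {v}" if "u \<in> {v}" "w \<in> insert v V" "adj u w" "\<phi> w = \<phi> v \<or> \<phi> w = \<gamma>" for u w
      using that assms unfolding colors_def by auto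
  qed auto
qed (use assms in \<open>auto simp: swap_def\<close>)

lemma lift_step_unaffected:
  assumes "colors (insert v V) L \<phi>" "v \<notin> V" "swap_set V \<phi> \<alpha> \<beta> D" "\<And>u. u \<in> V \<Longrightarrow> \<theta> u = swap \<alpha> \<beta> D \<phi> u"
    "colors V L \<theta>" "\<phi> v \<notin> {\<alpha>, \<beta>} \<or> (\<forall>x\<in>D. \<not> adj x v)"
  shows "step (insert v V) L \<phi> (\<theta>(v := \<phi> v))"
proof (rule step_swap[OF assms(1), of \<alpha> \<beta> D])
  note DV = swap_setD(1)[OF assms(3)]
  show "swap_set (insert v V) \<phi> \<alpha> \<beta> D"
  proof (rule swap_setI)
    show "w \<in> D" if "u \<in> D" "w \<in> insert v V" "adj u w" "\<phi> w = \<alpha> \<or> \<phi> w = \<beta>" for u w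
      using that assms(6) swap_setD(3)[OF assms(3) that(1) _ that(3,4)] by (cases "w = v") auto
  qed (use DV swap_setD(2)[OF assms(3)] in auto)
  show "swap \<alpha> \<beta> D \<phi> u \<in> L u" if "u \<in> D" for u
    using assms(4)[OF subsetD[OF DV that]] assms(5) subsetD[OF DV that] by (metis colors_def)
  show "(\<theta>(v := \<phi> v)) u = swap \<alpha> \<beta> D \<phi> u" if "u \<in> insert v V" for u
    using that assms(2,4) DV by (auto simp: swap_def)
qed

text \<open>Only neighbors whose lists meet the list of the new vertex count, because no other neighbor
  ever restricts its color.\<close>
lemma lift_step_insert:
  assumes "finite V" "v \<notin> V" and few: "card {w\<in>V. adj v w \<and> L w \<inter> L v \<noteq> {}} < card (L v)"
    and \<phi>: "colors (insert v V) L \<phi>" and "step V L \<phi> \<theta>"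
  shows "\<exists>\<phi>'. steps (insert v V) L \<phi> \<phi>' \<and> (\<forall>w\<in>V. \<phi>' w = \<theta> w)"
proof -
  obtain \<alpha>0 \<beta>0 D where D0: "swap_set V \<phi> \<alpha>0 \<beta>0 D" "\<And>u. u \<in> V \<Longrightarrow> \<theta> u = swap \<alpha>0 \<beta>0 D \<phi> u"
    using assms(5) unfolding step_def by blast
  have \<theta>: "colors V L \<theta>" using assms(5) by (simp add: step_def)
  note DV = swap_setD(1)[OF D0(1)]
  show ?thesis
  proof (cases "\<phi> v \<notin> {\<alpha>0, \<beta>0} \<or> (\<forall>x\<in>D. \<not> adj x v)")
    case True
    then have "step (insert v V) L \<phi> (\<theta>(v := \<phi> v))"
      using lift_step_unaffected[OF \<phi> assms(2) D0 \<theta>] by blast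
    then show ?thesis using assms(2) by (intro exI[of _ "\<theta>(v := \<phi> v)"]) auto
  next
    case False
    define \<alpha> where "\<alpha> = \<phi> v"
    define \<beta> where "\<beta> = (if \<phi> v = \<alpha>0 then \<beta>0 else \<alpha>0)"
    have D: "swap_set V \<phi> \<alpha> \<beta> D" "\<And>u. u \<in> V \<Longrightarrow> \<theta> u = swap \<alpha> \<beta> D \<phi> u"
      using False D0 swap_set_commute[of V \<phi> \<alpha>0 \<beta>0 D] swap_commute[OF D0(1)]
      unfolding \<alpha>_def \<beta>_def by (auto split: if_splits)
    obtain x where x: "x \<in> D" "adj v x" using False adj_sym by blast
    have proper: "\<phi> w \<noteq> \<alpha>" if "w \<in> V" "adj v w" for w
      using \<phi> that unfolding colors_def \<alpha>_def by auto
    note \<phi>D = swap_setD(2)[OF D(1)]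
    have xV: "x \<in> V" using x DV by blast
    have x\<beta>: "\<phi> x = \<beta>" using \<phi>D[OF x(1)] proper[OF xV x(2)] by blast
    have \<alpha>\<beta>: "\<alpha> \<noteq> \<beta>" using x\<beta> proper[OF xV x(2)] by blast
    have \<alpha>L: "\<alpha> \<in> L v" using \<phi> by (simp add: colors_def \<alpha>_def)
    show ?thesis
    \<comment> \<open>The swap extends to \<open>v\<close> if \<beta> is in its list and all its
      \<beta>-colored neighbors take part; otherwise \<open>v\<close> is first moved to a third
      color.\<close>
    proof (cases "\<beta> \<in> L v \<and> (\<forall>w\<in>V. adj v w \<longrightarrow> \<phi> w = \<beta> \<longrightarrow> w \<in> D)")
      case True
      have "step (insert v V) L \<phi> (\<theta>(v := \<beta>))"
      proof (rule step_swap[OF \<phi>, of \<alpha> \<beta> "insert v D"])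
        show "swap_set (insert v V) \<phi> \<alpha> \<beta> (insert v D)"
        proof (rule swap_setI)
          show "insert v D \<subseteq> insert v V" using DV by blast
          show "\<phi> u = \<alpha> \<or> \<phi> u = \<beta>" if "u \<in> insert v D" for u using that \<phi>D[of u] by (auto simp: \<alpha>_def)
          fix u w assume u: "u \<in> insert v D" "w \<in> insert v V" "adj u w" "\<phi> w = \<alpha> \<or> \<phi> w = \<beta>"
          show "w \<in> insert v D"
          proof (cases "w = v")
            case False
            then have w: "w \<in> V" using u by blast
            show ?thesis
            proof (cases "u = v")
              case True
              then have "\<phi> w = \<beta>" using u proper[OF w] by blast
              then show ?thesis using \<open>\<beta> \<in> L v \<and> _\<close> u True w by blast
            next
              case False
              then show ?thesis using u(1) swap_setD(3)[OF D(1) _ w u(3,4)] by blast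
            qed
          qed simp
        qed
        show "swap \<alpha> \<beta> (insert v D) \<phi> u \<in> L u" if "u \<in> insert v D" for u
        proof (cases "u = v")
          case False
          then have "u \<in> V" "swap \<alpha> \<beta> (insert v D) \<phi> u = \<theta> u" using that DV D(2)[of u] by (auto simp: swap_def)
          then show ?thesis using \<theta> by (simp add: colors_def)
        qed (use True in \<open>simp add: swap_def \<alpha>_def\<close>)
        show "(\<theta>(v := \<beta>)) u = swap \<alpha> \<beta> (insert v D) \<phi> u" if "u \<in> insert v V" for u
          using that D(2)[of u] by (auto simp: swap_def \<alpha>_def)
      qed
      then show ?thesis using assms(2) by (intro exI[of _ "\<theta>(v := \<beta>)"]) auto
    next
      case False
      let ?R = "{w\<in>V. adj v w \<and> L w \<inter> L v \<noteq> {}}" and ?N = "{w\<in>V. adj v w}"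
      have fin: "finite ?R" "finite (L v)" using assms(1) few by (auto intro: card_ge_0_finite)
      \<comment> \<open>After the swap \<open>x\<close> carries \<alpha>, which is also in the list
        of \<open>v\<close>. So \<open>x\<close> is counted as a neighbor even if \<beta> is not in
        the list of \<open>v\<close>.\<close>
      have "\<theta> x = \<alpha>" using D(2)[OF xV] x(1) x\<beta> \<alpha>\<beta> by (simp add: swap_def)
      then have xR: "x \<in> ?R" using xV x \<theta> \<alpha>L by (auto simp: colors_def)
      have inR: "w \<in> ?R" if "w \<in> ?N" "\<phi> w \<in> L v" for w
        using that \<phi> by (auto simp: colors_def)
      \<comment> \<open>The neighbor \<open>x\<close> blocks no color of its own: either \<beta> is
        not in the list of \<open>v\<close>, or another neighbor outside \<open>D\<close> has color
        \<beta> too. This saves one color, so a third color remains beside \<alpha>.\<close>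
      have seen: "L v \<inter> \<phi> ` ?N \<subseteq> \<phi> ` (?R - {x})"
      proof
        fix y assume "y \<in> L v \<inter> \<phi> ` ?N"
        then obtain w where w: "w \<in> ?N" "y = \<phi> w" "\<phi> w \<in> L v" by blast
        show "y \<in> \<phi> ` (?R - {x})"
        proof (cases "w = x")
          case False then show ?thesis using inR w by blast
        next
          case True
          then have "\<beta> \<in> L v" using w x\<beta> by simp
          then obtain x' where x': "x' \<in> V" "adj v x'" "\<phi> x' = \<beta>" "x' \<notin> D" using False by blast
          then have "x' \<in> ?R" "x' \<noteq> x" using inR \<open>\<beta> \<in> L v\<close> x by auto
          then show ?thesis using w True x\<beta> x' by (metis (no_types, lifting) DiffI imageI singletonD)
        qed
      qed
      have "card (L v \<inter> \<phi> ` ?N) \<le> card (?R - {x})"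
        using seen fin(1) by (meson card_image_le card_mono finite_Diff finite_imageI le_trans)
      also have "\<dots> < card ?R" using xR fin(1) by (meson card_Diff1_less)
      finally have "card (L v \<inter> \<phi> ` ?N) + 1 < card (L v)" using few by linarith
      moreover have "card (insert \<alpha> (L v \<inter> \<phi> ` ?N)) \<le> card (L v \<inter> \<phi> ` ?N) + 1"
        using fin(2) by (simp add: card_insert_if)
      ultimately have "card (insert \<alpha> (L v \<inter> \<phi> ` ?N)) < card (L v)" by linarith
      then have "\<not> L v \<subseteq> insert \<alpha> (L v \<inter> \<phi> ` ?N)"
        using fin(2) by (metis card_mono finite.insertI finite_Int leD)
      then obtain \<gamma> where \<gamma>: "\<gamma> \<in> L v" "\<gamma> \<noteq> \<alpha>" "\<gamma> \<notin> \<phi> ` ?N" by blast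
      have "\<gamma> \<noteq> \<beta>" using \<gamma>(3) xV x x\<beta> by blast
      let ?\<phi> = "\<phi>(v := \<gamma>)"
      have 1: "step (insert v V) L \<phi> ?\<phi>"
        using recolor_vertex[OF \<phi> assms(2) \<gamma>(1)] \<gamma>(3) by blast
      have agree: "?\<phi> u = \<phi> u" if "u \<in> V" for u using that assms(2) by auto
      have "swap_set V ?\<phi> \<alpha> \<beta> D"
      proof (rule swap_setI)
        show "?\<phi> w = \<alpha> \<or> ?\<phi> w = \<beta>" if "w \<in> D" for w
          using \<phi>D[OF that] agree[of w] DV that by auto
        show "w \<in> D" if "u \<in> D" "w \<in> V" "adj u w" "?\<phi> w = \<alpha> \<or> ?\<phi> w = \<beta>" for u w
          using that(4) swap_setD(3)[OF D(1) that(1-3)] unfolding agree[OF that(2)] by blast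
      qed (rule DV)
      moreover have "\<theta> u = swap \<alpha> \<beta> D ?\<phi> u" if "u \<in> V" for u
        using D(2)[OF that] agree[OF that] by (simp add: swap_def)
      moreover have "colors (insert v V) L ?\<phi>" using 1 by (simp add: step_def)
      ultimately have 2: "step (insert v V) L ?\<phi> (\<theta>(v := ?\<phi> v))"
        using lift_step_unaffected[of v V L ?\<phi> \<alpha> \<beta> D \<theta>] assms(2) \<theta> \<gamma>(2) \<open>\<gamma> \<noteq> \<beta>\<close> by auto
      show ?thesis
        using 1 2 assms(2) by (intro exI[of _ "\<theta>(v := ?\<phi> v)"]) auto
    qed
  qed
qed

text \<open>Lifting brings all old vertices to their colors under \<psi>; the color of
  \<open>v\<close> under \<psi> is then free and can be assigned directly.\<close>

lemma all_equivalent_insert: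
  assumes "finite V" "v \<notin> V" "card {w\<in>V. adj v w \<and> L w \<inter> L v \<noteq> {}} < card (L v)" "all_equivalent V L"
  shows "all_equivalent (insert v V) L"
  unfolding all_equivalent_def
proof (intro allI impI)
  fix \<phi> \<psi> assume \<phi>: "colors (insert v V) L \<phi>" and \<psi>: "colors (insert v V) L \<psi>"
  have "steps V L \<phi> \<psi>"
    using assms(4) colors_subset[OF \<phi>, of V] colors_subset[OF \<psi>, of V] unfolding all_equivalent_def by blast
  then obtain \<phi>' where \<phi>': "steps (insert v V) L \<phi> \<phi>'" "\<forall>w\<in>V. \<phi>' w = \<psi> w"
    using lift_steps[OF lift_step_insert[OF assms(1-3)]] \<phi> by blast
  have "colors (insert v V) L \<phi>'" using steps_colors \<phi>' \<phi> by blast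
  moreover have "\<phi>' w \<noteq> \<psi> v" if "w \<in> V" "adj v w" for w
    using that \<phi>'(2) \<psi> unfolding colors_def by (metis insertCI)
  moreover have "\<psi> v \<in> L v" using \<psi> by (simp add: colors_def)
  ultimately have "step (insert v V) L \<phi>' (\<phi>'(v := \<psi> v))"
    using recolor_vertex[of v V L \<phi>' "\<psi> v"] assms(2) by simp
  then have 1: "step (insert v V) L \<phi>' (\<phi>'(v := \<psi> v))" .
  have "steps (insert v V) L (\<phi>'(v := \<psi> v)) \<psi>"
  proof (rule steps_agree)
    show "colors (insert v V) L (\<phi>'(v := \<psi> v))" using 1 unfolding step_def by (rule conjunct1[OF conjunct2])
    show "\<psi> w = (\<phi>'(v := \<psi> v)) w" if "w \<in> insert v V" for w using that \<phi>'(2) by auto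
  qed
  then show "steps (insert v V) L \<phi> \<psi>" using \<phi>'(1) 1 by (meson rtranclp.rtrancl_into_rtrancl rtranclp_trans)
qed

section \<open>Degenerate orders of the vertices\<close>

lemma colors_insert_exists:
  assumes "finite V" "v \<notin> V" "card {w\<in>V. adj v w \<and> L w \<inter> L v \<noteq> {}} < card (L v)" "colors V L \<phi>"
  shows "\<exists>\<psi>. colors (insert v V) L \<psi>"
proof -
  let ?R = "{w\<in>V. adj v w \<and> L w \<inter> L v \<noteq> {}}"
  have "card (\<phi> ` ?R) < card (L v)"
    using assms(1,3) card_image_le[of ?R \<phi>] by simp
  moreover have "finite (\<phi> ` ?R)" using assms(1) by simp
  ultimately have "\<not> L v \<subseteq> \<phi> ` ?R" by (metis card_mono leD)
  then obtain \<gamma> where \<gamma>: "\<gamma> \<in> L v" "\<gamma> \<notin> \<phi> ` ?R" by blast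
  have "\<phi> w \<noteq> \<gamma>" if "w \<in> V" "adj v w" for w
    using that \<gamma> assms(4) unfolding colors_def by blast
  then have "colors (insert v V) L (\<phi>(v := \<gamma>))"
    using assms(2,4) \<gamma>(1) adj_irrefl adj_sym unfolding colors_def by (simp add: fun_upd_def) metis
  then show ?thesis by blast
qed

text \<open>One notion gives both existence and equivalence of colorings. As only neighbors with
  intersecting lists are counted, precolored vertices can take part with singleton lists: they cost
  nothing to a vertex whose list already avoids their colors.\<close>

inductive degenerate :: "('v \<Rightarrow> 'c set) \<Rightarrow> 'v set \<Rightarrow> bool" for L where
  empty: "degenerate L {}"
| insert: "degenerate L V \<Longrightarrow> v \<notin> V \<Longrightarrow> card {w\<in>V. adj v w \<and> L w \<inter> L v \<noteq> {}} < card (L v) \<Longrightarrow>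
    degenerate L (insert v V)"

lemma degenerate_finite: "degenerate L V \<Longrightarrow> finite V"
  by (induction rule: degenerate.induct) auto

lemma degenerate_all_equivalent: "degenerate L V \<Longrightarrow> all_equivalent V L"
proof (induction rule: degenerate.induct)
  case empty
  show ?case unfolding all_equivalent_def by (auto intro: steps_agree)
next
  case (insert V v)
  then show ?case using all_equivalent_insert degenerate_finite by blast
qed

lemma degenerate_colors: "degenerate L V \<Longrightarrow> \<exists>\<phi>. colors V L \<phi>"
proof (induction rule: degenerate.induct)
  case (insert V v)
  then show ?case using colors_insert_exists degenerate_finite by blast
qed (simp add: colors_def)

text \<open>Adjacent vertices have disjoint singleton lists, so no neighbor is counted.\<close>

lemma degenerate_singletons:
  assumes "finite V" "colors V L \<theta>" "\<And>v. v \<in> V \<Longrightarrow> M v = {\<theta> v}"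
  shows "degenerate M V"
  using assms
proof (induction V rule: finite_induct)
  case (insert v V)
  have "{w\<in>V. adj v w \<and> M w \<inter> M v \<noteq> {}} = {}"
    using insert.prems by (auto simp: colors_def)
  then have "card {w\<in>V. adj v w \<and> M w \<inter> M v \<noteq> {}} < card (M v)"
    using insert.prems(2) by (metis card.empty card_1_singleton_iff insertI1 less_one One_nat_def)
  moreover have "degenerate M V" using insert colors_subset by blast
  ultimately show ?case using insert.hyps by (intro degenerate.insert) auto
qed (rule degenerate.empty)

end

section \<open>Lifting swaps over an even cycle\<close>

lemma of_bool_add_less: "2 \<le> m \<Longrightarrow> \<not> Q \<Longrightarrow> of_bool P + of_bool Q < (m :: nat)"
  by (cases P) auto

text \<open>A cyclic order as a periodic sequence over all naturals: the successor is always
  \<open>Suc\<close>, adding \<open>n - 1\<close> to an index gives the predecessor, and multiplying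
  indices by \<open>n - 1\<close>, which is -1 modulo \<open>n\<close>, reverses the
  direction.\<close>

locale cyclic_sequence =
  fixes c :: "nat \<Rightarrow> 'v" and n :: nat
  assumes n_ge: "3 \<le> n" and c_periodic: "c (i + n) = c i" and inj_c: "inj_on c {..<n}"
begin

lemma c_add_mult: "c (i + n * k) = c i"
proof (induction k)
  case (Suc k)
  have "c (i + n * Suc k) = c ((i + n * k) + n)" by (simp add: algebra_simps)
  then show ?case using Suc c_periodic by simp
qed simp

lemma c_mod: "c (i mod n) = c i"
  using c_add_mult[of "i mod n" "i div n"] by (simp add: mod_mult_div_eq)

lemma c_eq_iff: "c i = c j \<longleftrightarrow> i mod n = j mod n"
proof
  assume "c i = c j"
  then have "c (i mod n) = c (j mod n)" by (simp add: c_mod)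
  then show "i mod n = j mod n" using inj_c n_ge by (simp add: inj_on_eq_iff)
qed (metis c_mod)

lemma c_add_eq_iff: "c (i + k) = c (j + k) \<longleftrightarrow> c i = c j"
proof
  assume "c i = c j"
  then show "c (i + k) = c (j + k)" unfolding c_eq_iff by (metis mod_add_left_eq)
next
  assume "c (i + k) = c (j + k)"
  then have "c ((i + k) + (n - 1) * k) = c ((j + k) + (n - 1) * k)"
    unfolding c_eq_iff by (metis mod_add_left_eq)
  moreover have "(x + k) + (n - 1) * k = x + n * k" for x
    using n_ge by (cases n) (auto simp: algebra_simps)
  ultimately show "c i = c j" by (simp only: c_add_mult)
qed

lemma c_Suc_eq_iff: "c (Suc i) = c (Suc j) \<longleftrightarrow> c i = c j"
  using c_add_eq_iff[of i 1 j] by simp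

lemma c_n: "c n = c 0"
  using c_periodic[of 0] by simp

lemma range_c: "range c = c ` {..<n}"
proof
  show "range c \<subseteq> c ` {..<n}"
  proof
    fix x assume "x \<in> range c"
    then obtain i where "x = c (i mod n)" by (auto simp: c_mod)
    then show "x \<in> c ` {..<n}" using n_ge by auto
  qed
qed auto

lemma shift_surj: "\<exists>j. c (j + k) = c i"
proof -
  have "(i + (n - 1) * k) + k = i + n * k" using n_ge by (cases n) (auto simp: algebra_simps)
  then show ?thesis using c_add_mult by metis
qed

lemma range_shift: "range (\<lambda>i. c (i + k)) = range c"
proof
  show "range c \<subseteq> range (\<lambda>i. c (i + k))"
  proof
    fix x assume "x \<in> range c"
    then obtain i where "x = c i" by blast
    then obtain j where "x = c (j + k)" using shift_surj[of k i] by metis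
    then show "x \<in> range (\<lambda>i. c (i + k))" by blast
  qed
qed auto

lemma c_rev_Suc: "c (Suc ((n - 1) * Suc i)) = c ((n - 1) * i)"
proof -
  have "Suc ((n - 1) * Suc i) = (n - 1) * i + n" using n_ge by (cases n) auto
  then show ?thesis by (simp only: c_periodic)
qed

lemma rev_surj: "\<exists>j. c ((n - 1) * j) = c i"
proof -
  have "(n - 1) * ((n - 1) * i) = i + n * ((n - 2) * i)"
    using n_ge by (cases n; cases "n - 1") (auto simp: algebra_simps)
  then show ?thesis using c_add_mult by metis
qed

lemma index_function: "\<exists>\<xi>. \<forall>i<n. \<xi> (c i) = f i"
  using inj_c by (intro exI[of _ "f \<circ> inv_into {..<n} c"]) (auto simp: inv_into_f_f)

lemma index_cases: obtains j where "j < n" "c i = c j" "c (Suc i) = (if Suc j = n then c 0 else c (Suc j))"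
proof
  show "i mod n < n" "c i = c (i mod n)" using n_ge by (auto simp: c_mod)
  have "c (Suc i) = c (Suc (i mod n))" by (simp add: c_Suc_eq_iff c_mod)
  then show "c (Suc i) = (if Suc (i mod n) = n then c 0 else c (Suc (i mod n)))" by (simp add: c_n)
qed

end

locale even_cycle = adjacency adj + cyclic_sequence c n
  for adj :: "'v \<Rightarrow> 'v \<Rightarrow> bool" and c :: "nat \<Rightarrow> 'v" and n :: nat +
  assumes even_n: "even n"
    and adj_c: "adj (c i) (c j) \<longleftrightarrow> c j = c (Suc i) \<or> c i = c (Suc j)"
begin

lemma even_cycle_shift: "even_cycle adj (\<lambda>i. c (i + k)) n"
proof unfold_locales
  show "inj_on (\<lambda>i. c (i + k)) {..<n}" using inj_c by (auto simp: inj_on_def c_add_eq_iff)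
  show "c (i + n + k) = c (i + k)" for i using c_periodic[of "i + k"] by (simp add: ac_simps)
  show "adj (c (i + k)) (c (j + k)) = (c (j + k) = c (Suc i + k) \<or> c (i + k) = c (Suc j + k))" for i j
    using adj_c[of "i + k" "j + k"] by simp
qed (use even_n n_ge in auto)

lemma even_cycle_rev: "even_cycle adj (\<lambda>i. c ((n - 1) * i)) n"
proof unfold_locales
  show "c ((n - 1) * (i + n)) = c ((n - 1) * i)" for i
  proof -
    have "(n - 1) * (i + n) = (n - 1) * i + n * (n - 1)" by (simp only: distrib_left mult.commute)
    then show ?thesis by (simp only: c_add_mult)
  qed
  show "adj (c ((n - 1) * i)) (c ((n - 1) * j)) =
      (c ((n - 1) * j) = c ((n - 1) * Suc i) \<or> c ((n - 1) * i) = c ((n - 1) * Suc j))" for i j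
  proof -
    have "c ((n - 1) * i) = c (Suc ((n - 1) * j)) \<longleftrightarrow> c ((n - 1) * Suc i) = c ((n - 1) * j)" for i j
      using c_Suc_eq_iff[of "(n - 1) * Suc i" "(n - 1) * j"] unfolding c_rev_Suc .
    from this[of i j] this[of j i] show ?thesis unfolding adj_c by metis
  qed
  show "inj_on (\<lambda>i. c ((n - 1) * i)) {..<n}"
  proof (rule eq_card_imp_inj_on)
    have "(\<lambda>i. c ((n - 1) * i)) ` {..<n} = range c"
    proof
      show "range c \<subseteq> (\<lambda>i. c ((n - 1) * i)) ` {..<n}"
      proof
        fix x assume "x \<in> range c"
        then obtain j where j: "x = c ((n - 1) * j)" using rev_surj by (metis rangeE)
        have "c ((n - 1) * j) = c ((n - 1) * (j mod n))" unfolding c_eq_iff by (metis mod_mult_right_eq)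
        then show "x \<in> (\<lambda>i. c ((n - 1) * i)) ` {..<n}" using j n_ge by auto
      qed
    qed auto
    then show "card ((\<lambda>i. c ((n - 1) * i)) ` {..<n}) = card {..<n}"
      using inj_c range_c by (simp add: card_image)
  qed simp
qed (use even_n n_ge in auto)

text \<open>The cycle is added after \<open>V0\<close> in the order \<open>c 0\<close>,
  \<open>c (n - 1)\<close>, ..., \<open>c 1\<close>. Each vertex then sees only its successor among
  the cycle vertices already present, except \<open>c 1\<close>, which also sees \<open>c 0\<close>;
  the two indicators count these neighbors.\<close>

lemma degenerate_cycle:
  assumes V0: "degenerate M V0" "\<And>i. c i \<notin> V0"
    and irrel: "\<And>i w. w \<in> V0 \<Longrightarrow> adj (c i) w \<Longrightarrow> M w \<inter> M (c i) = {}"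
    and M0: "0 < card (M (c 0))"
    and Mt: "\<And>t. 1 \<le> t \<Longrightarrow> t < n \<Longrightarrow> of_bool (M (c t) \<inter> M (c (Suc t)) \<noteq> {}) +
       of_bool (t = 1 \<and> M (c 1) \<inter> M (c 0) \<noteq> {}) < card (M (c t))"
  shows "degenerate M (V0 \<union> range c)"
proof -
  define W where "W = (\<lambda>t. V0 \<union> insert (c 0) (c ` {t..<n}))"
  have W: "degenerate M (W (n - k))" if "k < n" for k
    using that
  proof (induction k)
    case 0
    have "{w\<in>V0. adj (c 0) w \<and> M w \<inter> M (c 0) \<noteq> {}} = {}" using irrel by blast
    then have "card {w\<in>V0. adj (c 0) w \<and> M w \<inter> M (c 0) \<noteq> {}} < card (M (c 0))" using M0 by (simp only: card.empty)
    then have "degenerate M (insert (c 0) V0)"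
      using V0 by (intro degenerate.insert)
    then show ?case by (simp add: W_def)
  next
    case (Suc k)
    define t where "t = n - Suc k"
    have t: "1 \<le> t" "t < n" "n - k = Suc t" using Suc.prems by (auto simp: t_def)
    have IH: "degenerate M (W (Suc t))" using Suc t by simp
    have "{t..<n} = insert t {Suc t..<n}" using t by auto
    then have Wt: "W t = insert (c t) (W (Suc t))" unfolding W_def by auto
    have ne: "c t \<noteq> c j" if "j < n" "j \<noteq> t" for j
      using inj_c t that by (auto simp: inj_on_eq_iff)
    have notin: "c t \<notin> W (Suc t)"
      using V0(2)[of t] ne[of 0] ne t unfolding W_def by fastforce
    let ?R = "{w\<in>W (Suc t). adj (c t) w \<and> M w \<inter> M (c t) \<noteq> {}}"
    let ?A = "if M (c t) \<inter> M (c (Suc t)) \<noteq> {} then {c (Suc t)} else {}"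
    let ?B = "if t = 1 \<and> M (c 1) \<inter> M (c 0) \<noteq> {} then {c 0} else {}"
    have "?R \<subseteq> ?A \<union> ?B"
    proof
      fix w assume w: "w \<in> ?R"
      then have "w \<notin> V0" using irrel by blast
      then obtain j where j: "w = c j" "j = 0 \<or> Suc t \<le> j" "j < n"
      proof -
        have "w = c 0 \<or> (\<exists>j. w = c j \<and> Suc t \<le> j \<and> j < n)" using w \<open>w \<notin> V0\<close> unfolding W_def by auto
        then show ?thesis using that[of 0] that n_ge by auto
      qed
      have "c j = c (Suc t) \<or> c t = c (Suc j)" using w j adj_c by simp
      then show "w \<in> ?A \<union> ?B"
      proof
        assume "c j = c (Suc t)" then show ?thesis using w j by auto
      next
        assume eq: "c t = c (Suc j)"
        have "j = 0"
        proof (rule ccontr)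
          assume "j \<noteq> 0"
          then have "Suc t \<le> j" using j by blast
          then show False using eq ne[of "Suc j"] ne[of 0] t j by (cases "Suc j = n") (auto simp: c_n)
        qed
        then have "t = 1" using eq ne[of 1] n_ge by auto
        then show ?thesis using w j \<open>j = 0\<close> by auto
      qed
    qed
    then have "card ?R \<le> card (?A \<union> ?B)" by (intro card_mono) auto
    also have "\<dots> \<le> card ?A + card ?B" by (rule card_Un_le)
    also have "\<dots> = of_bool (M (c t) \<inter> M (c (Suc t)) \<noteq> {}) + of_bool (t = 1 \<and> M (c 1) \<inter> M (c 0) \<noteq> {})"
      by simp
    also have "\<dots> < card (M (c t))" by (rule Mt[OF t(1,2)])
    finally have "degenerate M (insert (c t) (W (Suc t)))" using IH notin by (intro degenerate.insert)
    then show ?case using Wt by (simp add: t_def)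
  qed
  have "W 1 = V0 \<union> range c"
  proof -
    have "{..<n} = insert 0 {1..<n}" using n_ge by auto
    then show ?thesis unfolding W_def range_c by (metis image_insert)
  qed
  then show ?thesis using W[of "n - 1"] n_ge by simp
qed

section \<open>Coloring an even cycle from lists of size two\<close>

lemma colors_range_iff:
  "colors (range c) L \<phi> \<longleftrightarrow> (\<forall>i. \<phi> (c i) \<in> L (c i)) \<and> (\<forall>i. \<phi> (c i) \<noteq> \<phi> (c (Suc i)))"
proof -
  have a: "adj (c i) (c (Suc i))" for i by (simp add: adj_c)
  have "\<phi> (c i) \<noteq> \<phi> (c j)" if "\<forall>i. \<phi> (c i) \<noteq> \<phi> (c (Suc i))" "adj (c i) (c j)" for i j
    using that unfolding adj_c by metis
  then show ?thesis using a unfolding colors_def by blast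
qed

text \<open>Equal lists allow an alternating coloring, and here the length must be even. Otherwise
  some color of a vertex is missing from the next list; once that color is fixed, the successor,
  last in the backward order, sees only one relevant neighbor.\<close>

theorem cycle_two_choosable:
  assumes A: "\<And>i. 2 \<le> card (A (c i))"
  shows "\<exists>\<xi>. colors (range c) A \<xi>"
proof -
  have "\<exists>S. S \<subseteq> A v \<and> card S = 2" if "v \<in> range c" for v
    using that A obtain_subset_with_card_n by (metis rangeE)
  then obtain S where S: "\<And>v. v \<in> range c \<Longrightarrow> S v \<subseteq> A v \<and> card (S v) = 2" by metis
  have "\<exists>\<xi>. colors (range c) S \<xi>"
  proof (cases "\<forall>i. S (c i) = S (c (Suc i))")
    case True
    have const: "S (c i) = S (c 0)" for i by (induction i) (use True in auto)
    obtain x y where xy: "S (c 0) = {x, y}" "x \<noteq> y" using S by (metis card_2_iff rangeI)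
    obtain \<xi> where \<xi>: "\<forall>i<n. \<xi> (c i) = (if even i then x else y)"
      using index_function[of "\<lambda>i. if even i then x else y"] by blast
    have "\<xi> (c i) \<noteq> \<xi> (c (Suc i))" for i
    proof (rule index_cases[of i])
      fix j assume "j < n" "c i = c j" "c (Suc i) = (if Suc j = n then c 0 else c (Suc j))"
      then show ?thesis using \<xi> xy(2) even_n n_ge by (cases "Suc j = n") auto
    qed
    moreover have "\<xi> (c i) \<in> S (c i)" for i
    proof (rule index_cases[of i])
      fix j assume "j < n" "c i = c j"
      then show ?thesis using \<xi> const[of i] xy by auto
    qed
    ultimately show ?thesis unfolding colors_range_iff by blast
  next
    case False
    then obtain k where k: "S (c k) \<noteq> S (c (Suc k))" by blast
    have "\<not> S (c k) \<subseteq> S (c (Suc k))"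
      using k S by (metis card_subset_eq card_ge_0_finite pos2 rangeI)
    then obtain x where x: "x \<in> S (c k)" "x \<notin> S (c (Suc k))" by blast
    interpret sh: even_cycle adj "\<lambda>i. c (i + k)" n by (rule even_cycle_shift)
    let ?M = "S(c k := {x})"
    note rsh = range_shift[of k]
    have ne: "c (t + k) \<noteq> c k" if "1 \<le> t" "t < n" for t
      using sh.inj_c that by (auto dest: inj_onD[of _ _ t 0])
    have "degenerate ?M ({} \<union> range (\<lambda>i. c (i + k)))"
    proof (rule sh.degenerate_cycle[OF degenerate.empty])
      fix t :: nat assume t: "1 \<le> t" "t < n"
      show "of_bool (?M (c (t + k)) \<inter> ?M (c (Suc t + k)) \<noteq> {}) +
         of_bool (t = 1 \<and> ?M (c (1 + k)) \<inter> ?M (c (0 + k)) \<noteq> {}) < card (?M (c (t + k)))"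
      proof -
        have "2 \<le> card (?M (c (t + k)))" using ne[OF t] S[of "c (t + k)"] by simp
        moreover have "\<not> (t = 1 \<and> ?M (c (1 + k)) \<inter> ?M (c (0 + k)) \<noteq> {})"
          using x(2) ne[of 1] n_ge by simp
        ultimately show ?thesis by (intro of_bool_add_less)
      qed
    qed auto
    then obtain \<xi> where \<xi>: "colors (range c) ?M \<xi>" using degenerate_colors rsh by fastforce
    have "?M v \<subseteq> S v" for v using x by auto
    then have "colors (range c) S \<xi>" using \<xi> unfolding colors_def by blast
    then show ?thesis by blast
  qed
  then show ?thesis using S unfolding colors_def by blast
qed

text \<open>The clockwise condition makes every run of consecutive vertices colored \<open>\<alpha>\<close> or \<open>\<beta>\<close>
  swappable within the lists, except possibly for the first vertex of the run.\<close>
definition clockwise :: "('v \<Rightarrow> 'c set) \<Rightarrow> 'c \<Rightarrow> 'c \<Rightarrow> ('v \<Rightarrow> 'c) \<Rightarrow> bool" where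
  "clockwise S \<alpha> \<beta> \<xi> \<longleftrightarrow> (\<forall>i. \<xi> (c i) \<in> {\<alpha>, \<beta>} \<longrightarrow> \<xi> (c (Suc i)) \<in> {\<alpha>, \<beta>} \<longrightarrow> {\<alpha>, \<beta>} \<subseteq> S (c (Suc i)))"

text \<open>The coloring runs forward from \<open>c 1\<close>, which avoids both colors, to
  \<open>c 0\<close>, whose list is exactly \<open>{\<alpha>, \<beta>}\<close>. So
  \<open>c 0\<close> can use either color without a conflict at \<open>c 1\<close>, and the round
  closes.\<close>

lemma clockwise_coloring_exists_start:
  assumes S: "\<And>i. card (S (c i)) = 2" and "\<alpha> \<noteq> \<beta>" and both: "{\<alpha>, \<beta>} \<subseteq> S (c 0)" and "\<not> {\<alpha>, \<beta>} \<subseteq> S (c 1)"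
  shows "\<exists>\<xi>. colors (range c) S \<xi> \<and> clockwise S \<alpha> \<beta> \<xi>"
proof -
  \<comment> \<open>\<open>F i y\<close> holds the colors forbidden at \<open>c i\<close> after
    color \<open>y\<close> at its predecessor. It never covers a list of size two: when it is
    \<open>{\<alpha>, \<beta>}\<close>, the list is a different set.\<close>
  define F where "F = (\<lambda>i y. if y \<in> {\<alpha>, \<beta>} \<and> \<not> {\<alpha>, \<beta>} \<subseteq> S (c i) then {\<alpha>, \<beta>} else {y})"
  have free: "\<exists>y. y \<in> S (c i) - F i z" for i z
  proof (rule ccontr)
    assume "\<not> ?thesis"
    then have sub: "S (c i) \<subseteq> F i z" by blast
    then show False
    proof (cases "z \<in> {\<alpha>, \<beta>} \<and> \<not> {\<alpha>, \<beta>} \<subseteq> S (c i)")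
      case True
      then have "S (c i) \<subseteq> {\<alpha>, \<beta>}" using sub by (simp add: F_def)
      then have "S (c i) = {\<alpha>, \<beta>}" using S[of i] assms(2) by (intro card_subset_eq) auto
      then show False using True by blast
    next
      case False
      then have "S (c i) \<subseteq> {z}" using sub by (auto simp: F_def)
      then show False using S[of i] card_mono[of "{z}" "S (c i)"] by simp
    qed
  qed
  obtain y1 where y1: "y1 \<in> S (c 1)" "y1 \<notin> {\<alpha>, \<beta>}"
    using free[of 1 \<alpha>] assms(4) by (auto simp: F_def)
  have "\<exists>f. \<forall>t. (f t \<in> S (c (Suc t)) \<and> (t = 0 \<longrightarrow> f t = y1)) \<and> f (Suc t) \<notin> F (Suc (Suc t)) (f t)"
    by (rule dependent_nat_choice) (use y1 free in auto)
  then obtain f where f: "\<And>t. f t \<in> S (c (Suc t))" "f 0 = y1" "\<And>t. f (Suc t) \<notin> F (Suc (Suc t)) (f t)"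
    by blast
  \<comment> \<open>\<open>f t\<close> is the color of \<open>c (Suc t)\<close>, so
    \<open>f (n - 2)\<close> belongs to \<open>c (n - 1)\<close>, the predecessor of
    \<open>c 0\<close>.\<close>
  obtain z where z: "z \<in> {\<alpha>, \<beta>}" "z \<noteq> f (n - 2)" using assms(2) by blast
  obtain \<xi> where \<xi>: "\<forall>i<n. \<xi> (c i) = (if i = 0 then z else f (i - 1))"
    using index_function[of "\<lambda>i. if i = 0 then z else f (i - 1)"] by blast
  have F_self: "y \<in> F i y" for i y by (simp add: F_def)
  have mem: "\<xi> (c i) \<in> S (c i)" for i
  proof (rule index_cases[of i])
    fix j assume "j < n" "c i = c j"
    then show ?thesis using \<xi> f(1)[of "j - 1"] z both by (cases j) auto
  qed
  have pair: "\<xi> (c i) \<noteq> \<xi> (c (Suc i)) \<and>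
     (\<xi> (c i) \<in> {\<alpha>, \<beta>} \<longrightarrow> \<xi> (c (Suc i)) \<in> {\<alpha>, \<beta>} \<longrightarrow> {\<alpha>, \<beta>} \<subseteq> S (c (Suc i)))" for i
  proof (rule index_cases[of i])
    fix j assume j: "j < n" "c i = c j" and s: "c (Suc i) = (if Suc j = n then c 0 else c (Suc j))"
    have \<xi>j: "\<xi> (c j') = (if j' = 0 then z else f (j' - 1))" if "j' < n" for j' using \<xi> that by blast
    consider "Suc j = n" | "j = 0" "Suc j < n" | t where "j = Suc t" "Suc j < n" using j(1) by (cases j; cases "Suc j = n") auto
    then show ?thesis
    proof cases
      case 1
      then have "j - 1 = n - 2" "j \<noteq> 0" using n_ge by auto
      then have "\<xi> (c i) = f (n - 2)" unfolding j(2) using \<xi>j[OF j(1)] by simp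
      moreover have "c (Suc i) = c 0" using s 1 by simp
      moreover have "\<xi> (c 0) = z" using \<xi>j[of 0] n_ge by simp
      ultimately show ?thesis using z both by simp
    next
      case 2
      have "\<xi> (c i) = z" unfolding j(2) using \<xi>j[OF j(1)] 2 by simp
      moreover have "c (Suc i) = c 1" using s 2 by simp
      moreover have "\<xi> (c 1) = y1" using \<xi>j[of 1] f(2) n_ge by simp
      ultimately show ?thesis using y1 z by auto
    next
      case (3 t)
      have "\<xi> (c i) = f t" unfolding j(2) using \<xi>j[OF j(1)] 3 by simp
      moreover have eqs: "c (Suc i) = c (Suc (Suc t))" using s 3 by simp
      moreover have "\<xi> (c (Suc i)) = f (Suc t)" unfolding eqs using \<xi>j[of "Suc (Suc t)"] 3 by simp
      moreover have "f t \<noteq> f (Suc t)" using f(3)[of t] F_self[of "f t" "Suc (Suc t)"] by auto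
      moreover have "{\<alpha>, \<beta>} \<subseteq> S (c (Suc (Suc t)))" if "f t \<in> {\<alpha>, \<beta>}" "f (Suc t) \<in> {\<alpha>, \<beta>}"
        using f(3)[of t] that unfolding F_def by (cases "{\<alpha>, \<beta>} \<subseteq> S (c (Suc (Suc t)))") simp_all
      ultimately show ?thesis by simp
    qed
  qed
  show ?thesis
    using mem pair unfolding colors_range_iff clockwise_def by blast
qed

text \<open>If every list contains both colors, any coloring is clockwise. If none does, identifying
  \<beta> with \<alpha> is injective on each list, and a coloring from the merged lists never puts
  the two colors on consecutive vertices. Otherwise the round starts where the lists change.\<close>

theorem clockwise_coloring_exists:
  assumes S: "\<And>i. card (S (c i)) = 2" and "\<alpha> \<noteq> \<beta>"
  shows "\<exists>\<xi>. colors (range c) S \<xi> \<and> clockwise S \<alpha> \<beta> \<xi>"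
proof -
  let ?both = "\<lambda>i. {\<alpha>, \<beta>} \<subseteq> S (c i)"
  have all: "(\<forall>i. ?both i) \<or> (\<forall>i. \<not> ?both i)" if st: "\<And>i. ?both i \<Longrightarrow> ?both (Suc i)"
  proof -
    have up: "?both (i + k)" if "?both i" for i k
    proof (induction k)
      case (Suc k)
      then show ?case using st[of "i + k"] by simp
    qed (use that in simp)
    have "?both j" if "?both i" for i j
    proof -
      obtain k where "c (k + i) = c j" using shift_surj[of i j] by blast
      then show ?thesis using up[OF that, of k] by (simp only: add.commute)
    qed
    then show ?thesis by metis
  qed
  consider "\<forall>i. ?both i" | "\<forall>i. \<not> ?both i" | i where "?both i" "\<not> ?both (Suc i)"
    using all by metis
  then show ?thesis
  proof cases
    case 1
    obtain \<xi> where "colors (range c) S \<xi>"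
      using cycle_two_choosable[of S, OF eq_refl[OF S[symmetric]]] by blast
    moreover have "clockwise S \<alpha> \<beta> \<xi>" unfolding clockwise_def using 1 by blast
    ultimately show ?thesis by blast
  next
    case 2
    define m where "m = (\<lambda>x. if x = \<beta> then \<alpha> else x)"
    have "card (m ` S (c i)) = 2" for i
    proof -
      have "inj_on m (S (c i))" using 2 by (auto simp: inj_on_def m_def)
      then show ?thesis using S[of i] card_image by metis
    qed
    then obtain \<eta> where \<eta>: "colors (range c) (\<lambda>v. m ` S v) \<eta>"
      using cycle_two_choosable[of "\<lambda>v. m ` S v"] by fastforce
    have "\<exists>y\<in>S v. m y = \<eta> v" if "v \<in> range c" for v
      using \<eta> that unfolding colors_def by force
    then obtain \<xi> where \<xi>: "\<And>v. v \<in> range c \<Longrightarrow> \<xi> v \<in> S v \<and> m (\<xi> v) = \<eta> v" by metis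
    have ne: "m (\<xi> (c i)) \<noteq> m (\<xi> (c (Suc i)))" for i
      using \<eta> \<xi>[of "c i"] \<xi>[of "c (Suc i)"] unfolding colors_range_iff by simp
    have "\<xi> (c i) \<noteq> \<xi> (c (Suc i))" for i using ne[of i] by auto
    then have "colors (range c) S \<xi>" using \<xi> unfolding colors_range_iff by blast
    moreover have "clockwise S \<alpha> \<beta> \<xi>"
      unfolding clockwise_def
    proof (intro allI impI)
      fix i assume "\<xi> (c i) \<in> {\<alpha>, \<beta>}" "\<xi> (c (Suc i)) \<in> {\<alpha>, \<beta>}"
      then have "m (\<xi> (c i)) = \<alpha>" "m (\<xi> (c (Suc i))) = \<alpha>" by (auto simp: m_def)
      then show "{\<alpha>, \<beta>} \<subseteq> S (c (Suc i))" using ne[of i] by simp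
    qed
    ultimately show ?thesis by blast
  next
    case (3 k)
    interpret sh: even_cycle adj "\<lambda>i. c (i + k)" n by (rule even_cycle_shift)
    note rsh = range_shift[of k]
    obtain \<xi> where \<xi>: "colors (range c) S \<xi>" "sh.clockwise S \<alpha> \<beta> \<xi>"
      using sh.clockwise_coloring_exists_start[of S \<alpha> \<beta>, OF S assms(2)] 3 unfolding rsh by auto
    have "clockwise S \<alpha> \<beta> \<xi>"
      unfolding clockwise_def
    proof (intro allI impI)
      fix i assume i: "\<xi> (c i) \<in> {\<alpha>, \<beta>}" "\<xi> (c (Suc i)) \<in> {\<alpha>, \<beta>}"
      obtain j where j: "c (j + k) = c i" using shift_surj by blast
      then have "c (Suc j + k) = c (Suc i)" by (simp add: c_Suc_eq_iff)
      then show "{\<alpha>, \<beta>} \<subseteq> S (c (Suc i))" using \<xi>(2) i j unfolding sh.clockwise_def by metis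
    qed
    then show ?thesis using \<xi>(1) by blast
  qed
qed

end

section \<open>Colorings of a cycle over an outer coloring\<close>

lemma of_bool_add_less_1: "\<not> P \<Longrightarrow> \<not> Q \<Longrightarrow> of_bool P + of_bool Q < (1 :: nat)"
  by simp

locale cycle_extension = even_cycle adj c n for adj :: "'v \<Rightarrow> 'v \<Rightarrow> bool" and c n +
  fixes V :: "'v set" and L :: "'v \<Rightarrow> 'c set"
  assumes finite_V: "finite V" and c_notin: "c i \<notin> V"
    and card_L: "card {w\<in>V. adj (c i) w} + 2 \<le> card (L (c i))"
begin

abbreviation W :: "'v set" where "W \<equiv> V \<union> range c"

definition avail :: "('v \<Rightarrow> 'c) \<Rightarrow> 'v \<Rightarrow> 'c set" where
  "avail \<phi> v = L v - \<phi> ` {w\<in>V. adj v w}"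

text \<open>Freezing the outer coloring as singleton lists turns its extensions into ordinary list
  colorings of \<open>W\<close>, so degenerate orders apply to them.\<close>

definition extension_lists :: "('v \<Rightarrow> 'c) \<Rightarrow> ('v \<Rightarrow> 'c set) \<Rightarrow> 'v \<Rightarrow> 'c set" where
  "extension_lists \<phi> A v = (if v \<in> V then {\<phi> v} else A v)"

lemma finite_L: "finite (L (c i))"
  using card_L[of i] by (intro card_ge_0_finite) linarith

lemma finite_avail: "finite (avail \<phi> (c i))"
  by (simp add: avail_def finite_L)

lemma card_avail: "2 \<le> card (avail \<phi> (c i))"
proof -
  have "card (\<phi> ` {w\<in>V. adj (c i) w}) \<le> card {w\<in>V. adj (c i) w}"
    using finite_V by (intro card_image_le) simp
  moreover have "card (L (c i)) - card (\<phi> ` {w\<in>V. adj (c i) w}) \<le> card (avail \<phi> (c i))"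
    unfolding avail_def using finite_V by (intro diff_card_le_card_Diff) simp
  ultimately show ?thesis using card_L[of i] by linarith
qed

text \<open>Equality in the count of lost colors: if at most two remain, every outer neighbor
  removes a color of its own from the list.\<close>

lemma tight:
  assumes "card (avail \<phi> (c i)) \<le> 2"
  shows "inj_on \<phi> {w\<in>V. adj (c i) w}" "\<phi> ` {w\<in>V. adj (c i) w} \<subseteq> L (c i)"
proof -
  let ?N = "{w\<in>V. adj (c i) w}"
  have fin: "finite ?N" using finite_V by simp
  have "card (L (c i)) = card (L (c i) \<inter> \<phi> ` ?N) + card (avail \<phi> (c i))"
    unfolding avail_def using card_Int_Diff[OF finite_L] by simp
  then have 1: "card ?N \<le> card (L (c i) \<inter> \<phi> ` ?N)" using assms card_L[of i] by linarith
  have 2: "card (L (c i) \<inter> \<phi> ` ?N) \<le> card (\<phi> ` ?N)" using fin by (intro card_mono) auto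
  have 3: "card (\<phi> ` ?N) \<le> card ?N" using fin by (rule card_image_le)
  have 4: "card (\<phi> ` ?N) = card ?N" "card (L (c i) \<inter> \<phi> ` ?N) = card (\<phi> ` ?N)" using 1 2 3 by linarith+
  show "inj_on \<phi> ?N" using fin 4(1) by (rule eq_card_imp_inj_on)
  have "L (c i) \<inter> \<phi> ` ?N = \<phi> ` ?N" by (rule card_subset_eq[OF finite_imageI[OF fin] Int_lower2 4(2)])
  then show "\<phi> ` ?N \<subseteq> L (c i)" by blast
qed

lemma colors_combine:
  assumes \<phi>: "colors V L \<phi>" and \<xi>: "colors (range c) S \<xi>" and S: "\<And>i. S (c i) \<subseteq> avail \<phi> (c i)"
    and \<psi>: "\<And>v. v \<in> V \<Longrightarrow> \<psi> v = \<phi> v" "\<And>i. \<psi> (c i) = \<xi> (c i)"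
  shows "colors W L \<psi>"
  unfolding colors_def
proof (intro conjI ballI impI)
  have mem: "\<xi> (c i) \<in> avail \<phi> (c i)" for i using \<xi> S unfolding colors_range_iff by blast
  show "\<psi> v \<in> L v" if "v \<in> W" for v
    using that \<phi> mem \<psi> unfolding colors_def avail_def by auto
  have out: "\<psi> v \<noteq> \<psi> (c i)" if "v \<in> V" "adj (c i) v" for v i
    using mem[of i] that \<psi> unfolding avail_def by (auto simp: image_iff)
  show "\<psi> u \<noteq> \<psi> v" if uv: "u \<in> W" "v \<in> W" "adj u v" for u v
  proof (cases "u \<in> V"; cases "v \<in> V")
    assume "u \<in> V" "v \<in> V" then show ?thesis using \<phi> uv \<psi>(1) unfolding colors_def by simp
  next
    assume "u \<in> V" "v \<notin> V" then show ?thesis using uv out adj_sym by blast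
  next
    assume "u \<notin> V" "v \<in> V" then show ?thesis using uv out by (metis UnE rangeE)
  next
    assume "u \<notin> V" "v \<notin> V"
    then show ?thesis using uv \<xi> \<psi>(2) unfolding colors_def by (metis UnE rangeE)
  qed
qed

lemma colors_avail:
  assumes "colors W L \<phi>"
  shows "colors (range c) (avail \<phi>) \<phi>"
  unfolding colors_def
proof (intro conjI ballI impI)
  show "\<phi> v \<in> avail \<phi> v" if "v \<in> range c" for v
    using that assms unfolding colors_def avail_def by (auto simp: image_iff)
  show "\<phi> u \<noteq> \<phi> v" if "u \<in> range c" "v \<in> range c" "adj u v" for u v
    using that assms unfolding colors_def by blast
qed

lemma extension_colors_iff:
  assumes "colors V L \<phi>" "\<And>i. A (c i) \<subseteq> avail \<phi> (c i)"
  shows "colors W (extension_lists \<phi> A) \<psi> \<longleftrightarrow>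
    (\<forall>v\<in>V. \<psi> v = \<phi> v) \<and> colors (range c) A \<psi>"
proof
  assume \<psi>: "colors W (extension_lists \<phi> A) \<psi>"
  have "colors (range c) (extension_lists \<phi> A) \<psi>" by (rule colors_subset[OF \<psi>]) blast
  then have "colors (range c) A \<psi>" using c_notin unfolding colors_range_iff extension_lists_def by simp
  moreover have "\<psi> v = \<phi> v" if "v \<in> V" for v
  proof -
    have "\<psi> v \<in> extension_lists \<phi> A v" using \<psi> that unfolding colors_def by blast
    then show ?thesis using that by (simp add: extension_lists_def)
  qed
  ultimately show "(\<forall>v\<in>V. \<psi> v = \<phi> v) \<and> colors (range c) A \<psi>" by blast
next
  assume \<psi>: "(\<forall>v\<in>V. \<psi> v = \<phi> v) \<and> colors (range c) A \<psi>"
  have "colors W L \<psi>"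
    by (rule colors_combine[OF assms(1) _ assms(2)]) (use \<psi> in auto)
  then show "colors W (extension_lists \<phi> A) \<psi>"
    using \<psi> c_notin unfolding colors_def extension_lists_def by auto
qed

lemma degenerate_extension:
  assumes "colors V L \<phi>" "\<And>i. A (c i) \<subseteq> avail \<phi> (c i)" "0 < card (A (c k))"
    and "\<And>t. 1 \<le> t \<Longrightarrow> t < n \<Longrightarrow> of_bool (A (c (t + k)) \<inter> A (c (Suc t + k)) \<noteq> {}) +
       of_bool (t = 1 \<and> A (c (Suc k)) \<inter> A (c k) \<noteq> {}) < card (A (c (t + k)))"
  shows "degenerate (extension_lists \<phi> A) W"
proof -
  interpret sh: even_cycle adj "\<lambda>i. c (i + k)" n by (rule even_cycle_shift)
  have M: "extension_lists \<phi> A (c i) = A (c i)" for i by (simp add: extension_lists_def c_notin)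
  have "degenerate (extension_lists \<phi> A) (V \<union> range (\<lambda>i. c (i + k)))"
  proof (rule sh.degenerate_cycle)
    show "degenerate (extension_lists \<phi> A) V"
      using degenerate_singletons[OF finite_V assms(1)] by (simp add: extension_lists_def)
    show "extension_lists \<phi> A w \<inter> extension_lists \<phi> A (c (i + k)) = {}" if "w \<in> V" "adj (c (i + k)) w" for i w
      using assms(2)[of "i + k"] that unfolding M by (auto simp: extension_lists_def avail_def)
    show "0 < card (extension_lists \<phi> A (c (0 + k)))" using assms(3) unfolding M by simp
    show "of_bool (extension_lists \<phi> A (c (t + k)) \<inter> extension_lists \<phi> A (c (Suc t + k)) \<noteq> {}) +
         of_bool (t = 1 \<and> extension_lists \<phi> A (c (1 + k)) \<inter> extension_lists \<phi> A (c (0 + k)) \<noteq> {})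
         < card (extension_lists \<phi> A (c (t + k)))" if "1 \<le> t" "t < n" for t
      using assms(4)[OF that] unfolding M by simp
  qed (rule c_notin)
  then show ?thesis by (simp only: range_shift)
qed

lemma extension_steps:
  assumes \<phi>: "colors V L \<phi>" and A: "\<And>i. A (c i) \<subseteq> avail \<phi> (c i)"
    and deg: "degenerate (extension_lists \<phi> A) W"
    and "colors (range c) A \<psi>" "\<And>v. v \<in> V \<Longrightarrow> \<psi> v = \<phi> v" "colors (range c) A \<psi>'" "\<And>v. v \<in> V \<Longrightarrow> \<psi>' v = \<phi> v"
  shows "steps W L \<psi> \<psi>'"
proof (rule steps_mono)
  show "steps W (extension_lists \<phi> A) \<psi> \<psi>'"
    using degenerate_all_equivalent[OF deg] extension_colors_iff[OF \<phi> A] assms(4-7)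
    unfolding all_equivalent_def by blast
  show "extension_lists \<phi> A v \<subseteq> L v" if "v \<in> W" for v
    using that \<phi> A c_notin unfolding extension_lists_def colors_def avail_def by auto
qed

section \<open>Equivalent extensions of one outer coloring\<close>

lemma shift_ne: "1 \<le> t \<Longrightarrow> t < n \<Longrightarrow> c (t + k) \<noteq> c k"
  using c_add_eq_iff[of t k 0] inj_c by (auto dest: inj_onD[of _ _ t 0])

text \<open>Only the last vertex of the backward order sees two cycle neighbors. It is chosen as the
  vertex with three colors, or as \<open>c (Suc i)\<close>, for which the neighbor
  \<open>c i\<close> is irrelevant because their lists are disjoint.\<close>

lemma degenerate_avail:
  assumes \<phi>: "colors V L \<phi>" and "3 \<le> card (avail \<phi> (c i)) \<or> avail \<phi> (c i) \<inter> avail \<phi> (c (Suc i)) = {}"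
  shows "degenerate (extension_lists \<phi> (avail \<phi>)) W"
  using assms(2)
proof
  assume i: "3 \<le> card (avail \<phi> (c i))"
  \<comment> \<open>The order starts at the predecessor of \<open>c i\<close> and hence ends at
    \<open>c i\<close>.\<close>
  define k where "k = i + (n - 1)"
  have k: "c (Suc k) = c i" using c_periodic[of i] n_ge by (simp add: k_def)
  show ?thesis
  proof (rule degenerate_extension[OF \<phi> order_refl, where k = k])
    show "0 < card (avail \<phi> (c k))" using card_avail[of \<phi> k] by linarith
    fix t :: nat assume "1 \<le> t" "t < n"
    show "of_bool (avail \<phi> (c (t + k)) \<inter> avail \<phi> (c (Suc t + k)) \<noteq> {}) +
       of_bool (t = 1 \<and> avail \<phi> (c (Suc k)) \<inter> avail \<phi> (c k) \<noteq> {}) < card (avail \<phi> (c (t + k)))"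
    proof (cases "t = 1")
      case True
      then have "3 \<le> card (avail \<phi> (c (t + k)))" using i k by simp
      moreover have "of_bool P + of_bool Q < (3::nat)" for P Q by simp
      ultimately show ?thesis by (meson less_le_trans)
    qed (intro of_bool_add_less card_avail, simp)
  qed
next
  assume i: "avail \<phi> (c i) \<inter> avail \<phi> (c (Suc i)) = {}"
  show ?thesis
  proof (rule degenerate_extension[OF \<phi> order_refl, where k = i])
    show "0 < card (avail \<phi> (c i))" using card_avail[of \<phi> i] by linarith
    fix t :: nat assume "1 \<le> t" "t < n"
    show "of_bool (avail \<phi> (c (t + i)) \<inter> avail \<phi> (c (Suc t + i)) \<noteq> {}) +
       of_bool (t = 1 \<and> avail \<phi> (c (Suc i)) \<inter> avail \<phi> (c i) \<noteq> {}) < card (avail \<phi> (c (t + i)))"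
      by (intro of_bool_add_less card_avail) (use i in blast)
  qed
qed

text \<open>The singleton list at \<open>c i\<close> is disjoint from the next list, so the
  successor of \<open>c i\<close>, last in the order, sees at most one relevant neighbor.\<close>

lemma fixed_color_steps:
  assumes \<phi>: "colors V L \<phi>" and a: "a \<in> avail \<phi> (c i)" "a \<notin> avail \<phi> (c (Suc i))"
    and \<psi>: "colors (range c) (avail \<phi>) \<psi>" "\<And>v. v \<in> V \<Longrightarrow> \<psi> v = \<phi> v" "\<psi> (c i) = a"
    and \<psi>': "colors (range c) (avail \<phi>) \<psi>'" "\<And>v. v \<in> V \<Longrightarrow> \<psi>' v = \<phi> v" "\<psi>' (c i) = a"
  shows "steps W L \<psi> \<psi>'"
proof -
  let ?A = "(avail \<phi>)(c i := {a})"
  have A: "?A (c j) \<subseteq> avail \<phi> (c j)" for j using a(1) by simp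
  have deg: "degenerate (extension_lists \<phi> ?A) W"
  proof (rule degenerate_extension[OF \<phi> A, where k = i])
    show "0 < card (?A (c i))" by simp
    fix t :: nat assume t: "1 \<le> t" "t < n"
    show "of_bool (?A (c (t + i)) \<inter> ?A (c (Suc t + i)) \<noteq> {}) +
       of_bool (t = 1 \<and> ?A (c (Suc i)) \<inter> ?A (c i) \<noteq> {}) < card (?A (c (t + i)))"
    proof (rule of_bool_add_less)
      show "2 \<le> card (?A (c (t + i)))" using shift_ne[OF t] card_avail by simp
      have "?A (c (Suc i)) \<inter> ?A (c i) = {}" using shift_ne[of 1 i] n_ge a(2) by simp
      then show "\<not> (t = 1 \<and> ?A (c (Suc i)) \<inter> ?A (c i) \<noteq> {})" by blast
    qed
  qed
  show ?thesis
    by (rule extension_steps[OF \<phi> A deg]) (use \<psi> \<psi>' in \<open>auto simp: colors_def\<close>)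
qed

text \<open>This supplies a stepping stone between a coloring with \<open>a\<close> at
  \<open>c i\<close> and one with \<open>b\<close> at \<open>c j\<close>. The singleton at
  \<open>c j\<close> is harmless, because its only earlier neighbor on the cycle that could count is
  its successor, whose list misses \<open>b\<close>.\<close>

lemma two_fixed_colors:
  assumes \<phi>: "colors V L \<phi>" and a: "a \<in> avail \<phi> (c i)" "a \<notin> avail \<phi> (c (Suc i))"
    and b: "b \<in> avail \<phi> (c j)" "b \<notin> avail \<phi> (c (Suc j))" and "c i \<noteq> c j"
  shows "\<exists>\<sigma>. colors (range c) (avail \<phi>) \<sigma> \<and> (\<forall>v\<in>V. \<sigma> v = \<phi> v) \<and> \<sigma> (c i) = a \<and> \<sigma> (c j) = b"
proof -
  define A where "A = (avail \<phi>)(c i := {a}, c j := {b})"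
  have Ai: "A (c i) = {a}" and Aj: "A (c j) = {b}" using assms(6) by (auto simp: A_def)
  have A: "A (c k) \<subseteq> avail \<phi> (c k)" for k using a(1) b(1) by (auto simp: A_def)
  have "degenerate (extension_lists \<phi> A) W"
  proof (rule degenerate_extension[OF \<phi> A, where k = i])
    show "0 < card (A (c i))" using Ai by simp
    fix t :: nat assume t: "1 \<le> t" "t < n"
    have "a \<notin> A (c (Suc i))" using A[of "Suc i"] a(2) by blast
    then have 1: "\<not> (t = 1 \<and> A (c (Suc i)) \<inter> A (c i) \<noteq> {})" using Ai by simp
    show "of_bool (A (c (t + i)) \<inter> A (c (Suc t + i)) \<noteq> {}) +
       of_bool (t = 1 \<and> A (c (Suc i)) \<inter> A (c i) \<noteq> {}) < card (A (c (t + i)))"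
    proof (cases "c (t + i) = c j")
      case True
      then have s: "c (Suc t + i) = c (Suc j)" by (simp add: c_Suc_eq_iff)
      have "b \<notin> A (c (Suc j))" using A[of "Suc j"] b(2) by blast
      then have 2: "\<not> A (c (t + i)) \<inter> A (c (Suc t + i)) \<noteq> {}" using True Aj s by simp
      have "card (A (c (t + i))) = 1" using True Aj by simp
      then show ?thesis using of_bool_add_less_1[OF 2 1] by simp
    next
      case False
      then have "A (c (t + i)) = avail \<phi> (c (t + i))" using shift_ne[OF t] by (simp add: A_def)
      then have "2 \<le> card (A (c (t + i)))" using card_avail by simp
      then show ?thesis using 1 by (rule of_bool_add_less)
    qed
  qed
  then obtain \<sigma> where \<sigma>: "\<forall>v\<in>V. \<sigma> v = \<phi> v" "colors (range c) A \<sigma>"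
    using degenerate_colors extension_colors_iff[OF \<phi> A] by blast
  have mem: "\<sigma> (c k) \<in> A (c k)" for k using \<sigma>(2) unfolding colors_range_iff by blast
  have "\<sigma> (c i) = a" "\<sigma> (c j) = b" using mem[of i] mem[of j] Ai Aj by auto
  moreover have "colors (range c) (avail \<phi>) \<sigma>"
    using \<sigma>(2) mem A unfolding colors_range_iff by blast
  ultimately show ?thesis using \<sigma>(1) by blast
qed

text \<open>The swap is continued along each run of cycle vertices colored \<alpha> or \<beta> that
  starts next to \<open>D\<close>. At the start, tightness puts both colors in the list and excludes
  a second outer neighbor in these colors; as \<open>D\<close> blocks one of them there, the
  clockwise condition excludes a predecessor in these colors. Later vertices of the run have both
  colors available, hence no outer neighbor in them.\<close>

lemma lift_clockwise:
  assumes \<phi>: "colors W L \<phi>"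
    and D: "swap_set V \<phi> \<alpha> \<beta> D" "\<And>v. v \<in> V \<Longrightarrow> \<theta> v = swap \<alpha> \<beta> D \<phi> v" "colors V L \<theta>"
    and S: "\<And>i. S (c i) \<subseteq> avail \<phi> (c i)" "clockwise S \<alpha> \<beta> \<phi>"
    and t: "\<And>i x. x \<in> D \<Longrightarrow> adj (c i) x \<Longrightarrow> \<phi> (c i) \<in> {\<alpha>, \<beta>} \<Longrightarrow> card (avail \<phi> (c i)) \<le> 2"
  shows "\<exists>\<phi>'. steps W L \<phi> \<phi>' \<and> (\<forall>v\<in>V. \<phi>' v = \<theta> v)"
proof -
  note DV = swap_setD(1)[OF D(1)] and D\<phi> = swap_setD(2)[OF D(1)] and Dcl = swap_setD(3)[OF D(1)]
  define att where "att = (\<lambda>i. (\<exists>x\<in>D. adj (c i) x))"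
  define run where "run = (\<lambda>i m. att i \<and> (\<forall>t\<le>m. \<phi> (c (i + t)) \<in> {\<alpha>, \<beta>}))"
  define K where "K = D \<union> {c (i + m) |i m. run i m}"
  have proper: "\<phi> u \<noteq> \<phi> v" if "u \<in> W" "v \<in> W" "adj u v" for u v
    using \<phi> that unfolding colors_def by blast
  have proper': "\<phi> w \<noteq> \<phi> (c i)" if "w \<in> V" "adj (c i) w" for w i
    using proper[of "c i" w] that by auto
  have cw: "{\<alpha>, \<beta>} \<subseteq> S (c (Suc j))" if "\<phi> (c j) \<in> {\<alpha>, \<beta>}" "\<phi> (c (Suc j)) \<in> {\<alpha>, \<beta>}" for j
    using S(2) that unfolding clockwise_def by blast
  have both_out: "\<phi> w \<notin> {\<alpha>, \<beta>}" if "{\<alpha>, \<beta>} \<subseteq> S (c i)" "w \<in> V" "adj (c i) w" for i w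
    using that S(1)[of i] unfolding avail_def by blast
  have both_L: "\<alpha> \<in> L (c i) \<and> \<beta> \<in> L (c i)" if "{\<alpha>, \<beta>} \<subseteq> S (c i)" for i
    using that S(1)[of i] unfolding avail_def by blast
  have att: "(\<alpha> \<in> L (c i) \<and> \<beta> \<in> L (c i)) \<and> \<not> {\<alpha>, \<beta>} \<subseteq> S (c i) \<and> (\<forall>w\<in>V. adj (c i) w \<longrightarrow> \<phi> w \<in> {\<alpha>, \<beta>} \<longrightarrow> w \<in> D)"
    if i: "att i" "\<phi> (c i) \<in> {\<alpha>, \<beta>}" for i
  proof -
    obtain x where x: "x \<in> D" "adj (c i) x" using i(1) unfolding att_def by blast
    have xV: "x \<in> V" using x(1) DV by blast
    have "\<phi> x \<noteq> \<phi> (c i)" by (rule proper'[OF xV x(2)])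
    then have eq: "{\<alpha>, \<beta>} = {\<phi> (c i), \<phi> x}" using D\<phi>[OF x(1)] i(2) by auto
    note T = tight[OF t[OF x i(2)]]
    have "\<phi> x \<in> L (c i)" using T(2) x xV by blast
    moreover have "\<phi> (c i) \<in> L (c i)" using \<phi> unfolding colors_def by blast
    ultimately have 1: "{\<alpha>, \<beta>} \<subseteq> L (c i)" unfolding eq by blast
    have 2: "\<not> {\<alpha>, \<beta>} \<subseteq> S (c i)" using both_out[OF _ xV x(2)] D\<phi>[OF x(1)] by blast
    have "w \<in> D" if w: "w \<in> V" "adj (c i) w" "\<phi> w \<in> {\<alpha>, \<beta>}" for w
    proof -
      have "\<phi> w \<noteq> \<phi> (c i)" by (rule proper'[OF w(1,2)])
      then have "\<phi> w = \<phi> x" using w(3) unfolding eq by simp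
      then have "w = x" using T(1) w x xV by (auto dest: inj_onD)
      then show ?thesis using x by blast
    qed
    then show ?thesis using 1 2 by blast
  qed
  have both_run: "{\<alpha>, \<beta>} \<subseteq> S (c (i + Suc m))" if "run i (Suc m)" for i m
  proof -
    have "\<phi> (c (i + m)) \<in> {\<alpha>, \<beta>}" "\<phi> (c (i + Suc m)) \<in> {\<alpha>, \<beta>}" using that unfolding run_def by auto
    then show ?thesis using cw[of "i + m"] by simp
  qed
  have in_K: "c (i + m) \<in> K" if "run i m" for i m using that unfolding K_def by blast
  have K_cases: "v \<in> D \<or> (\<exists>i m. v = c (i + m) \<and> run i m)" if "v \<in> K" for v
    using that unfolding K_def by blast
  have K_set: "swap_set W \<phi> \<alpha> \<beta> K"
  proof (rule swap_setI)
    show "K \<subseteq> W" using DV unfolding K_def by blast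
    show "\<phi> v = \<alpha> \<or> \<phi> v = \<beta>" if "v \<in> K" for v
      using K_cases[OF that] D\<phi>[of v] unfolding run_def by auto
    fix v w assume v: "v \<in> K" and w: "w \<in> W" "adj v w" "\<phi> w = \<alpha> \<or> \<phi> w = \<beta>"
    from K_cases[OF v] show "w \<in> K"
    proof
      assume vD: "v \<in> D"
      show ?thesis
      proof (cases "w \<in> V")
        case True then show ?thesis using Dcl[OF vD True w(2,3)] unfolding K_def by blast
      next
        case False
        then obtain j where j: "w = c j" using w(1) by blast
        have "run j 0" unfolding run_def att_def using vD adj_sym[OF w(2)] w(3) j by auto
        then show ?thesis using in_K[of j 0] j by simp
      qed
    next
      assume "\<exists>i m. v = c (i + m) \<and> run i m"
      then obtain i m where im: "v = c (i + m)" "run i m" by blast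
      show ?thesis
      proof (cases "w \<in> V")
        case True
        show ?thesis
        proof (cases m)
          case 0
          then show ?thesis using att[of i] im True w unfolding run_def K_def by auto
        next
          case (Suc m')
          then show ?thesis using both_out[OF both_run True] im w by blast
        qed
      next
        case False
        then obtain j where j: "w = c j" using w(1) by blast
        then have "c j = c (Suc (i + m)) \<or> c (i + m) = c (Suc j)" using w(2) im adj_c by simp
        then show ?thesis
        proof
          assume eq: "c j = c (Suc (i + m))"
          then have "run i (Suc m)" using im(2) w(3) j unfolding run_def by (auto simp: le_Suc_eq)
          then show ?thesis using in_K[of i "Suc m"] eq j by simp
        next
          assume eq: "c (i + m) = c (Suc j)"
          show ?thesis
          proof (cases m)
            case 0
            \<comment> \<open>A predecessor colored \<alpha> or \<beta> would make both colors
              available at the start of the run, where a neighbor in \<open>D\<close> uses one of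
              them.\<close>
            then have "{\<alpha>, \<beta>} \<subseteq> S (c i)"
              using cw[of j] eq w(3) j im(2) unfolding run_def by auto
            moreover have "\<not> {\<alpha>, \<beta>} \<subseteq> S (c i)"
              using att[of i] im(2) unfolding run_def by (metis add.right_neutral le0)
            ultimately show ?thesis by blast
          next
            case (Suc m')
            then have "c j = c (i + m')" using eq by (simp add: c_Suc_eq_iff)
            moreover have "run i m'" using im(2) Suc unfolding run_def by auto
            ultimately show ?thesis using in_K j by simp
          qed
        qed
      qed
    qed
  qed
  have KV: "v \<in> K \<longleftrightarrow> v \<in> D" if "v \<in> V" for v
    using that c_notin unfolding K_def by blast
  have "step W L \<phi> (swap \<alpha> \<beta> K \<phi>)"
  proof (rule step_swap[OF \<phi> K_set])
    fix v assume v: "v \<in> K"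
    from K_cases[OF v] show "swap \<alpha> \<beta> K \<phi> v \<in> L v"
    proof
      assume vD: "v \<in> D"
      then have "swap \<alpha> \<beta> K \<phi> v = \<theta> v" using D(2)[of v] v DV by (auto simp: swap_def)
      then show ?thesis using D(3) vD DV unfolding colors_def by auto
    next
      assume "\<exists>i m. v = c (i + m) \<and> run i m"
      then obtain i m where im: "v = c (i + m)" "run i m" by blast
      have "\<alpha> \<in> L v \<and> \<beta> \<in> L v"
      proof (cases m)
        case 0
        then show ?thesis using att[of i] im unfolding run_def by auto
      next
        case (Suc m')
        then show ?thesis using both_L[OF both_run] im by blast
      qed
      then show ?thesis using v by (simp add: swap_def)
    qed
  qed simp
  moreover have "\<forall>v\<in>V. swap \<alpha> \<beta> K \<phi> v = \<theta> v" using D(2) KV by (simp add: swap_def)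
  ultimately show ?thesis by blast
qed

section \<open>Extensions along which a swap lifts\<close>

lemma avail_cong: "(\<And>v. v \<in> V \<Longrightarrow> \<psi> v = \<phi> v) \<Longrightarrow> avail \<psi> = avail \<phi>"
  unfolding avail_def by (intro ext arg_cong2[of _ _ _ _ "(-)"] image_cong refl) simp

lemma step_combine:
  assumes \<phi>: "colors V L \<phi>" and \<xi>: "colors (range c) S \<xi>" and S: "\<And>i. S (c i) \<subseteq> avail \<phi> (c i)" and cw: "clockwise S \<alpha> \<beta> \<xi>"
    and D: "swap_set V \<phi> \<alpha> \<beta> D" "\<And>v. v \<in> V \<Longrightarrow> \<theta> v = swap \<alpha> \<beta> D \<phi> v" "colors V L \<theta>"
    and t: "\<And>i x. x \<in> D \<Longrightarrow> adj (c i) x \<Longrightarrow> \<xi> (c i) \<in> {\<alpha>, \<beta>} \<Longrightarrow> card (avail \<phi> (c i)) \<le> 2"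
  shows "\<exists>\<psi> \<phi>'. colors (range c) (avail \<phi>) \<psi> \<and> (\<forall>v\<in>V. \<psi> v = \<phi> v) \<and> (\<forall>i. \<psi> (c i) = \<xi> (c i)) \<and>
     steps W L \<psi> \<phi>' \<and> (\<forall>v\<in>V. \<phi>' v = \<theta> v)"
proof -
  define \<psi> where "\<psi> = (\<lambda>v. if v \<in> V then \<phi> v else \<xi> v)"
  have \<psi>: "\<psi> v = \<phi> v" if "v \<in> V" for v using that by (simp add: \<psi>_def)
  have \<psi>c: "\<psi> (c i) = \<xi> (c i)" for i by (simp add: \<psi>_def c_notin)
  have col: "colors W L \<psi>" by (rule colors_combine[OF \<phi> \<xi> S \<psi> \<psi>c])
  have av: "avail \<psi> = avail \<phi>" by (rule avail_cong[OF \<psi>])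
  have "\<exists>\<phi>'. steps W L \<psi> \<phi>' \<and> (\<forall>v\<in>V. \<phi>' v = \<theta> v)"
  proof (rule lift_clockwise[OF col _ _ D(3), where S = S])
    show "swap_set V \<psi> \<alpha> \<beta> D"
    proof (rule swap_setI)
      show "D \<subseteq> V" by (rule swap_setD(1)[OF D(1)])
      show "\<psi> v = \<alpha> \<or> \<psi> v = \<beta>" if "v \<in> D" for v
        using swap_setD(2)[OF D(1) that] \<psi>[OF subsetD[OF swap_setD(1)[OF D(1)] that]] by simp
      show "w \<in> D" if "v \<in> D" "w \<in> V" "adj v w" "\<psi> w = \<alpha> \<or> \<psi> w = \<beta>" for v w
        using swap_setD(3)[OF D(1) that(1-3)] that(4) \<psi>[OF that(2)] by simp
    qed
    show "\<theta> v = swap \<alpha> \<beta> D \<psi> v" if "v \<in> V" for v using D(2)[OF that] \<psi>[OF that] by (simp add: swap_def)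
    show "S (c i) \<subseteq> avail \<psi> (c i)" for i using S av by simp
    show "clockwise S \<alpha> \<beta> \<psi>" using cw unfolding clockwise_def \<psi>c .
    show "card (avail \<psi> (c i)) \<le> 2" if "x \<in> D" "adj (c i) x" "\<psi> (c i) \<in> {\<alpha>, \<beta>}" for i x
      using t[OF that(1,2)] that(3) unfolding av \<psi>c .
  qed
  moreover have "colors (range c) (avail \<phi>) \<psi>" using colors_avail[OF col] av by simp
  ultimately show ?thesis using \<psi> \<psi>c by blast
qed

text \<open>A vertex next to \<open>D\<close> has lost \<alpha> or \<beta> to its neighbor, so if
  more than two colors are available, two of them lie outside \<open>{\<alpha>, \<beta>}\<close>.
  With these lists, a vertex next to \<open>D\<close> that is colored \<alpha> or \<beta> is tight,
  as \<open>lift_clockwise\<close> requires.\<close>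

lemma lists_for_swap:
  assumes \<phi>: "colors V L \<phi>" and D: "swap_set V \<phi> \<alpha> \<beta> D"
  shows "\<exists>S. \<forall>i. S (c i) \<subseteq> avail \<phi> (c i) \<and> card (S (c i)) = 2 \<and>
    ((\<exists>x\<in>D. adj (c i) x) \<longrightarrow> 2 < card (avail \<phi> (c i)) \<longrightarrow> S (c i) \<inter> {\<alpha>, \<beta>} = {})"
proof -
  have "\<exists>T. T \<subseteq> avail \<phi> v \<and> card T = 2 \<and>
    ((\<exists>x\<in>D. adj v x) \<longrightarrow> 2 < card (avail \<phi> v) \<longrightarrow> T \<inter> {\<alpha>, \<beta>} = {})" if v: "v \<in> range c" for v
  proof (cases "(\<exists>x\<in>D. adj v x) \<and> 2 < card (avail \<phi> v)")
    case True
    then obtain x where x: "x \<in> D" "adj v x" by blast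
    then have "\<phi> x \<notin> avail \<phi> v" using swap_setD(1)[OF D] unfolding avail_def by blast
    then have "avail \<phi> v \<inter> {\<alpha>, \<beta>} \<subseteq> {\<alpha>, \<beta>} - {\<phi> x}" by blast
    moreover have "card ({\<alpha>, \<beta>} - {\<phi> x}) \<le> 1"
      using swap_setD(2)[OF D x(1)] by (auto simp: card_insert_if insert_Diff_if)
    ultimately have "card (avail \<phi> v \<inter> {\<alpha>, \<beta>}) \<le> 1"
      by (metis (no_types, lifting) card_mono finite.emptyI finite.insertI finite_Diff le_trans)
    moreover have "card (avail \<phi> v) = card (avail \<phi> v \<inter> {\<alpha>, \<beta>}) + card (avail \<phi> v - {\<alpha>, \<beta>})"
      using v finite_avail by (intro card_Int_Diff) auto
    ultimately have "2 \<le> card (avail \<phi> v - {\<alpha>, \<beta>})" using True by linarith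
    then obtain T where "T \<subseteq> avail \<phi> v - {\<alpha>, \<beta>}" "card T = 2" by (rule obtain_subset_with_card_n)
    then show ?thesis by (intro exI[of _ T]) auto
  next
    case False
    have "2 \<le> card (avail \<phi> v)" using v card_avail by auto
    then obtain T where "T \<subseteq> avail \<phi> v" "card T = 2" by (rule obtain_subset_with_card_n)
    then show ?thesis using False by (intro exI[of _ T]) auto
  qed
  then obtain S where "\<And>v. v \<in> range c \<Longrightarrow> S v \<subseteq> avail \<phi> v \<and> card (S v) = 2 \<and>
    ((\<exists>x\<in>D. adj v x) \<longrightarrow> 2 < card (avail \<phi> v) \<longrightarrow> S v \<inter> {\<alpha>, \<beta>} = {})" by metis
  then show ?thesis by blast
qed

text \<open>If all extensions of the outer coloring are within reach, so is one that is clockwise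
  for the two colors of the swap, and the swap extends from there.\<close>

lemma lift_flexible:
  assumes \<phi>: "colors W L \<phi>" and st: "step V L \<phi> \<theta>"
    and equiv: "\<And>\<psi>. colors (range c) (avail \<phi>) \<psi> \<Longrightarrow> (\<And>v. v \<in> V \<Longrightarrow> \<psi> v = \<phi> v) \<Longrightarrow> steps W L \<phi> \<psi>"
  shows "\<exists>\<phi>'. steps W L \<phi> \<phi>' \<and> (\<forall>v\<in>V. \<phi>' v = \<theta> v)"
proof -
  obtain \<alpha> \<beta> D where D: "swap_set V \<phi> \<alpha> \<beta> D" "\<And>v. v \<in> V \<Longrightarrow> \<theta> v = swap \<alpha> \<beta> D \<phi> v" and \<theta>: "colors V L \<theta>"
    using st unfolding step_def by blast
  have \<phi>V: "colors V L \<phi>" by (rule colors_subset[OF \<phi>]) blast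
  show ?thesis
  proof (cases "\<alpha> = \<beta>")
    case True
    have "\<phi> v = \<theta> v" if "v \<in> V" for v
      using D(2)[OF that] swap_setD(2)[OF D(1), of v] True by (auto simp: swap_def)
    then show ?thesis by blast
  next
    case False
    obtain S where S: "\<And>i. S (c i) \<subseteq> avail \<phi> (c i)" "\<And>i. card (S (c i)) = 2"
      "\<And>i. (\<exists>x\<in>D. adj (c i) x) \<longrightarrow> 2 < card (avail \<phi> (c i)) \<longrightarrow> S (c i) \<inter> {\<alpha>, \<beta>} = {}"
      using lists_for_swap[OF \<phi>V D(1)] by blast
    obtain \<xi> where \<xi>: "colors (range c) S \<xi>" "clockwise S \<alpha> \<beta> \<xi>"
      using clockwise_coloring_exists[of S, OF S(2) False] by blast
    have t: "card (avail \<phi> (c i)) \<le> 2" if "x \<in> D" "adj (c i) x" "\<xi> (c i) \<in> {\<alpha>, \<beta>}" for i x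
    proof (rule ccontr)
      assume "\<not> ?thesis"
      then have "S (c i) \<inter> {\<alpha>, \<beta>} = {}" using S(3)[of i] that by auto
      moreover have "\<xi> (c i) \<in> S (c i)" using \<xi>(1) unfolding colors_range_iff by blast
      ultimately show False using that(3) by blast
    qed
    obtain \<psi> \<phi>' where "colors (range c) (avail \<phi>) \<psi>" "\<forall>v\<in>V. \<psi> v = \<phi> v"
      "steps W L \<psi> \<phi>'" "\<forall>v\<in>V. \<phi>' v = \<theta> v"
    proof -
      have "\<exists>\<psi> \<phi>'. colors (range c) (avail \<phi>) \<psi> \<and> (\<forall>v\<in>V. \<psi> v = \<phi> v) \<and> (\<forall>i. \<psi> (c i) = \<xi> (c i)) \<and>
         steps W L \<psi> \<phi>' \<and> (\<forall>v\<in>V. \<phi>' v = \<theta> v)"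
        by (rule step_combine[OF \<phi>V \<xi>(1) S(1) \<xi>(2) D(1) _ \<theta>]) (use D(2) t in auto)
      then show thesis using that by blast
    qed
    then show ?thesis using equiv[of \<psi>] by (meson rtranclp_trans)
  qed
qed

text \<open>Each list consists of the color of the vertex and that of its predecessor, so \<phi> is
  clockwise for every pair of colors and the swap extends without any recoloring beforehand.\<close>

lemma lift_one_direction:
  assumes \<phi>: "colors W L \<phi>" and st: "step V L \<phi> \<theta>"
    and tight: "\<And>i. card (avail \<phi> (c i)) = 2" and dir: "\<And>i. \<phi> (c i) \<in> avail \<phi> (c (Suc i))"
  shows "\<exists>\<phi>'. steps W L \<phi> \<phi>' \<and> (\<forall>v\<in>V. \<phi>' v = \<theta> v)"
proof -
  obtain \<alpha> \<beta> D where D: "swap_set V \<phi> \<alpha> \<beta> D" "\<And>v. v \<in> V \<Longrightarrow> \<theta> v = swap \<alpha> \<beta> D \<phi> v" and \<theta>: "colors V L \<theta>"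
    using st unfolding step_def by blast
  have av: "\<phi> (c i) \<in> avail \<phi> (c i)" "\<phi> (c i) \<noteq> \<phi> (c (Suc i))" for i
    using colors_avail[OF \<phi>] unfolding colors_range_iff by blast+
  have "clockwise (avail \<phi>) \<alpha> \<beta> \<phi>"
    unfolding clockwise_def
  proof (intro allI impI)
    fix i assume "\<phi> (c i) \<in> {\<alpha>, \<beta>}" "\<phi> (c (Suc i)) \<in> {\<alpha>, \<beta>}"
    then have "{\<alpha>, \<beta>} = {\<phi> (c i), \<phi> (c (Suc i))}" using av(2)[of i] by auto
    then show "{\<alpha>, \<beta>} \<subseteq> avail \<phi> (c (Suc i))" using dir[of i] av(1)[of "Suc i"] by simp
  qed
  then show ?thesis
    by (intro lift_clockwise[OF \<phi> D(1) _ \<theta> order_refl]) (simp_all add: tight D(2))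
qed

text \<open>If some coloring moves every color on to the next list, all lists have the form
  \<open>{\<tau> (c i), \<tau> (c (Suc i))}\<close> and there are only two colorings.\<close>
lemma rotating_unique:
  assumes tight: "\<And>i. card (avail \<phi> (c i)) = 2"
    and \<tau>: "colors (range c) (avail \<phi>) \<tau>" "\<And>i. \<tau> (c i) \<in> avail \<phi> (c (Suc i))"
    and \<phi>: "colors (range c) (avail \<phi>) \<phi>"
  shows "(\<forall>i. \<phi> (c i) \<in> avail \<phi> (c (Suc i))) \<or> (\<forall>i. \<phi> (c (Suc i)) \<in> avail \<phi> (c i))"
proof -
  have \<tau>': "\<tau> (c i) \<in> avail \<phi> (c i)" "\<tau> (c i) \<noteq> \<tau> (c (Suc i))" for i
    using \<tau>(1) unfolding colors_range_iff by blast+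
  have \<phi>': "\<phi> (c i) \<in> avail \<phi> (c i)" "\<phi> (c i) \<noteq> \<phi> (c (Suc i))" for i
    using \<phi> unfolding colors_range_iff by blast+
  have lists: "avail \<phi> (c (Suc i)) = {\<tau> (c i), \<tau> (c (Suc i))}" for i
  proof (rule sym, rule card_subset_eq[OF finite_avail])
    show "{\<tau> (c i), \<tau> (c (Suc i))} \<subseteq> avail \<phi> (c (Suc i))" using \<tau>(2) \<tau>'(1) by simp
    show "card {\<tau> (c i), \<tau> (c (Suc i))} = card (avail \<phi> (c (Suc i)))" using tight \<tau>'(2) by simp
  qed
  have dich: "\<phi> (c (Suc i)) = \<tau> (c i) \<or> \<phi> (c (Suc i)) = \<tau> (c (Suc i))" for i
    using \<phi>'(1)[of "Suc i"] lists[of i] by simp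
  show ?thesis
  proof (cases "\<exists>k. \<phi> (c k) = \<tau> (c k)")
    case True
    then obtain k where k: "\<phi> (c k) = \<tau> (c k)" by blast
    \<comment> \<open>Agreement at one vertex spreads forward, since the other color of the next
      list is the one just used.\<close>
    have "\<phi> (c (m + k)) = \<tau> (c (m + k))" for m
    proof (induction m)
      case (Suc m)
      then show ?case using dich[of "m + k"] \<phi>'(2)[of "m + k"] by auto
    qed (use k in simp)
    then have "\<phi> (c i) = \<tau> (c i)" for i using shift_surj[of k i] by metis
    then show ?thesis using \<tau>(2) by simp
  next
    case False
    then have "\<phi> (c (Suc i)) = \<tau> (c i)" for i using dich[of i] by blast
    then show ?thesis using \<tau>'(1) by simp
  qed
qed

text \<open>By \<open>rotating_unique\<close>, a \<tau> that moved all its colors forward would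
  force \<phi> to move all colors in one direction, against the choice of \<open>i\<close> and
  \<open>j\<close>. So \<tau> also has a color missing from the next list, at some
  \<open>c p\<close>, and a coloring that takes this color from \<tau> and the color at
  \<open>c i\<close> from \<phi> links the two.\<close>

lemma tight_flexible:
  assumes \<phi>: "colors W L \<phi>" and tight: "\<And>i. card (avail \<phi> (c i)) = 2"
    and i: "\<phi> (c i) \<notin> avail \<phi> (c (Suc i))" and j: "\<phi> (c (Suc j)) \<notin> avail \<phi> (c j)"
    and \<tau>: "colors (range c) (avail \<phi>) \<tau>" "\<And>v. v \<in> V \<Longrightarrow> \<tau> v = \<phi> v"
  shows "steps W L \<phi> \<tau>"
proof -
  have \<phi>V: "colors V L \<phi>" by (rule colors_subset[OF \<phi>]) blast
  note \<phi>c = colors_avail[OF \<phi>]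
  have \<phi>': "\<phi> (c i) \<in> avail \<phi> (c i)" for i using \<phi>c unfolding colors_range_iff by blast
  have \<tau>': "\<tau> (c i) \<in> avail \<phi> (c i)" for i using \<tau>(1) unfolding colors_range_iff by blast
  obtain p where p: "\<tau> (c p) \<notin> avail \<phi> (c (Suc p))"
    using rotating_unique[OF tight \<tau>(1) _ \<phi>c] i j by blast
  show ?thesis
  proof (cases "avail \<phi> (c i) \<inter> avail \<phi> (c (Suc i)) = {}")
    case True
    then have "degenerate (extension_lists \<phi> (avail \<phi>)) W"
      using degenerate_avail[OF \<phi>V] by blast
    then show ?thesis
      by (rule extension_steps[OF \<phi>V order_refl]) (use \<phi>c \<tau> in auto)
  next
    case False
    show ?thesis
    proof (cases "c i = c p")
      case True
      have "\<phi> (c i) = \<tau> (c i)"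
      proof (rule ccontr)
        \<comment> \<open>The two colors then make up the whole list of \<open>c i\<close>, and both
          are missing from the next list.\<close>
        assume ne: "\<phi> (c i) \<noteq> \<tau> (c i)"
        have eq: "{\<phi> (c i), \<tau> (c i)} = avail \<phi> (c i)"
          by (rule card_subset_eq[OF finite_avail]) (use ne tight \<phi>' \<tau>' in auto)
        have "c (Suc p) = c (Suc i)" using True by (simp add: c_Suc_eq_iff)
        then have "\<tau> (c i) \<notin> avail \<phi> (c (Suc i))" using p True by simp
        then have "avail \<phi> (c i) \<inter> avail \<phi> (c (Suc i)) = {}" using i unfolding eq[symmetric] by simp
        then show False using \<open>avail \<phi> (c i) \<inter> avail \<phi> (c (Suc i)) \<noteq> {}\<close> by blast
      qed
      then show ?thesis
        by (intro fixed_color_steps[OF \<phi>V \<phi>' i \<phi>c]) (use \<tau> in auto)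
    next
      case False
      obtain \<sigma> where \<sigma>: "colors (range c) (avail \<phi>) \<sigma>" "\<forall>v\<in>V. \<sigma> v = \<phi> v" "\<sigma> (c i) = \<phi> (c i)" "\<sigma> (c p) = \<tau> (c p)"
        using two_fixed_colors[OF \<phi>V \<phi>' i \<tau>' p False] by blast
      have "steps W L \<phi> \<sigma>"
        by (rule fixed_color_steps[OF \<phi>V \<phi>' i \<phi>c _ _ \<sigma>(1)]) (use \<sigma> in auto)
      moreover have "steps W L \<sigma> \<tau>"
        by (rule fixed_color_steps[OF \<phi>V \<tau>' p \<sigma>(1) _ _ \<tau>(1)]) (use \<sigma> \<tau> in auto)
      ultimately show ?thesis by (rule rtranclp_trans)
    qed
  qed
qed

section \<open>Lifting and equivalence over the cycle\<close>

lemma cycle_extension_rev: "cycle_extension adj (\<lambda>i. c ((n - 1) * i)) n V L"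
proof -
  interpret rv: even_cycle adj "\<lambda>i. c ((n - 1) * i)" n by (rule even_cycle_rev)
  show ?thesis by unfold_locales (use finite_V c_notin card_L in auto)
qed

lemma range_rev: "range (\<lambda>i. c ((n - 1) * i)) = range c"
proof
  show "range c \<subseteq> range (\<lambda>i. c ((n - 1) * i))"
  proof
    fix x assume "x \<in> range c"
    then obtain i where "x = c i" by blast
    then obtain j where "x = c ((n - 1) * j)" using rev_surj[of i] by metis
    then show "x \<in> range (\<lambda>i. c ((n - 1) * i))" by blast
  qed
qed auto

text \<open>With a third color somewhere, or with colors that move neither all forward nor all
  backward, every extension is within reach. The remaining colorings move all colors one way, and
  reversing the cycle turns backward into forward.\<close>

lemma lift_step_cycle:
  assumes \<phi>: "colors W L \<phi>" and st: "step V L \<phi> \<theta>"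
  shows "\<exists>\<phi>'. steps W L \<phi> \<phi>' \<and> (\<forall>v\<in>V. \<phi>' v = \<theta> v)"
proof -
  have \<phi>V: "colors V L \<phi>" by (rule colors_subset[OF \<phi>]) blast
  note \<phi>c = colors_avail[OF \<phi>]
  consider i where "3 \<le> card (avail \<phi> (c i))" | "\<And>i. card (avail \<phi> (c i)) = 2"
  proof -
    have "card (avail \<phi> (c i)) = 2 \<or> 3 \<le> card (avail \<phi> (c i))" for i using card_avail[of \<phi> i] by linarith
    then show thesis using that by blast
  qed
  then show ?thesis
  proof cases
    case (1 i)
    then have deg: "degenerate (extension_lists \<phi> (avail \<phi>)) W"
      using degenerate_avail[OF \<phi>V] by blast
    show ?thesis
      by (rule lift_flexible[OF \<phi> st], rule extension_steps[OF \<phi>V order_refl deg]) (use \<phi>c in auto)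
  next
    case 2
    consider "\<And>i. \<phi> (c i) \<in> avail \<phi> (c (Suc i))" | "\<And>i. \<phi> (c (Suc i)) \<in> avail \<phi> (c i)"
      | i j where "\<phi> (c i) \<notin> avail \<phi> (c (Suc i))" "\<phi> (c (Suc j)) \<notin> avail \<phi> (c j)" by blast
    then show ?thesis
    proof cases
      case 1
      then show ?thesis using lift_one_direction[OF \<phi> st 2] by blast
    next
      case rev: 2
      interpret rv: cycle_extension adj "\<lambda>i. c ((n - 1) * i)" n V L by (rule cycle_extension_rev)
      have "\<phi> (c ((n - 1) * i)) \<in> avail \<phi> (c ((n - 1) * Suc i))" for i
        using rev[of "(n - 1) * Suc i"] by (simp only: c_rev_Suc)
      then show ?thesis using rv.lift_one_direction[of \<phi> \<theta>] \<phi> st 2 unfolding range_rev by blast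
    next
      case (3 i j)
      show ?thesis by (rule lift_flexible[OF \<phi> st]) (rule tight_flexible[OF \<phi> 2 3])
    qed
  qed
qed

text \<open>Every coloring can be brought to agree with \<theta> outside the cycle, and the third
  color makes the extensions of \<theta> equivalent to each other.\<close>

theorem all_equivalent_cycle:
  assumes V: "all_equivalent V L" and \<theta>: "colors V L \<theta>" "3 \<le> card (avail \<theta> (c i))"
  shows "all_equivalent W L"
  unfolding all_equivalent_def
proof (intro allI impI)
  fix \<phi> \<psi> assume \<phi>: "colors W L \<phi>" and \<psi>: "colors W L \<psi>"
  have reach: "\<exists>\<phi>'. steps W L \<phi> \<phi>' \<and> (\<forall>v\<in>V. \<phi>' v = \<theta> v) \<and> colors (range c) (avail \<theta>) \<phi>'"
    if \<phi>: "colors W L \<phi>" for \<phi>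
  proof -
    have "steps V L \<phi> \<theta>" using V \<theta>(1) colors_subset[OF \<phi>, of V] unfolding all_equivalent_def by blast
    then obtain \<phi>' where \<phi>': "steps W L \<phi> \<phi>'" "\<forall>v\<in>V. \<phi>' v = \<theta> v"
      using lift_steps[OF lift_step_cycle] \<phi> by blast
    have "colors (range c) (avail \<phi>') \<phi>'" using colors_avail steps_colors[OF \<phi>'(1) \<phi>] by blast
    then show ?thesis using \<phi>' avail_cong[of \<phi>' \<theta>] by auto
  qed
  obtain \<phi>' where \<phi>': "steps W L \<phi> \<phi>'" "\<forall>v\<in>V. \<phi>' v = \<theta> v" "colors (range c) (avail \<theta>) \<phi>'"
    using reach[OF \<phi>] by blast
  obtain \<psi>' where \<psi>': "steps W L \<psi> \<psi>'" "\<forall>v\<in>V. \<psi>' v = \<theta> v" "colors (range c) (avail \<theta>) \<psi>'"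
    using reach[OF \<psi>] by blast
  have deg: "degenerate (extension_lists \<theta> (avail \<theta>)) W"
    using degenerate_avail[OF \<theta>(1)] \<theta>(2) by blast
  have "steps W L \<phi>' \<psi>'"
    by (rule extension_steps[OF \<theta>(1) order_refl deg]) (use \<phi>' \<psi>' in auto)
  then show "steps W L \<phi> \<psi>"
    using \<phi>'(1) steps_sym[OF \<psi>'(1)] by (meson rtranclp_trans)
qed

end

section \<open>Sparse graphs contain reducible configurations\<close>

abbreviation deg :: "'a set set \<Rightarrow> 'a \<Rightarrow> nat" where
  "deg H v \<equiv> card {e\<in>H. v \<in> e}"

lemma finite_Union_edges: "finite K \<Longrightarrow> (\<And>e. e \<in> K \<Longrightarrow> card e = 2) \<Longrightarrow> finite (\<Union>K)"
  by (rule finite_Union) (auto intro: card_ge_0_finite)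

lemma sum_deg:
  assumes "finite H" "finite S"
  shows "(\<Sum>v\<in>S. deg H v) = (\<Sum>e\<in>H. card (e \<inter> S))"
proof -
  have "(\<Sum>v\<in>S. deg H v) = (\<Sum>v\<in>S. \<Sum>e\<in>H. of_bool (v \<in> e))"
    using assms(1) by (simp add: sum_of_bool_eq Int_def)
  also have "\<dots> = (\<Sum>e\<in>H. \<Sum>v\<in>S. of_bool (v \<in> e))" by (rule sum.swap)
  also have "\<dots> = (\<Sum>e\<in>H. card (e \<inter> S))"
    using assms(2) by (simp add: sum_of_bool_eq Int_def conj_commute)
  finally show ?thesis .
qed

text \<open>Each peeled edge takes a vertex of its own with it.\<close>

lemma card_le_card_Union_if_peelable:
  assumes "finite K" "\<And>e. e \<in> K \<Longrightarrow> card e = 2" "\<And>K'. K' \<subseteq> K \<Longrightarrow> leafless K' \<Longrightarrow> K' = {}"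
  shows "card K \<le> card (\<Union>K)"
  using assms
proof (induction K rule: finite_psubset_induct)
  case (psubset K)
  show ?case
  proof (cases "K = {}")
    case False
    then have "\<not> leafless K" using psubset.prems(2) by blast
    then obtain e v where e: "e \<in> K" "v \<in> e" "\<And>f. f \<in> K \<Longrightarrow> f \<noteq> e \<Longrightarrow> v \<notin> f"
      unfolding leafless_def by blast
    have fin: "finite (\<Union>K)" using finite_Union_edges[OF psubset.hyps psubset.prems(1)] .
    have "card (K - {e}) \<le> card (\<Union>(K - {e}))"
    proof (rule psubset.IH)
      show "K - {e} \<subset> K" using e by blast
      show "K' = {}" if "K' \<subseteq> K - {e}" "leafless K'" for K' by (rule psubset.prems(2)) (use that in auto)
    qed (use psubset.prems in auto)
    also have "\<dots> \<le> card (\<Union>K - {v})" using e fin by (intro card_mono) auto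
    finally have "card (K - {e}) \<le> card (\<Union>K - {v})" .
    moreover have "card K = Suc (card (K - {e}))" by (rule card.remove[OF psubset.hyps e(1)])
    moreover have "card (\<Union>K) = Suc (card (\<Union>K - {v}))" by (rule card.remove[OF fin]) (use e in blast)
    ultimately show ?thesis by simp
  qed simp
qed

text \<open>Every edge can be continued at each end, so there is an infinite walk that never turns
  back. Its first repetition closes a cycle; the length is at least three, because vertices at
  distance one or two along the walk differ.\<close>

lemma leafless_contains_cycle:
  assumes "finite K" "K \<noteq> {}" "leafless K" "\<And>e. e \<in> K \<Longrightarrow> card e = 2"
  shows "\<exists>v n. cyclic_sequence v n \<and> (\<forall>i. {v i, v (Suc i)} \<in> K)"
proof -
  have next_ex: "\<exists>d. {b, d} \<in> K \<and> d \<noteq> a" if ab: "{a, b} \<in> K" for a b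
  proof -
    obtain f where f: "f \<in> K" "f \<noteq> {a, b}" "b \<in> f" using assms(3) ab unfolding leafless_def by blast
    obtain u w where uw: "f = {u, w}" "u \<noteq> w" using assms(4)[OF f(1)] by (auto simp: card_2_iff)
    then show ?thesis using f by (metis doubleton_eq_iff empty_iff insert_iff)
  qed
  obtain e where e: "e \<in> K" using assms(2) by blast
  then obtain a0 b0 where ab0: "e = {a0, b0}" using assms(4)[OF e] by (auto simp: card_2_iff)
  have "\<exists>f. \<forall>i. {fst (f i), snd (f i)} \<in> K \<and> (fst (f (Suc i)) = snd (f i) \<and> snd (f (Suc i)) \<noteq> fst (f i))"
  proof (rule dependent_nat_choice)
    show "\<exists>x. {fst x, snd x} \<in> K" using e ab0 by (intro exI[of _ "(a0, b0)"]) simp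
    show "\<exists>y. {fst y, snd y} \<in> K \<and> fst y = snd x \<and> snd y \<noteq> fst x" if x: "{fst x, snd x} \<in> K" for x :: "'a \<times> 'a" and i :: nat
      using next_ex[OF x] by auto
  qed
  then obtain f where f: "\<And>i. {fst (f i), snd (f i)} \<in> K" "\<And>i. fst (f (Suc i)) = snd (f i)" "\<And>i. snd (f (Suc i)) \<noteq> fst (f i)"
    by blast
  define x where "x = (\<lambda>i. fst (f i))"
  have xK: "{x i, x (Suc i)} \<in> K" for i using f(1)[of i] f(2)[of i] by (simp add: x_def)
  have x1: "x i \<noteq> x (Suc i)" for i using assms(4)[OF xK[of i]] by auto
  have x2: "x i \<noteq> x (Suc (Suc i))" for i using f(2)[of "Suc i"] f(3)[of i] by (simp add: x_def)
  have "finite (\<Union>K)" using finite_Union_edges[OF assms(1,4)] .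
  then have "\<not> inj x" using xK by (metis (no_types, lifting) Union_iff finite_subset image_subsetI infinite_UNIV_nat finite_imageD insertI1)
  then have ex: "\<exists>j. \<exists>i<j. x i = x j" unfolding inj_def by (metis linorder_neqE_nat)
  define j where "j = (LEAST j. \<exists>i<j. x i = x j)"
  obtain i where i: "i < j" "x i = x j" using LeastI_ex[OF ex] unfolding j_def by blast
  have inj: "x s \<noteq> x t" if "s < t" "t < j" for s t
    using not_less_Least[of t "\<lambda>j. \<exists>i<j. x i = x j"] that unfolding j_def by blast
  define n where "n = j - i"
  have j: "j = i + n" "0 < n" using i by (auto simp: n_def)
  have "n \<noteq> 1" "n \<noteq> 2" using i j x1[of i] x2[of i] by auto
  then have n3: "3 \<le> n" using j by linarith
  define v where "v = (\<lambda>t. x (i + t mod n))"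
  have "cyclic_sequence v n"
  proof
    show "3 \<le> n" by (rule n3)
    show "v (t + n) = v t" for t by (simp add: v_def)
    show "inj_on v {..<n}"
    proof (rule linorder_inj_onI')
      fix s t assume "s \<in> {..<n}" "t \<in> {..<n}" "s < t"
      then show "v s \<noteq> v t" using inj[of "i + s" "i + t"] j by (simp add: v_def)
    qed
  qed
  moreover have "{v t, v (Suc t)} \<in> K" for t
  proof (cases "Suc (t mod n) = n")
    case True
    then have "v (Suc t) = x j" using i by (simp add: v_def mod_Suc)
    moreover have "Suc (i + t mod n) = j" using True j by simp
    ultimately show ?thesis using xK[of "i + t mod n"] by (simp add: v_def)
  next
    case False
    then have "v (Suc t) = x (Suc (i + t mod n))" by (simp add: v_def mod_Suc)
    then show ?thesis using xK[of "i + t mod n"] by (simp add: v_def)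
  qed
  ultimately show ?thesis by blast
qed

text \<open>What the induction keeps of planarity. Both bounds range over all subsets of edges, so
  they are inherited when edges are deleted; \<open>S\<close> is one side of a bipartition of
  \<open>K\<close>.\<close>

definition planar_sparse :: "'a set set \<Rightarrow> bool" where
  "planar_sparse H \<longleftrightarrow> finite H \<and> (\<forall>e\<in>H. card e = 2) \<and>
     (\<forall>K\<subseteq>H. 3 \<le> card (\<Union>K) \<longrightarrow> card K + 6 \<le> 3 * card (\<Union>K)) \<and>
     (\<forall>K\<subseteq>H. \<forall>S. (\<forall>e\<in>K. card (e \<inter> S) = 1) \<longrightarrow> card K \<le> 2 * card (\<Union>K))"

lemma planar_sparseD:
  assumes "planar_sparse H"
  shows "finite H" "e \<in> H \<Longrightarrow> card e = 2" "3 \<le> card (\<Union>H) \<Longrightarrow> card H + 6 \<le> 3 * card (\<Union>H)"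
    "K \<subseteq> H \<Longrightarrow> (\<And>e. e \<in> K \<Longrightarrow> card (e \<inter> S) = 1) \<Longrightarrow> card K \<le> 2 * card (\<Union>K)"
  using assms unfolding planar_sparse_def by (blast, blast, blast, metis)

lemma planar_sparse_subset: "planar_sparse H \<Longrightarrow> K \<subseteq> H \<Longrightarrow> planar_sparse K"
  unfolding planar_sparse_def by (intro conjI) (auto intro: finite_subset)

lemma planar_sparse_plane_graph:
  assumes "plane_graph (V, E) p c"
  shows "planar_sparse E"
proof -
  interpret drawing V E p c using assms by unfold_locales
  show ?thesis
    unfolding planar_sparse_def
    using fin_E card_E plane_graph_edge_bound[OF plane_graph_subset[OF assms]]
      plane_graph_bipartite_edge_bound[OF plane_graph_subset[OF assms]] by blast
qed

text \<open>Charge counting. The total charge \<open>d v - 6\<close> is at most \<open>-9\<close>, while the bipartite bounds for the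
  vertices with \<open>d v \<le> 5\<close> and \<open>d v \<le> 4\<close> and the forest bound for \<open>d v = 3\<close>, taken with weights
  \<open>1\<close>, \<open>2\<close>, \<open>3\<close>, show that three times the total charge is at least \<open>-18\<close>. The marks \<open>m\<close> count the
  precolored edges at a vertex.\<close>
theorem sparse_reducible:
  fixes m :: "'a \<Rightarrow> nat"
  assumes H: "planar_sparse H" "H \<noteq> {}" and m: "(\<Sum>v\<in>\<Union>H. m v) \<le> 3" and "10 \<le> k"
    and d: "\<And>v. v \<in> \<Union>H \<Longrightarrow> deg H v + m v < k"
  shows "(\<exists>u v. {u, v} \<in> H \<and> u \<noteq> v \<and> deg H u + m u + (deg H v + m v) \<le> k + 1) \<or>
    (\<exists>K\<subseteq>H. K \<noteq> {} \<and> leafless K \<and>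
      (\<forall>e\<in>K. \<exists>u w. e = {u, w} \<and> deg H w + m w = 3 \<and> deg H u + m u = k - 1))"
proof (rule ccontr)
  assume no: "\<not> ?thesis"
  define U where "U = \<Union>H"
  \<comment> \<open>A mark is treated as one more edge at the vertex, since it costs the edges there
    one color.\<close>
  define D where "D = (\<lambda>v. deg H v + m v)"
  have fin: "finite H" and c2: "\<And>e. e \<in> H \<Longrightarrow> card e = 2" using planar_sparseD(1,2)[OF H(1)] by blast+
  have finU: "finite U" unfolding U_def by (rule finite_Union_edges[OF fin c2])
  have heavy: "k + 2 \<le> D u + D v" if "{u, v} \<in> H" "u \<noteq> v" for u v
  proof -
    have "\<not> D u + D v \<le> k + 1" using no that unfolding D_def by blast
    then show ?thesis by simp
  qed
  have Dk: "D v \<le> k - 1" if "v \<in> U" for v using d[of v] that unfolding U_def D_def by simp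
  have edge: "\<exists>u. e = {u, w} \<and> u \<noteq> w \<and> u \<in> U" if ew: "e \<in> H" "w \<in> e" for e w
  proof -
    obtain a b where ab: "e = {a, b}" "a \<noteq> b" using c2[OF ew(1)] by (auto simp: card_2_iff)
    have "a \<in> U" "b \<in> U" using ew(1) ab(1) unfolding U_def by blast+
    then show ?thesis using ab ew(2) by (cases "w = a") (auto simp: insert_commute)
  qed
  have D3: "3 \<le> D v" if v: "v \<in> U" for v
  proof -
    obtain e where e: "e \<in> H" "v \<in> e" using v unfolding U_def by blast
    obtain u where "e = {u, v}" "u \<noteq> v" "u \<in> U" using edge[OF e] by blast
    then show ?thesis using heavy[of u v] e Dk[of u] assms(4) by simp
  qed
  \<comment> \<open>The planar bound requires three vertices. On fewer there is a single edge, whose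
    ends have \<open>D\<close> sum at most 5 even with all marks, far below
    \<open>k + 2\<close>.\<close>
  have card_U: "3 \<le> card U"
  proof (rule ccontr)
    assume small: "\<not> 3 \<le> card U"
    obtain e where e: "e \<in> H" using H(2) by blast
    have eU: "f = U" if "f \<in> H" for f
    proof (rule card_subset_eq[OF finU])
      show fU: "f \<subseteq> U" using that by (auto simp: U_def)
      show "card f = card U" using card_mono[OF finU fU] c2[OF that] small by linarith
    qed
    obtain u v where uv: "e = {u, v}" "u \<noteq> v" using c2[OF e] by (auto simp: card_2_iff)
    have "deg H w \<le> 1" for w
    proof -
      have "{f\<in>H. w \<in> f} \<subseteq> {U}" using eU by blast
      then have "card {f\<in>H. w \<in> f} \<le> card {U}" by (intro card_mono) auto
      then show ?thesis by simp
    qed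
    from this[of u] this[of v] have "D u + D v \<le> 2 + (m u + m v)" unfolding D_def by linarith
    also have "m u + m v = (\<Sum>w\<in>U. m w)" using eU[OF e] uv by auto
    finally show False using heavy[of u v] e uv m assms(4) unfolding U_def by simp
  qed
  \<comment> \<open>Each edge has at most one end in \<open>S\<close>, so the degrees count edges;
    the summand 3 pays for all marks.\<close>
  have sum_D: "(\<Sum>v\<in>S. D v) \<le> card {e\<in>H. e \<inter> S \<noteq> {}} + 3" if S: "S \<subseteq> U" "\<And>e. e \<in> H \<Longrightarrow> card (e \<inter> S) \<le> 1" for S
  proof -
    have finS: "finite S" using S(1) finU finite_subset by blast
    have "(\<Sum>v\<in>S. deg H v) = (\<Sum>e\<in>H. card (e \<inter> S))" by (rule sum_deg[OF fin finS])
    also have "\<dots> \<le> (\<Sum>e\<in>H. of_bool (e \<inter> S \<noteq> {}))"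
    proof (rule sum_mono)
      show "card (e \<inter> S) \<le> of_bool (e \<inter> S \<noteq> {})" if "e \<in> H" for e using S(2)[OF that] by auto
    qed
    also have "\<dots> = card {e\<in>H. e \<inter> S \<noteq> {}}" using fin by (simp add: sum_of_bool_eq Int_def)
    finally have "(\<Sum>v\<in>S. deg H v) \<le> card {e\<in>H. e \<inter> S \<noteq> {}}" .
    moreover have "(\<Sum>v\<in>S. m v) \<le> 3"
      using sum_mono2[OF finU S(1), of m] m unfolding U_def by simp
    ultimately show ?thesis unfolding D_def by (simp add: sum.distrib)
  qed
  have le1: "card (e \<inter> {v\<in>U. D v \<le> j}) \<le> 1" if e: "e \<in> H" and "j \<le> 5" for e j
  proof (rule ccontr)
    assume "\<not> ?thesis"
    then have "2 \<le> card (e \<inter> {v\<in>U. D v \<le> j})" by simp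
    moreover have "card (e \<inter> {v\<in>U. D v \<le> j}) \<le> card e" using c2[OF e] by (intro card_mono) (auto intro: card_ge_0_finite)
    ultimately have "card (e \<inter> {v\<in>U. D v \<le> j}) = card e" using c2[OF e] by simp
    then have "e \<inter> {v\<in>U. D v \<le> j} = e" using c2[OF e] by (intro card_subset_eq) (auto intro: card_ge_0_finite)
    moreover obtain u v where uv: "e = {u, v}" "u \<noteq> v" using c2[OF e] by (auto simp: card_2_iff)
    ultimately have "D u \<le> j" "D v \<le> j" by auto
    then show False using heavy[of u v] e uv \<open>j \<le> 5\<close> assms(4) by simp
  qed
  \<comment> \<open>The other end of an edge at a vertex with value at most \<open>j\<close> has
    value at least \<open>k + 2 - j\<close>, and \<open>10 \<le> k\<close> makes this at least
    \<open>12 - j\<close>.\<close>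
  have Un: "\<Union>{e\<in>H. e \<inter> {v\<in>U. D v \<le> j} \<noteq> {}} \<subseteq> {v\<in>U. D v \<le> j} \<union> {v\<in>U. 12 - j \<le> D v}" for j
  proof
    fix w assume "w \<in> \<Union>{e\<in>H. e \<inter> {v\<in>U. D v \<le> j} \<noteq> {}}"
    then obtain e x where e: "e \<in> H" "w \<in> e" "x \<in> e" "D x \<le> j" by blast
    have "w \<in> U" using e by (auto simp: U_def)
    moreover obtain u where "e = {u, w}" "u \<noteq> w" using edge[OF e(1,2)] by blast
    ultimately show "w \<in> {v\<in>U. D v \<le> j} \<union> {v\<in>U. 12 - j \<le> D v}"
      using e heavy[of u w] assms(4) by (cases "x = w") auto
  qed
  have bip: "(\<Sum>v\<in>{v\<in>U. D v \<le> j}. D v) \<le> 2 * (card {v\<in>U. D v \<le> j} + card {v\<in>U. 12 - j \<le> D v}) + 3"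
    if "j \<le> 5" for j
  proof -
    let ?S = "{v\<in>U. D v \<le> j}" and ?N = "{v\<in>U. 12 - j \<le> D v}"
    let ?K = "{e\<in>H. e \<inter> ?S \<noteq> {}}"
    have one: "card (e \<inter> ?S) = 1" if "e \<in> ?K" for e
    proof -
      have "finite (e \<inter> ?S)" using finU by simp
      then have "card (e \<inter> ?S) \<noteq> 0" using that by simp
      then show ?thesis using le1[of e j] that \<open>j \<le> 5\<close> by simp
    qed
    have 1: "card ?K \<le> 2 * card (\<Union>?K)"
      by (rule planar_sparseD(4)[OF H(1) _ one]) blast
    have "card (\<Union>?K) \<le> card (?S \<union> ?N)" using Un[of j] finU by (intro card_mono) auto
    then have 2: "card (\<Union>?K) \<le> card ?S + card ?N" using card_Un_le le_trans by blast
    have 3: "(\<Sum>v\<in>?S. D v) \<le> card ?K + 3" by (rule sum_D) (use le1 \<open>j \<le> 5\<close> in auto)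
    have "card ?K + 3 \<le> 2 * (card ?S + card ?N) + 3"
      by (rule add_right_mono) (rule le_trans[OF 1 mult_le_mono2[OF 2]])
    then show ?thesis by (rule le_trans[OF 3])
  qed
  \<comment> \<open>A vertex of value 3 has only neighbors of value \<open>k - 1\<close>. A leafless
    set of such edges is the second alternative, so these edges form a forest, and the factor 2 of
    the bipartite bound improves to 1.\<close>
  have forest: "(\<Sum>v\<in>{v\<in>U. D v \<le> 3}. D v) \<le> card {v\<in>U. D v \<le> 3} + card {v\<in>U. 9 \<le> D v} + 3"
  proof -
    let ?S = "{v\<in>U. D v \<le> 3}"
    let ?K = "{e\<in>H. e \<inter> ?S \<noteq> {}}"
    have shape: "\<exists>u w. e = {u, w} \<and> deg H w + m w = 3 \<and> deg H u + m u = k - 1" if eK: "e \<in> ?K" for e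
    proof -
      obtain w where w: "e \<in> H" "w \<in> e" "w \<in> U" "D w \<le> 3" using eK by blast
      obtain u where u: "e = {u, w}" "u \<noteq> w" "u \<in> U" using edge[OF w(1,2)] by blast
      have "D w = 3" using D3[OF w(3)] w(4) by simp
      moreover have "D u = k - 1" using heavy[of u w] Dk[OF u(3)] u w \<open>D w = 3\<close> by simp
      ultimately show ?thesis using u unfolding D_def by blast
    qed
    have "K' = {}" if K': "K' \<subseteq> ?K" "leafless K'" for K'
    proof (rule ccontr)
      assume ne: "K' \<noteq> {}"
      have sh: "\<exists>u w. e = {u, w} \<and> deg H w + m w = 3 \<and> deg H u + m u = k - 1" if "e \<in> K'" for e
        by (rule shape[OF subsetD[OF K'(1) that]])
      have "K' \<subseteq> H" using K'(1) by (rule order_trans) (rule Collect_subset)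
      then show False using no ne K'(2) sh by meson
    qed
    note peel = this
    have 1: "card ?K \<le> card (\<Union>?K)"
    proof (rule card_le_card_Union_if_peelable)
      show "finite ?K" using fin by simp
      show "card e = 2" if "e \<in> ?K" for e using c2 that by simp
    qed (rule peel)
    have "card (\<Union>?K) \<le> card (?S \<union> {v\<in>U. 12 - 3 \<le> D v})" using Un[of 3] finU by (intro card_mono) simp_all
    then have "card (\<Union>?K) \<le> card ?S + card {v\<in>U. 12 - 3 \<le> D v}" using card_Un_le le_trans by blast
    then have 2: "card (\<Union>?K) \<le> card ?S + card {v\<in>U. 9 \<le> D v}" by simp
    have 3: "(\<Sum>v\<in>?S. D v) \<le> card ?K + 3" by (rule sum_D) (use le1[of _ 3] in auto)
    show ?thesis by (rule le_trans[OF 3], rule add_right_mono) (rule le_trans[OF 1 2])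
  qed
  \<comment> \<open>Planarity gives \<open>6 * card U - 12\<close> for the sum of degrees, and the
    marks add at most 3.\<close>
  have total: "(\<Sum>v\<in>U. D v) + 9 \<le> 6 * card U"
  proof -
    have "(\<Sum>v\<in>U. deg H v) = (\<Sum>e\<in>H. card (e \<inter> U))" by (rule sum_deg[OF fin finU])
    also have "\<dots> = (\<Sum>e\<in>H. 2)"
    proof (rule sum.cong[OF refl])
      fix e assume e: "e \<in> H"
      then have "e \<inter> U = e" by (auto simp: U_def)
      then show "card (e \<inter> U) = 2" using c2[OF e] by simp
    qed
    finally have "(\<Sum>v\<in>U. deg H v) = 2 * card H" by simp
    moreover have "card H + 6 \<le> 3 * card U" using planar_sparseD(3)[OF H(1)] card_U unfolding U_def by blast
    moreover have "(\<Sum>v\<in>U. D v) = (\<Sum>v\<in>U. deg H v) + (\<Sum>v\<in>U. m v)" unfolding D_def by (rule sum.distrib)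
    ultimately show ?thesis using m unfolding U_def by linarith
  qed
  have sumf: "(\<Sum>v\<in>{v\<in>U. P v}. g v) = (\<Sum>v\<in>U. if P v then g v else 0)" for P and g :: "'a \<Rightarrow> nat"
    by (rule sum.inter_filter[OF finU])
  have cardf: "card {v\<in>U. P v} = (\<Sum>v\<in>U. if P v then 1 else 0)" for P
    using sumf[of "\<lambda>_. 1" P] by simp
  \<comment> \<open>The weights 1, 2, 3 make this an equality for the values 3, 4, 5, 6, 8 and 9;
    there is slack only at 7 and above 9.\<close>
  have "(\<Sum>v\<in>U. 18 + 2 * (if 7 \<le> D v then 1 else 0) + 2 * (2 * (if 8 \<le> D v then 1 else 0)) + 3 * (if 9 \<le> D v then 1 else 0) +
      2 * (if D v \<le> 5 then 1 else 0) + 2 * (2 * (if D v \<le> 4 then 1 else 0)) + 3 * (if D v \<le> 3 then 1 else 0)) \<le>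
     (\<Sum>v\<in>U. 3 * D v + (if D v \<le> 5 then D v else 0) + 2 * (if D v \<le> 4 then D v else 0) + 3 * (if D v \<le> 3 then D v else (0::nat)))"
  proof (rule sum_mono)
    fix v assume "v \<in> U"
    then have "3 \<le> D v" by (rule D3)
    then consider "D v = 3" | "D v = 4" | "D v = 5" | "D v = 6" | "D v = 7" | "D v = 8" | "9 \<le> D v" by linarith
    then show "18 + 2 * (if 7 \<le> D v then 1 else 0) + 2 * (2 * (if 8 \<le> D v then 1 else 0)) + 3 * (if 9 \<le> D v then 1 else 0) +
      2 * (if D v \<le> 5 then 1 else 0) + 2 * (2 * (if D v \<le> 4 then 1 else 0)) + 3 * (if D v \<le> 3 then 1 else 0) \<le>
     3 * D v + (if D v \<le> 5 then D v else 0) + 2 * (if D v \<le> 4 then D v else 0) + 3 * (if D v \<le> 3 then D v else (0::nat))"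
      by cases simp_all
  qed
  moreover have "(\<Sum>v\<in>{v\<in>U. D v \<le> 5}. D v) \<le> 2 * (card {v\<in>U. D v \<le> 5} + card {v\<in>U. 7 \<le> D v}) + 3" using bip[of 5] by simp
  moreover have "(\<Sum>v\<in>{v\<in>U. D v \<le> 4}. D v) \<le> 2 * (card {v\<in>U. D v \<le> 4} + card {v\<in>U. 8 \<le> D v}) + 3" using bip[of 4] by simp
  \<comment> \<open>The marks cost \<open>3 + 2 * 3 + 3 * 3 = 18\<close> in the weighted bounds,
    less than the deficit \<open>3 * 9 = 27\<close> of the total.\<close>
  ultimately show False
    using total forest unfolding sumf cardf sum.distrib sum_distrib_left[symmetric] by simp
qed

section \<open>Edge colorings\<close>

definition meets :: "'a set \<Rightarrow> 'a set \<Rightarrow> bool" where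
  "meets e f \<longleftrightarrow> e \<noteq> f \<and> e \<inter> f \<noteq> {}"

interpretation line: adjacency meets
  by unfold_locales (auto simp: meets_def)

lemma card_meets:
  assumes "finite H" "\<And>e. e \<in> H \<Longrightarrow> card e = 2" "{u, v} \<in> H" "u \<noteq> v"
  shows "card {f\<in>H. meets {u, v} f} + 2 = deg H u + deg H v"
proof -
  let ?e = "{u, v}"
  have "f = ?e" if f: "f \<in> H" "u \<in> f" "v \<in> f" for f
  proof -
    have "finite f" using assms(2)[OF f(1)] by (intro card_ge_0_finite) simp
    then have "?e = f" by (rule card_subset_eq) (use f assms(2)[OF f(1)] assms(4) in auto)
    then show ?thesis by simp
  qed
  then have "{f\<in>H. meets ?e f} = ({f\<in>H. u \<in> f} - {?e}) \<union> ({f\<in>H. v \<in> f} - {?e})"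
    "({f\<in>H. u \<in> f} - {?e}) \<inter> ({f\<in>H. v \<in> f} - {?e}) = {}"
    by (auto simp: meets_def)
  then have "card {f\<in>H. meets ?e f} = card ({f\<in>H. u \<in> f} - {?e}) + card ({f\<in>H. v \<in> f} - {?e})"
    using assms(1) by (simp add: card_Un_disjoint)
  moreover have "card {f\<in>H. w \<in> f} = Suc (card ({f\<in>H. w \<in> f} - {?e}))" if "w \<in> ?e" for w
    by (rule card.remove) (use assms that in auto)
  from this[of u] this[of v] have "deg H u = Suc (card ({f\<in>H. u \<in> f} - {?e}))" "deg H v = Suc (card ({f\<in>H. v \<in> f} - {?e}))"
    by simp_all
  ultimately show ?thesis by linarith
qed

section \<open>Even cycles of edges\<close>

locale edge_cycle = cyclic_sequence v n for v :: "nat \<Rightarrow> 'a" and n +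
  fixes H :: "'a set set"
  assumes fin_H: "finite H" and card_H: "e \<in> H \<Longrightarrow> card e = 2" and edge_H: "{v i, v (Suc i)} \<in> H"
    and even_n: "even n"
begin

definition c :: "nat \<Rightarrow> 'a set" where "c i = {v i, v (Suc i)}"

lemma v_Suc_ne: "v i \<noteq> v (Suc i)" "v i \<noteq> v (Suc (Suc i))"
proof -
  have "v (0 + i) \<noteq> v (1 + i)" "v (0 + i) \<noteq> v (2 + i)"
    unfolding c_add_eq_iff using inj_c n_ge by (auto dest: inj_onD)
  then show "v i \<noteq> v (Suc i)" "v i \<noteq> v (Suc (Suc i))" by simp_all
qed

lemma c_eq: "c i = c j \<longleftrightarrow> v i = v j"
proof
  assume "c i = c j"
  then have "v i = v j \<or> v i = v (Suc j) \<and> v (Suc i) = v j" unfolding c_def by (metis doubleton_eq_iff)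
  then show "v i = v j"
  proof
    assume *: "v i = v (Suc j) \<and> v (Suc i) = v j"
    then have "v (Suc i) = v (Suc (Suc j))" using c_Suc_eq_iff[of i "Suc j"] by metis
    then show ?thesis using * v_Suc_ne(2)[of j] by metis
  qed
qed (use c_Suc_eq_iff[of i j] in \<open>simp add: c_def\<close>)

lemma meets_c: "meets (c i) (c j) \<longleftrightarrow> c j = c (Suc i) \<or> c i = c (Suc j)"
proof -
  have "c i \<inter> c j \<noteq> {} \<longleftrightarrow> v i = v j \<or> v i = v (Suc j) \<or> v j = v (Suc i)"
    unfolding c_def using c_Suc_eq_iff[of i j] by auto
  then show ?thesis unfolding meets_def c_eq using v_Suc_ne(1) by metis
qed

sublocale cyc: even_cycle meets c n
proof unfold_locales
  show "c (i + n) = c i" for i using c_periodic[of i] c_periodic[of "Suc i"] by (simp add: c_def)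
  show "inj_on c {..<n}" using inj_c by (auto simp: inj_on_def c_eq)
qed (use n_ge even_n meets_c in auto)

lemma range_c_sub: "range c \<subseteq> H" unfolding c_def using edge_H by auto

lemma at_vertex: "v j \<in> e \<Longrightarrow> e \<in> range c \<Longrightarrow> e = c j \<or> e = c (j + (n - 1))"
proof -
  assume e: "v j \<in> e" "e \<in> range c"
  then obtain t where t: "e = c t" by blast
  have "v j = v (Suc (j + (n - 1)))" using c_periodic[of j] n_ge by simp
  then show ?thesis using e(1) unfolding t c_eq by (auto simp: c_def c_Suc_eq_iff)
qed

text \<open>Of the edges that \<open>c i\<close> meets, two are its distinct neighbors on the
  cycle.\<close>

lemma outer_neighbors:
  "card {f\<in>H - range c. meets (c i) f} + 4 \<le> deg H (v i) + deg H (v (Suc i))"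
proof -
  let ?p = "i + (n - 1)"
  have p: "c (Suc ?p) = c i" using cyc.c_periodic[of i] n_ge by simp
  have "meets (c i) (c (Suc i))" "meets (c i) (c ?p)" using p unfolding meets_c by simp_all
  moreover have "c ?p \<noteq> c (Suc i)" using v_Suc_ne(2)[of ?p] p c_Suc_eq_iff[of "Suc ?p" i] unfolding c_eq by metis
  ultimately have "card ({f\<in>H - range c. meets (c i) f} \<union> {c (Suc i), c ?p}) = card {f\<in>H - range c. meets (c i) f} + 2"
    using fin_H by (subst card_Un_disjoint) auto
  moreover have "card ({f\<in>H - range c. meets (c i) f} \<union> {c (Suc i), c ?p}) \<le> card {f\<in>H. meets (c i) f}"
    using \<open>meets (c i) (c (Suc i))\<close> \<open>meets (c i) (c ?p)\<close> range_c_sub fin_H by (intro card_mono) auto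
  moreover have "card {f\<in>H. meets (c i) f} + 2 = deg H (v i) + deg H (v (Suc i))"
    unfolding c_def using card_meets[OF fin_H card_H edge_H v_Suc_ne(1)] by blast
  ultimately show ?thesis by linarith
qed

lemma cycle_extension_outer:
  assumes "\<And>i. deg H (v i) + deg H (v (Suc i)) \<le> card (L (c i)) + 2"
  shows "cycle_extension meets c n (H - range c) L"
proof unfold_locales
  show "card {w\<in>H - range c. meets (c i) w} + 2 \<le> card (L (c i))" for i
    using outer_neighbors[of i] assms[of i] by linarith
qed (use fin_H in auto)

end

section \<open>Colorings with precolored edges\<close>

lemma edge_cycle_from_leafless:
  assumes H: "finite H" "\<And>e. e \<in> H \<Longrightarrow> card e = 2" and K: "K \<subseteq> H" "K \<noteq> {}" "leafless K"
    and d: "\<And>e. e \<in> K \<Longrightarrow> \<exists>u w. e = {u, w} \<and> D w = 3 \<and> D u = k - 1" and "10 \<le> (k :: nat)"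
  shows "\<exists>v n. edge_cycle v n H \<and> (\<forall>i. D (v i) = 3 \<and> D (v (Suc i)) = k - 1 \<or> D (v i) = k - 1 \<and> D (v (Suc i)) = 3)"
proof -
  obtain v n where v: "cyclic_sequence v n" "\<And>i. {v i, v (Suc i)} \<in> K"
    using leafless_contains_cycle[OF finite_subset[OF K(1) H(1)] K(2,3)] H(2) K(1) by blast
  interpret cyclic_sequence v n by (rule v(1))
  have alt: "D (v i) = 3 \<and> D (v (Suc i)) = k - 1 \<or> D (v i) = k - 1 \<and> D (v (Suc i)) = 3" for i
    using d[OF v(2)[of i]] by (metis doubleton_eq_iff)
  have flip: "D (v (Suc i)) = 3 \<longleftrightarrow> D (v i) \<noteq> 3" for i using alt[of i] assms(7) by auto
  have par: "D (v i) = 3 \<longleftrightarrow> (D (v 0) = 3 \<longleftrightarrow> even i)" for i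
    by (induction i) (simp_all add: flip)
  \<comment> \<open>The values 3 and \<open>k - 1\<close> differ and alternate around the cycle, so
    its length is even.\<close>
  have "even n" using par[of n] c_n by auto
  then have "edge_cycle v n H" using H K(1) v(2) by unfold_locales auto
  then show ?thesis using alt by blast
qed

text \<open>An edge may lack one color for each mark at its ends. Since \<open>deg H v + m v\<close>
  charges a mark like an edge, the configurations of \<open>sparse_reducible\<close> remain
  colorable with these shorter lists.\<close>

theorem marked_edge_coloring_exists:
  fixes m :: "'a \<Rightarrow> nat"
  assumes "planar_sparse H" "10 \<le> k" "(\<Sum>v\<in>\<Union>H. m v) \<le> 3" "\<And>v. v \<in> \<Union>H \<Longrightarrow> deg H v + m v < k"
    "\<And>u v. {u, v} \<in> H \<Longrightarrow> u \<noteq> v \<Longrightarrow> k \<le> card (L {u, v}) + m u + m v"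
  shows "\<exists>\<phi>. line.colors H L \<phi>"
proof -
  have "finite H" using assms(1) by (rule planar_sparseD)
  then show ?thesis using assms(1,3,4,5)
  proof (induction H rule: finite_psubset_induct)
    case (psubset H)
    note c2 = planar_sparseD(2)[OF psubset.prems(1)]
    have finU: "finite (\<Union>H)" by (rule finite_Union_edges[OF psubset.hyps c2])
    have sub: "\<exists>\<phi>. line.colors K L \<phi>" if K: "K \<subset> H" for K
    proof (rule psubset.IH[OF K])
      show "planar_sparse K" using planar_sparse_subset[OF psubset.prems(1)] K by blast
      have "(\<Sum>v\<in>\<Union>K. m v) \<le> (\<Sum>v\<in>\<Union>H. m v)" using K finU by (intro sum_mono2) auto
      then show "(\<Sum>v\<in>\<Union>K. m v) \<le> 3" using psubset.prems(2) by simp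
      fix v assume v: "v \<in> \<Union>K"
      have "deg K v \<le> deg H v" using K psubset.hyps by (intro card_mono) auto
      moreover have "v \<in> \<Union>H" using v K by blast
      ultimately show "deg K v + m v < k" using psubset.prems(3)[of v] by simp
    next
      show "k \<le> card (L {u, v}) + m u + m v" if "{u, v} \<in> K" "u \<noteq> v" for u v
        by (rule psubset.prems(4)) (use that K in auto)
    qed
    show ?case
    proof (cases "H = {}")
      case True
      then show ?thesis by (simp add: line.colors_def)
    next
      case False
      have "(\<exists>u v. {u, v} \<in> H \<and> u \<noteq> v \<and> deg H u + m u + (deg H v + m v) \<le> k + 1) \<or>
        (\<exists>K\<subseteq>H. K \<noteq> {} \<and> leafless K \<and>
          (\<forall>e\<in>K. \<exists>u w. e = {u, w} \<and> deg H w + m w = 3 \<and> deg H u + m u = k - 1))"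
        by (rule sparse_reducible[OF psubset.prems(1) False psubset.prems(2) assms(2) psubset.prems(3)])
      then consider u v where "{u, v} \<in> H" "u \<noteq> v" "deg H u + m u + (deg H v + m v) \<le> k + 1"
        | K where "K \<subseteq> H" "K \<noteq> {}" "leafless K" "\<And>e. e \<in> K \<Longrightarrow> \<exists>u w. e = {u, w} \<and> deg H w + m w = 3 \<and> deg H u + m u = k - 1"
        by meson
      then show ?thesis
      proof cases
        case (1 u v)
        let ?e = "{u, v}"
        have "H - {?e} \<subset> H" using 1(1) by auto
        from sub[OF this] obtain \<phi> where \<phi>: "line.colors (H - {?e}) L \<phi>" ..
        have "card {f\<in>H - {?e}. meets ?e f \<and> L f \<inter> L ?e \<noteq> {}} \<le> card {f\<in>H. meets ?e f}"
          using psubset.hyps by (intro card_mono) auto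
        also have "\<dots> < card (L ?e)"
          using card_meets[OF psubset.hyps c2 1(1,2)] 1(3) psubset.prems(4)[OF 1(1,2)] by linarith
        finally have few: "card {f\<in>H - {?e}. meets ?e f \<and> L f \<inter> L ?e \<noteq> {}} < card (L ?e)" .
        have "\<exists>\<psi>. line.colors (insert ?e (H - {?e})) L \<psi>"
          by (rule line.colors_insert_exists[OF _ _ few \<phi>]) (use psubset.hyps in auto)
        then show ?thesis using 1(1) by (simp add: insert_absorb)
      next
        case (2 K)
        obtain v n where "edge_cycle v n H" and alt: "\<And>i. deg H (v i) + m (v i) = 3 \<and> deg H (v (Suc i)) + m (v (Suc i)) = k - 1 \<or>
            deg H (v i) + m (v i) = k - 1 \<and> deg H (v (Suc i)) + m (v (Suc i)) = 3"
          using edge_cycle_from_leafless[where D = "\<lambda>v. deg H v + m v", OF psubset.hyps c2 2 assms(2)] by blast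
        then interpret edge_cycle v n H by simp
        have "deg H (v i) + deg H (v (Suc i)) \<le> card (L (c i)) + 2" for i
          using alt[of i] psubset.prems(4)[OF edge_H v_Suc_ne(1), of i] assms(2) unfolding c_def by linarith
        then interpret ext: cycle_extension meets c n "H - range c" L by (rule cycle_extension_outer)
        have "H - range c \<subset> H" using range_c_sub by auto
        from sub[OF this] obtain \<phi> where \<phi>: "line.colors (H - range c) L \<phi>" ..
        obtain \<xi> where \<xi>: "line.colors (range c) (ext.avail \<phi>) \<xi>"
          using cyc.cycle_two_choosable[of "ext.avail \<phi>", OF ext.card_avail] by blast
        have "line.colors (H - range c \<union> range c) L (\<lambda>e. if e \<in> range c then \<xi> e else \<phi> e)"
          by (rule ext.colors_combine[OF \<phi> \<xi> order_refl]) auto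
        moreover have "H - range c \<union> range c = H" using range_c_sub by blast
        ultimately show ?thesis by metis
      qed
    qed
  qed
qed

text \<open>The edges of \<open>F\<close> are deleted and \<open>a\<close> is removed from the lists
  of the edges that meet them. A mark at each end of an edge of \<open>F\<close> pays for this
  color, and degree plus mark stays below \<open>k\<close> because every marked vertex has lost an
  edge.\<close>

lemma precoloring_extends:
  assumes V: "planar_sparse V" "10 \<le> k" "\<And>v. v \<in> \<Union>V \<Longrightarrow> deg V v < k" "\<And>e. e \<in> V \<Longrightarrow> card (L e) = k"
    and F: "F \<subseteq> V" "\<And>e f. e \<in> F \<Longrightarrow> f \<in> F \<Longrightarrow> \<not> meets e f" "\<And>e. e \<in> F \<Longrightarrow> a \<in> L e"
    and few: "card (\<Union>(V - F) \<inter> \<Union>F) \<le> 3"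
  shows "\<exists>\<theta>. line.colors V L \<theta> \<and> (\<forall>e\<in>F. \<theta> e = a)"
proof -
  define m where "m = (\<lambda>v. of_bool (v \<in> \<Union>F) :: nat)"
  define L0 where "L0 = (\<lambda>e. if e \<inter> \<Union>F = {} then L e else L e - {a})"
  note fin = planar_sparseD(1)[OF V(1)] and c2 = planar_sparseD(2)[OF V(1)]
  have finU: "finite (\<Union>(V - F))" by (rule finite_Union_edges) (use fin c2 in auto)
  have "\<exists>\<phi>. line.colors (V - F) L0 \<phi>"
  proof (rule marked_edge_coloring_exists[OF _ V(2)])
    show "planar_sparse (V - F)" using planar_sparse_subset[OF V(1)] by blast
    show "(\<Sum>v\<in>\<Union>(V - F). m v) \<le> 3" using few finU unfolding m_def by (simp add: sum_of_bool_eq Int_def)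
    show "deg (V - F) v + m v < k" if v: "v \<in> \<Union>(V - F)" for v
    proof (cases "v \<in> \<Union>F")
      case True
      then obtain f where f: "f \<in> F" "v \<in> f" by blast
      have "card {e\<in>V - F. v \<in> e} < card {e\<in>V. v \<in> e}"
        by (rule psubset_card_mono) (use f F(1) fin in auto)
      moreover have "deg V v < k" by (rule V(3)) (use v in auto)
      ultimately show ?thesis using True by (simp add: m_def del: mem_Collect_eq)
    next
      case False
      have "card {e\<in>V - F. v \<in> e} \<le> card {e\<in>V. v \<in> e}" using fin by (intro card_mono) auto
      moreover have "deg V v < k" by (rule V(3)) (use v in auto)
      ultimately show ?thesis using False by (simp add: m_def)
    qed
    show "k \<le> card (L0 {u, v}) + m u + m v" if e: "{u, v} \<in> V - F" "u \<noteq> v" for u v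
    proof (cases "{u, v} \<inter> \<Union>F = {}")
      case True
      then show ?thesis using V(4) e by (simp add: L0_def)
    next
      case False
      then have "1 \<le> m u + m v" by (auto simp: m_def)
      moreover have "card (L {u, v}) \<le> card (L {u, v} - {a}) + 1" using diff_card_le_card_Diff[of "{a}" "L {u, v}"] by simp
      ultimately show ?thesis using V(4)[of "{u, v}"] e False by (simp add: L0_def)
    qed
  qed
  then obtain \<phi> where \<phi>: "line.colors (V - F) L0 \<phi>" by blast
  define \<theta> where "\<theta> = (\<lambda>e. if e \<in> F then a else \<phi> e)"
  have \<phi>_a: "\<phi> e \<noteq> a" if "e \<in> V - F" "f \<in> F" "meets e f" for e f
  proof -
    have "e \<inter> \<Union>F \<noteq> {}" using that by (auto simp: meets_def)
    then have "L0 e = L e - {a}" by (simp only: L0_def if_False)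
    moreover have "\<phi> e \<in> L0 e" using \<phi> that(1) unfolding line.colors_def by blast
    ultimately show ?thesis by blast
  qed
  have "line.colors V L \<theta>"
    unfolding line.colors_def
  proof (intro conjI ballI impI)
    show "\<theta> e \<in> L e" if "e \<in> V" for e
    proof (cases "e \<in> F")
      case True then show ?thesis using F(3) by (simp add: \<theta>_def)
    next
      case False
      then have "\<phi> e \<in> L0 e" using \<phi> that unfolding line.colors_def by blast
      then show ?thesis using False by (auto simp: \<theta>_def L0_def split: if_splits)
    qed
    show "\<theta> e \<noteq> \<theta> f" if ef: "e \<in> V" "f \<in> V" "meets e f" for e f
    proof (cases "e \<in> F"; cases "f \<in> F")
      assume "e \<in> F" "f \<in> F" then show ?thesis using F(2) ef by blast
    next
      assume "e \<in> F" "f \<notin> F" then show ?thesis using \<phi>_a[of f e] ef line.adj_sym by (auto simp: \<theta>_def)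
    next
      assume "e \<notin> F" "f \<in> F" then show ?thesis using \<phi>_a[of e f] ef by (auto simp: \<theta>_def)
    next
      assume "e \<notin> F" "f \<notin> F" then show ?thesis using \<phi> ef unfolding line.colors_def by (auto simp: \<theta>_def)
    qed
  qed
  then show ?thesis by (intro exI[of _ \<theta>]) (simp add: \<theta>_def)
qed

text \<open>Let \<open>g\<close> and \<open>h\<close> be edges outside the cycle at the two ends of \<open>c j\<close>. A color of \<open>g\<close> or \<open>h\<close>
  that is missing from the list of \<open>c j\<close> can be precolored. Otherwise the three lists agree and \<open>g\<close>,
  \<open>h\<close> are precolored alike. At most three marks arise, as \<open>g\<close> is the only outer edge at its end \<open>w\<close>.\<close>
theorem (in edge_cycle) loose_coloring_exists:
  assumes H: "planar_sparse H" "10 \<le> k" and d: "\<And>u. u \<in> \<Union>H \<Longrightarrow> deg H u < k" and L: "\<And>e. e \<in> H \<Longrightarrow> card (L e) = k"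
    and j: "deg H (v j) = 3" "deg H (v (Suc j)) = k - 1"
  shows "\<exists>\<theta>. line.colors (H - range c) L \<theta> \<and> 3 \<le> card (L (c j) - \<theta> ` {e\<in>H - range c. meets (c j) e})"
proof -
  define V where "V = H - range c"
  define w where "w = v j"
  define u where "u = v (Suc j)"
  have wu: "w \<noteq> u" "c j = {w, u}" by (simp_all add: w_def u_def c_def v_Suc_ne)
  have finV: "finite V" using fin_H by (simp add: V_def)
  have cH: "c t \<in> H" for t using range_c_sub by blast
  define p where "p = j + (n - 1)"
  have at_w: "e = c j \<or> e = c p" if "w \<in> e" "e \<in> range c" for e
    using at_vertex[of j e] that by (simp add: w_def p_def)
  have at_u: "e = c (Suc j) \<or> e = c j" if "u \<in> e" "e \<in> range c" for e
  proof -
    have "c (Suc j + (n - 1)) = c j" using cyc.c_periodic[of j] n_ge by simp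
    then show ?thesis using at_vertex[of "Suc j" e] that by (simp add: u_def)
  qed
  \<comment> \<open>\<open>w\<close> has degree 3 and lies on only two cycle edges, so there is an
    outer edge \<open>g\<close> at \<open>w\<close>.\<close>
  have "card {c j, c p} \<le> 2" by (simp add: card_insert_if)
  then have "\<not> {e\<in>H. w \<in> e} \<subseteq> {c j, c p}"
    using j(1) card_mono[of "{c j, c p}" "{e\<in>H. w \<in> e}"] unfolding w_def by auto
  then obtain g where g: "g \<in> H" "w \<in> g" "g \<noteq> c j" "g \<noteq> c p" by blast
  have gV: "g \<in> V" using g at_w unfolding V_def by blast
  obtain x where x: "g = {w, x}" "x \<noteq> w" using card_H[OF g(1)] g(2) by (auto simp: card_2_iff)
  have xu: "x \<noteq> u" using g(3) x wu by auto
  \<comment> \<open>\<open>u\<close> has degree at least 9, so \<open>h\<close> can avoid the two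
    cycle edges and also \<open>{u, x}\<close>, the only edge besides \<open>c j\<close> through
    which it could meet \<open>g\<close>.\<close>
  have "card {c j, c (Suc j), {u, x}} \<le> 3" by (simp add: card_insert_if)
  then have "\<not> {e\<in>H. u \<in> e} \<subseteq> {c j, c (Suc j), {u, x}}"
    using j(2) H(2) card_mono[of "{c j, c (Suc j), {u, x}}" "{e\<in>H. u \<in> e}"] unfolding u_def by auto
  then obtain h where h: "h \<in> H" "u \<in> h" "h \<noteq> c j" "h \<noteq> c (Suc j)" "h \<noteq> {u, x}" by blast
  have hV: "h \<in> V" using h at_u unfolding V_def by blast
  obtain y where y: "h = {u, y}" "y \<noteq> u" using card_H[OF h(1)] h(2) by (auto simp: card_2_iff)
  have yx: "y \<noteq> x" "y \<noteq> w" using h y wu by (auto simp: insert_commute)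
  have gh: "g \<noteq> h" "\<not> meets g h" "\<not> meets h g" using x y xu yx wu by (auto simp: meets_def)
  have only_g: "e = g" if "e \<in> V" "w \<in> e" for e
  proof (rule ccontr)
    assume "e \<noteq> g"
    have "v j = v (Suc p)" using c_periodic[of j] n_ge by (simp add: p_def)
    then have "w \<in> c p" by (simp add: c_def w_def)
    moreover have "c p \<noteq> c j"
    proof
      assume "c p = c j"
      then show False using \<open>v j = v (Suc p)\<close> v_Suc_ne(1)[of p] unfolding c_eq by simp
    qed
    moreover have out: "c t \<noteq> f" if "f \<in> V" for t f using that unfolding V_def by blast
    ultimately have "card {c j, c p, g, e} = 4"
      using out[OF gV] out[OF \<open>e \<in> V\<close>] \<open>e \<noteq> g\<close> by simp
    moreover have "w \<in> c j" "e \<in> H" using wu(2) \<open>e \<in> V\<close> unfolding V_def by blast+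
    then have "{c j, c p, g, e} \<subseteq> {e\<in>H. w \<in> e}" using g(1,2) \<open>w \<in> e\<close> \<open>w \<in> c p\<close> cH by blast
    ultimately have "card {c j, c p, g, e} = 4" "{c j, c p, g, e} \<subseteq> {e\<in>H. w \<in> e}" by blast+
    then show False using card_mono[of "{e\<in>H. w \<in> e}" "{c j, c p, g, e}"] fin_H j(1) unfolding w_def by simp
  qed
  have meets_gh: "meets (c j) g" "meets (c j) h" using g h wu by (auto simp: meets_def)
  let ?N = "{e\<in>V. meets (c j) e}"
  have cardN: "card ?N + 2 \<le> k"
  proof -
    have "card ?N + 4 \<le> deg H (v j) + deg H (v (Suc j))" using outer_neighbors[of j] unfolding V_def .
    then show ?thesis using j H(2) by simp
  qed
  have finN: "finite ?N" using finV by simp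
  have sV: "planar_sparse V" using planar_sparse_subset[OF H(1)] unfolding V_def by blast
  have dV: "deg V z < k" if "z \<in> \<Union>V" for z
  proof -
    have "deg V z \<le> deg H z" using fin_H unfolding V_def by (intro card_mono) auto
    moreover have "z \<in> \<Union>H" using that unfolding V_def by blast
    ultimately show ?thesis using d[of z] by linarith
  qed
  have LV: "card (L e) = k" if "e \<in> V" for e using L that unfolding V_def by blast
  note pre = precoloring_extends[where L = L, OF sV H(2) dV LV]
  have finL: "finite (L (c j))" using L[OF cH] H(2) by (intro card_ge_0_finite) simp
  \<comment> \<open>\<open>c j\<close> has at most \<open>k - 2\<close> outer neighbors. If one of
    them takes no list color of its own, three colors remain.\<close>
  have goal: "3 \<le> card (L (c j) - \<theta> ` ?N)" if "card (L (c j) \<inter> \<theta> ` ?N) < card ?N" for \<theta> :: "'a set \<Rightarrow> 'b"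
  proof -
    have "card (L (c j)) = card (L (c j) \<inter> \<theta> ` ?N) + card (L (c j) - \<theta> ` ?N)"
      by (rule card_Int_Diff[OF finL])
    then show ?thesis using that cardN L[OF cH] by simp
  qed
  \<comment> \<open>A color outside the list of \<open>c j\<close> costs it nothing. Precoloring a
    single edge makes at most two marks.\<close>
  have one: ?thesis if f: "f \<in> {g, h}" "a \<in> L f" "a \<notin> L (c j)" for f a
  proof -
    have fV: "f \<in> V" "meets (c j) f" using f(1) gV hV meets_gh by auto
    have cf: "card f = 2" using card_H fV(1) unfolding V_def by blast
    then have "card (\<Union>(V - {f}) \<inter> \<Union>{f}) \<le> card f" by (intro card_mono) (auto intro: card_ge_0_finite)
    then have "card (\<Union>(V - {f}) \<inter> \<Union>{f}) \<le> 3" using cf by simp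
    moreover have "\<not> meets e e'" if "e \<in> {f}" "e' \<in> {f}" for e e' using that by (simp add: meets_def)
    moreover have "a \<in> L e" if "e \<in> {f}" for e using that f by simp
    ultimately obtain \<theta> where \<theta>: "line.colors V L \<theta>" "\<theta> f = a"
      using pre[where F = "{f}" and a = a] fV(1) by auto
    have "L (c j) \<inter> \<theta> ` ?N \<subseteq> \<theta> ` (?N - {f})" using f(3) \<theta>(2) by auto
    then have "card (L (c j) \<inter> \<theta> ` ?N) \<le> card (?N - {f})"
      using finN by (meson card_image_le card_mono finite_Diff finite_imageI le_trans)
    also have "\<dots> < card ?N" by (rule card_Diff1_less[OF finN]) (use fV in simp)
    finally show ?thesis using goal \<theta>(1) unfolding V_def by blast
  qed
  show ?thesis
  proof (cases "L g \<subseteq> L (c j) \<and> L h \<subseteq> L (c j)")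
    case False
    then show ?thesis using one by blast
  next
    case True
    have "L g = L (c j)" "L h = L (c j)"
      using True L[OF g(1)] L[OF h(1)] L[OF cH[of j]] card_subset_eq[OF finL, of "L g"] card_subset_eq[OF finL, of "L h"]
      by simp_all
    moreover have "L (c j) \<noteq> {}" using L[OF cH[of j]] H(2) by auto
    ultimately obtain a where a: "a \<in> L g" "a \<in> L h" by auto
    have "\<Union>(V - {g, h}) \<inter> \<Union>{g, h} \<subseteq> {x, u, y}" using only_g x y by auto
    then have "card (\<Union>(V - {g, h}) \<inter> \<Union>{g, h}) \<le> card {x, u, y}" by (intro card_mono) auto
    also have "\<dots> \<le> 3" by (simp add: card_insert_if)
    finally have "card (\<Union>(V - {g, h}) \<inter> \<Union>{g, h}) \<le> 3" .
    moreover have "\<not> meets e e'" if "e \<in> {g, h}" "e' \<in> {g, h}" for e e'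
      using that gh by (auto simp: meets_def)
    moreover have "a \<in> L e" if "e \<in> {g, h}" for e using that a by auto
    ultimately obtain \<theta> where \<theta>: "line.colors V L \<theta>" "\<theta> g = a" "\<theta> h = a"
      using pre[where F = "{g, h}" and a = a] gV hV by auto
    have "\<theta> ` ?N \<subseteq> \<theta> ` (?N - {g})"
    proof
      fix z assume "z \<in> \<theta> ` ?N"
      then obtain e where e: "e \<in> ?N" "z = \<theta> e" by blast
      have h: "h \<in> ?N - {g}" using hV meets_gh gh by blast
      show "z \<in> \<theta> ` (?N - {g})"
      proof (cases "e = g")
        case True
        then have "z = \<theta> h" using e(2) \<theta>(2,3) by simp
        then show ?thesis using h by (rule image_eqI)
      next
        case False
        then have "e \<in> ?N - {g}" using e(1) by simp
        then show ?thesis using e(2) by simp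
      qed
    qed
    then have "card (\<theta> ` ?N) \<le> card (?N - {g})"
      using finN by (meson card_image_le card_mono finite_Diff finite_imageI le_trans)
    moreover have "card (L (c j) \<inter> \<theta> ` ?N) \<le> card (\<theta> ` ?N)" using finN by (intro card_mono) auto
    moreover have "card (?N - {g}) < card ?N" by (rule card_Diff1_less[OF finN]) (use gV meets_gh in simp)
    ultimately have "card (L (c j) \<inter> \<theta> ` ?N) < card ?N" by linarith
    then show ?thesis using goal \<theta>(1) unfolding V_def by blast
  qed
qed

theorem edge_colorings_all_equivalent:
  assumes "planar_sparse H" "10 \<le> k" "\<And>v. v \<in> \<Union>H \<Longrightarrow> deg H v < k" "\<And>e. e \<in> H \<Longrightarrow> card (L e) = k"
  shows "line.all_equivalent H L"
proof -
  have "finite H" using assms(1) by (rule planar_sparseD)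
  then show ?thesis using assms(1,3,4)
  proof (induction H rule: finite_psubset_induct)
    case (psubset H)
    note c2 = planar_sparseD(2)[OF psubset.prems(1)]
    have sub: "line.all_equivalent K L" if K: "K \<subset> H" for K
    proof (rule psubset.IH[OF K])
      show "planar_sparse K" using planar_sparse_subset[OF psubset.prems(1)] K by blast
      fix v assume v: "v \<in> \<Union>K"
      have "deg K v \<le> deg H v" using K psubset.hyps by (intro card_mono) auto
      moreover have "v \<in> \<Union>H" using v K by blast
      ultimately show "deg K v < k" using psubset.prems(2)[of v] by simp
    next
      show "card (L e) = k" if "e \<in> K" for e by (rule psubset.prems(3)) (use that K in auto)
    qed
    show ?case
    proof (cases "H = {}")
      case True
      then show ?thesis using line.degenerate_all_equivalent[OF line.degenerate.empty] by simp
    next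
      case False
      have "(\<exists>u v. {u, v} \<in> H \<and> u \<noteq> v \<and> deg H u + deg H v \<le> k + 1) \<or>
        (\<exists>K\<subseteq>H. K \<noteq> {} \<and> leafless K \<and> (\<forall>e\<in>K. \<exists>u w. e = {u, w} \<and> deg H w = 3 \<and> deg H u = k - 1))"
        using sparse_reducible[OF psubset.prems(1) False, of "\<lambda>_. 0" k] assms(2) psubset.prems(2) by simp
      then consider u v where "{u, v} \<in> H" "u \<noteq> v" "deg H u + deg H v \<le> k + 1"
        | K where "K \<subseteq> H" "K \<noteq> {}" "leafless K" "\<And>e. e \<in> K \<Longrightarrow> \<exists>u w. e = {u, w} \<and> deg H w = 3 \<and> deg H u = k - 1"
        by meson
      then show ?thesis
      proof cases
        case (1 u v)
        let ?e = "{u, v}"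
        have "card {f\<in>H - {?e}. meets ?e f \<and> L f \<inter> L ?e \<noteq> {}} \<le> card {f\<in>H. meets ?e f}"
          using psubset.hyps by (intro card_mono) auto
        also have "\<dots> < card (L ?e)"
          using card_meets[OF psubset.hyps c2 1(1,2)] 1(3) psubset.prems(3)[OF 1(1)] assms(2) by linarith
        finally have few: "card {f\<in>H - {?e}. meets ?e f \<and> L f \<inter> L ?e \<noteq> {}} < card (L ?e)" .
        have "line.all_equivalent (insert ?e (H - {?e})) L"
          by (rule line.all_equivalent_insert[OF _ _ few sub]) (use psubset.hyps 1(1) in auto)
        then show ?thesis using 1(1) by (simp add: insert_absorb)
      next
        case (2 K)
        obtain v n where "edge_cycle v n H" and alt: "\<And>i. deg H (v i) = 3 \<and> deg H (v (Suc i)) = k - 1 \<or>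
            deg H (v i) = k - 1 \<and> deg H (v (Suc i)) = 3"
          using edge_cycle_from_leafless[where D = "deg H", OF psubset.hyps c2 2 assms(2)] by blast
        then interpret edge_cycle v n H by simp
        have "deg H (v i) + deg H (v (Suc i)) \<le> card (L (c i)) + 2" for i
          using alt[of i] psubset.prems(3)[OF edge_H, of i] assms(2) unfolding c_def by linarith
        then interpret ext: cycle_extension meets c n "H - range c" L by (rule cycle_extension_outer)
        obtain j where j: "deg H (v j) = 3" "deg H (v (Suc j)) = k - 1"
          using alt[of 0] alt[of 1] assms(2) by (cases "deg H (v 0) = 3") auto
        obtain \<theta> where \<theta>: "line.colors (H - range c) L \<theta>" "3 \<le> card (ext.avail \<theta> (c j))"
          using loose_coloring_exists[where L = L, OF psubset.prems(1) assms(2) psubset.prems(2,3) j] unfolding ext.avail_def by blast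
        have "line.all_equivalent (H - range c) L" by (rule sub) (use range_c_sub in auto)
        then have "line.all_equivalent (H - range c \<union> range c) L"
          by (rule ext.all_equivalent_cycle[OF _ \<theta>])
        moreover have "H - range c \<union> range c = H" using range_c_sub by blast
        ultimately show ?thesis by simp
      qed
    qed
  qed
qed

section \<open>Kempe swaps\<close>

lemma line_graph_edge_iff: "{e, f} \<in> edges (line_graph (V, E)) \<longleftrightarrow> e \<in> E \<and> f \<in> E \<and> meets e f"
  unfolding line_graph_def meets_def by (auto simp: doubleton_eq_iff)

lemma L_coloring_line_graph:
  "L_coloring (line_graph (V, E)) L \<phi> \<longleftrightarrow> line.colors E L \<phi> \<and> \<phi> \<in> extensional E"
  unfolding L_coloring_def line.colors_def line_graph_edge_iff
  by (auto simp: line_graph_def PiE_def Pi_def)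

text \<open>\<open>K\<close> is a union of Kempe components, which are swapped one at a time. Each
  intermediate coloring stays within the lists because on every edge it agrees with \<phi> or with
  the swap of all of \<open>K\<close>.\<close>

lemma valid_swaps_of_swap_set:
  assumes "finite K" "\<alpha> \<noteq> \<beta>" "L_coloring (line_graph (V, E)) L \<phi>" "line.swap_set E \<phi> \<alpha> \<beta> K"
    "\<And>e. e \<in> K \<Longrightarrow> line.swap \<alpha> \<beta> K \<phi> e \<in> L e"
  shows "(valid_swap (line_graph (V, E)) L)\<^sup>*\<^sup>* \<phi> (line.swap \<alpha> \<beta> K \<phi>)"
  using assms
proof (induction K arbitrary: \<phi> rule: finite_psubset_induct)
  case (psubset K)
  let ?J = "line_graph (V, E)"
  note KE = line.swap_setD(1)[OF psubset.prems(3)] and K\<phi> = line.swap_setD(2)[OF psubset.prems(3)]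
    and Kcl = line.swap_setD(3)[OF psubset.prems(3)]
  have col: "line.colors E L \<phi>" "\<phi> \<in> extensional E" using psubset.prems(2) unfolding L_coloring_line_graph by blast+
  show ?case
  proof (cases "K = {}")
    case True
    then have "line.swap \<alpha> \<beta> K \<phi> = \<phi>" by (simp add: line.swap_def fun_eq_iff)
    then show ?thesis by simp
  next
    case False
    then obtain x where x: "x \<in> K" by blast
    let ?I = "induced_subgraph ?J {e. \<phi> e = \<alpha> \<or> \<phi> e = \<beta>}"
    define R where "R = (\<lambda>u v. {u, v} \<in> edges ?I)"
    have R: "R e f \<longleftrightarrow> e \<in> E \<and> f \<in> E \<and> meets e f \<and> (\<phi> e = \<alpha> \<or> \<phi> e = \<beta>) \<and> (\<phi> f = \<alpha> \<or> \<phi> f = \<beta>)" for e f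
      unfolding R_def induced_subgraph_def using line_graph_edge_iff[of e f V E] by auto
    define X where "X = {y. R\<^sup>*\<^sup>* x y}"
    have xX: "x \<in> X" by (simp add: X_def)
    have XK: "X \<subseteq> K"
    proof
      fix y assume "y \<in> X"
      then have "R\<^sup>*\<^sup>* x y" by (simp add: X_def)
      then show "y \<in> K"
        by (induction rule: rtranclp_induct) (use x in \<open>simp\<close>, metis R Kcl)
    qed
    have "x \<in> verts ?I" using x KE K\<phi>[OF x] by (auto simp: induced_subgraph_def line_graph_def)
    then have comp: "X \<in> graph_components ?I" unfolding graph_components_def X_def R_def by blast
    have Xcl: "w \<in> X" if "v \<in> X" "w \<in> E" "meets v w" "\<phi> w = \<alpha> \<or> \<phi> w = \<beta>" for v w
    proof -
      have "v \<in> K" using that(1) XK by blast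
      then have "R v w" using that KE K\<phi>[of v] unfolding R by blast
      then show ?thesis using that(1) unfolding X_def by (simp add: rtranclp.rtrancl_into_rtrancl)
    qed
    let ?\<phi> = "line.swap \<alpha> \<beta> X \<phi>"
    have X: "line.swap_set E \<phi> \<alpha> \<beta> X"
      by (rule line.swap_setI) (use XK KE K\<phi> Xcl in auto)
    have "line.step E L \<phi> ?\<phi>"
    proof (rule line.step_swap[OF col(1) X])
      show "line.swap \<alpha> \<beta> X \<phi> e \<in> L e" if "e \<in> X" for e
        using psubset.prems(4)[of e] that XK by (auto simp: line.swap_def)
    qed simp
    then have "line.colors E L ?\<phi>" by (simp add: line.step_def)
    moreover have "?\<phi> \<in> extensional E" using col(2) XK KE by (auto simp: extensional_def line.swap_def)
    ultimately have \<phi>': "L_coloring ?J L ?\<phi>" unfolding L_coloring_line_graph by blast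
    have "kempe_swap ?J \<alpha> \<beta> \<phi> ?\<phi>"
      unfolding kempe_swap_def using psubset.prems(1) comp by (intro conjI bexI[of _ X]) (auto simp: line.swap_def)
    then have 1: "valid_swap ?J L \<phi> ?\<phi>" using psubset.prems(2) \<phi>' unfolding valid_swap_def by blast
    have K': "line.swap_set E ?\<phi> \<alpha> \<beta> (K - X)"
    proof (rule line.swap_setI)
      show "?\<phi> v = \<alpha> \<or> ?\<phi> v = \<beta>" if "v \<in> K - X" for v using K\<phi>[of v] that by (auto simp: line.swap_def)
      show "w \<in> K - X" if vw: "v \<in> K - X" "w \<in> E" "meets v w" "?\<phi> w = \<alpha> \<or> ?\<phi> w = \<beta>" for v w
      proof -
        have "w \<notin> X"
        proof
          assume "w \<in> X"
          then have "v \<in> X" using Xcl[of w v] vw KE K\<phi>[of v] line.adj_sym[OF vw(3)] by blast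
          then show False using vw(1) by blast
        qed
        moreover have "w \<in> K" using Kcl[of v w] vw \<open>w \<notin> X\<close> by (simp add: line.swap_def)
        ultimately show ?thesis by blast
      qed
    qed (use KE in blast)
    have eq: "line.swap \<alpha> \<beta> (K - X) ?\<phi> = line.swap \<alpha> \<beta> K \<phi>"
      using XK by (auto simp: line.swap_def fun_eq_iff)
    have "(valid_swap ?J L)\<^sup>*\<^sup>* ?\<phi> (line.swap \<alpha> \<beta> (K - X) ?\<phi>)"
    proof (rule psubset.IH[OF _ psubset.prems(1) \<phi>' K'])
      show "K - X \<subset> K" using x xX by blast
      show "line.swap \<alpha> \<beta> (K - X) ?\<phi> e \<in> L e" if "e \<in> K - X" for e
        unfolding eq using psubset.prems(4) that by blast
    qed
    then show ?thesis unfolding eq using 1 by (meson converse_rtranclp_into_rtranclp)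
  qed
qed

text \<open>Steps fix colorings only on \<open>E\<close>, while valid swaps act on extensional
  functions; restricting every coloring of the sequence to \<open>E\<close> bridges the gap.\<close>

lemma valid_swaps_of_steps:
  assumes "finite E" "L_coloring (line_graph (V, E)) L \<phi>" "line.steps E L \<phi> \<psi>"
  shows "(valid_swap (line_graph (V, E)) L)\<^sup>*\<^sup>* \<phi> (restrict \<psi> E)"
  using assms(3)
proof (induction rule: rtranclp_induct)
  case base
  have "restrict \<phi> E = \<phi>" using assms(2) unfolding L_coloring_line_graph by (simp add: extensional_restrict)
  then show ?case by simp
next
  case (step \<eta> \<zeta>)
  let ?\<eta> = "restrict \<eta> E"
  have st: "line.step E L ?\<eta> \<zeta>" by (rule line.step_cong_left[OF step.hyps(2)]) simp
  then obtain \<alpha> \<beta> K where K: "line.swap_set E ?\<eta> \<alpha> \<beta> K" "\<And>e. e \<in> E \<Longrightarrow> \<zeta> e = line.swap \<alpha> \<beta> K ?\<eta> e"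
    and c: "line.colors E L ?\<eta>" "line.colors E L \<zeta>"
    unfolding line.step_def by blast
  note KE = line.swap_setD(1)[OF K(1)]
  have eq: "restrict \<zeta> E = line.swap \<alpha> \<beta> K ?\<eta>"
  proof
    fix e show "restrict \<zeta> E e = line.swap \<alpha> \<beta> K ?\<eta> e"
      using K(2)[of e] KE by (cases "e \<in> E") (auto simp: line.swap_def)
  qed
  show ?case
  \<comment> \<open>Steps admit equal colors and Kempe swaps do not; such a step changes
    nothing.\<close>
  proof (cases "\<alpha> = \<beta>")
    case True
    have "line.swap \<alpha> \<beta> K ?\<eta> = ?\<eta>"
    proof
      fix e show "line.swap \<alpha> \<beta> K ?\<eta> e = ?\<eta> e"
        using line.swap_setD(2)[OF K(1), of e] True unfolding line.swap_def by metis
    qed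
    then show ?thesis using step.IH eq by simp
  next
    case False
    have "(valid_swap (line_graph (V, E)) L)\<^sup>*\<^sup>* ?\<eta> (line.swap \<alpha> \<beta> K ?\<eta>)"
    proof (rule valid_swaps_of_swap_set[OF finite_subset[OF KE assms(1)] False _ K(1)])
      show "L_coloring (line_graph (V, E)) L ?\<eta>" using c(1) by (simp add: L_coloring_line_graph)
      show "line.swap \<alpha> \<beta> K ?\<eta> e \<in> L e" if "e \<in> K" for e
        using K(2)[of e] c(2) that KE unfolding line.colors_def by (metis subsetD)
    qed
    then show ?thesis unfolding eq by (rule rtranclp_trans[OF step.IH])
  qed
qed

theorem theorem4:
  fixes G :: "'a graph"
    and p :: "'a \<Rightarrow> complex"
    and c :: "'a set \<Rightarrow> real \<Rightarrow> complex"
    and J :: "'a set graph"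
    and k :: nat
    and L :: "'a set \<Rightarrow> 'c set"
  assumes "plane_graph G p c"
    and "J = line_graph G"
    and "k = max 10 (max_degree G + 1)"
    and "k_assignment k J L"
  shows "swappable J L"
proof -
  obtain V E where G: "G = (V, E)" by (cases G)
  have sparse: "planar_sparse E" using assms(1) planar_sparse_plane_graph unfolding G by blast
  have simple: "finite V" "\<And>e. e \<in> E \<Longrightarrow> e \<subseteq> V"
    using assms(1) unfolding G plane_graph_def simple_graph_def by auto
  have "deg E v < k" if v: "v \<in> \<Union>E" for v
  proof -
    have "degree G v \<in> insert 0 (degree G ` V)" using v simple(2) by blast
    then have "degree G v \<le> max_degree G"
      unfolding max_degree_def using simple(1) by (simp add: G)
    then show ?thesis using assms(3) unfolding degree_def by (simp add: G)
  qed
  moreover have "card (L e) = k" if "e \<in> E" for e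
    using assms(2,4) that unfolding k_assignment_def by (simp add: G line_graph_def)
  ultimately have all: "line.all_equivalent E L"
    using edge_colorings_all_equivalent[OF sparse, of k L] assms(3) by simp
  show ?thesis
    unfolding swappable_def
  proof (intro allI impI)
    fix \<phi> \<psi> assume \<phi>: "L_coloring J L \<phi>" and \<psi>: "L_coloring J L \<psi>"
    note col = \<phi>[unfolded assms(2) G L_coloring_line_graph] \<psi>[unfolded assms(2) G L_coloring_line_graph]
    have "line.steps E L \<phi> \<psi>" using all col unfolding line.all_equivalent_def by blast
    then have "(valid_swap (line_graph (V, E)) L)\<^sup>*\<^sup>* \<phi> (restrict \<psi> E)"
      using valid_swaps_of_steps planar_sparseD(1)[OF sparse] \<phi> unfolding assms(2) G by blast
    then show "(valid_swap J L)\<^sup>*\<^sup>* \<phi> \<psi>" using col(2) unfolding assms(2) G by (simp add: extensional_restrict)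
  qed
qed

end
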